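(* Let $\mathbb{H}^1$ be the Heisenberg group of homogeneous dimension $Q=4$, with sub-Laplacian $\mathcal{L}_{\mathbb{H}^1}$. Let $f:[0,\infty)\to[0,\infty)$ be continuous and convex with $f(0)=0$ and $f(v)>0$ for $v>0$, such that $$\int_1^{+\infty}\frac{1}{f_m(v)}\,dv<+\infty\quad\text{and}\quad\lim_{v\to0^+}\frac{f_M(v)}{v}=0,$$ where $$f_m(v):=\inf_{\alpha\in(0,1)}\frac{f(\alpha v)}{f(\alpha)},\qquad f_M(v):=\sup_{\alpha\in(0,1)}\frac{f(\alpha v)}{f(\alpha)} .$$ Let $0\le\varphi\in C[0,+\infty)$. Then the following statements are equivalent: (a) for all $0<w\in C_0(\mathbb{H}^1)\cap L^1(\mathbb{H}^1)$, $$\int_0^\infty\varphi(\tau)\frac{f(\|e^{\tau\mathcal{L}_{\mathbb{H}^1}}w\|_{L^\infty(\mathbb{H}^1)})}{\|e^{\tau\mathcal{L}_{\mathbb{H}^1}}w\|_{L^\infty(\mathbb{H}^1)}}\,d\tau=+\infty ;$$ (b) for all $\varepsilon>0$, $\displaystyle\int_1^\infty\varphi(\tau)\,\tau^2f(\varepsilon\tau^{-2})\,d\tau=+\infty$; (c) for all $0<u_0\in C_0(\mathbb{H}^1)\cap L^1(\mathbb{H}^1)$ there exists no global solution of the Cauchy problem $$u_t(t,x)-\mathcal{L}_{\mathbb{H}^1}u(t,x)=\varphi(t)f(u(t,x)),\quad (t,x)\in\mathbb{R}_+\times\mathbb{H}^1,\qquad u(0,x)=u_0(x),\quad x\in\mathbb{H}^1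 .$$
   Context: The Heisenberg group $\mathbb{H}^1\cong\mathbb{C}\times\mathbb{R}$ has elements $x=(\xi,\zeta)$, $\xi=g+\mathrm{i}v$ with $g,v\in\mathbb{R}$, and group law $(\xi,\zeta)\circ(\xi',\zeta')=(\xi+\xi',\zeta+\zeta'+2\,\mathrm{Im}(\xi\,\overline{\xi'}))$. The left-invariant vector fields are $X=\partial_g+2v\,\partial_\zeta$, $Y=\partial_v-2g\,\partial_\zeta$, and the sub-Laplacian is $\mathcal{L}_{\mathbb{H}^1}=X^2+Y^2$. The Haar measure $dx$ is Lebesgue measure. $e^{t\mathcal{L}_{\mathbb{H}^1}}$, $t>0$, is the heat semigroup, $e^{t\mathcal{L}_{\mathbb{H}^1}}g(x)=\int_{\mathbb{H}^1}p_t(y^{-1}x)g(y)\,dy$, with $p_t>0$ the heat kernel of $\partial_t-\mathcal{L}_{\mathbb{H}^1}$. $C_0(\mathbb{H}^1)$ is the space of continuous functions vanishing at infinity; $0<w$ means $w(x)>0$ for all $x$. Solutions of the Cauchy problem are (positive) functions $u$ satisfying $$u(t,x)=e^{t\mathcal{L}_{\mathbb{H}^1}}u_0(x)+\int_0^t e^{(t-\tau)\mathcal{L}_{\mathbb{H}^1}}\varphi(\tau)f(u(\tau,\cdot))(x)\,d\tau ;$$ the solution is global if it is defined for all $t>0$ and $\|u(t,\cdot)\|_{L^\infty(\mathbb{H}^1)}<\infty$ for all $t>0$. The supremum defining $f_M$ is taken in $[0,+\infty]$. *)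

theory Defs
  imports "HOL-Probability.Probability"
begin

section \<open>The Heisenberg group\<close>

type_synonym heis = "complex \<times> real"

fun hmul :: "heis \<Rightarrow> heis \<Rightarrow> heis"  (infixl "\<odot>" 70) where
  "(\<xi>, \<zeta>) \<odot> (\<xi>', \<zeta>') = (\<xi> + \<xi>', \<zeta> + \<zeta>' + 2 * Im (\<xi> * cnj \<xi>'))"

definition hinv :: "heis \<Rightarrow> heis" where
  "hinv x = (- fst x, - snd x)"

lemma hmul_assoc: "(x \<odot> y) \<odot> z = x \<odot> (y \<odot> z)"
  by (cases x; cases y; cases z) (simp add: algebra_simps)

lemma hmul_0_left: "(0, 0) \<odot> x = x"
  by (cases x) simp

lemma hmul_hinv_left: "hinv x \<odot> x = (0, 0)"
  by (cases x) (simp add: hinv_def)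

definition d_g :: "(heis \<Rightarrow> real) \<Rightarrow> heis \<Rightarrow> real" where
  "d_g h = (\<lambda>(\<xi>, \<zeta>). deriv (\<lambda>g. h (Complex g (Im \<xi>), \<zeta>)) (Re \<xi>))"

definition d_v :: "(heis \<Rightarrow> real) \<Rightarrow> heis \<Rightarrow> real" where
  "d_v h = (\<lambda>(\<xi>, \<zeta>). deriv (\<lambda>v. h (Complex (Re \<xi>) v, \<zeta>)) (Im \<xi>))"

definition d_zeta :: "(heis \<Rightarrow> real) \<Rightarrow> heis \<Rightarrow> real" where
  "d_zeta h = (\<lambda>(\<xi>, \<zeta>). deriv (\<lambda>s. h (\<xi>, s)) \<zeta>)"

definition X_field :: "(heis \<Rightarrow> real) \<Rightarrow> heis \<Rightarrow> real" where
  "X_field h x = d_g h x + 2 * Im (fst x) * d_zeta h x"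

definition Y_field :: "(heis \<Rightarrow> real) \<Rightarrow> heis \<Rightarrow> real" where
  "Y_field h x = d_v h x - 2 * Re (fst x) * d_zeta h x"

definition sub_laplacian :: "(heis \<Rightarrow> real) \<Rightarrow> heis \<Rightarrow> real" where
  "sub_laplacian h x = X_field (X_field h) x + Y_field (Y_field h) x"


section \<open>Heat kernel and heat semigroup\<close>

text \<open>The class of \<open>k\<close> times continuously differentiable functions; only meaningful for open \<open>S\<close>.\<close>

fun Ck_on :: "nat \<Rightarrow> 'a::euclidean_space set \<Rightarrow> ('a \<Rightarrow> real) \<Rightarrow> bool" where
  "Ck_on 0 S h \<longleftrightarrow> continuous_on S h"
| "Ck_on (Suc k) S h \<longleftrightarrow>
     h differentiable_on S \<and> (\<forall>b\<in>Basis. Ck_on k S (\<lambda>x. frechet_derivative h (at x) b))"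

definition smooth_on :: "'a::euclidean_space set \<Rightarrow> ('a \<Rightarrow> real) \<Rightarrow> bool" where
  "smooth_on S h \<longleftrightarrow> (\<forall>k. Ck_on k S h)"

text \<open>
  \<open>p\<close> is the heat kernel of \<open>\<partial>\<^sub>t - \<L>\<close>: the positive fundamental solution with pole at the group
  identity, a smooth probability density for every \<open>t > 0\<close> that tends weakly to the Dirac measure
  at \<open>(0, 0)\<close> as \<open>t\<close> decreases to \<open>0\<close>.  By the maximum principle for bounded solutions these
  conditions determine \<open>p t x\<close> for all \<open>t > 0\<close>; the values for \<open>t \<le> 0\<close> are irrelevant.
\<close>

definition heat_kernel :: "(real \<Rightarrow> heis \<Rightarrow> real) \<Rightarrow> bool" where
  "heat_kernel p \<longleftrightarrow>
     smooth_on ({0<..} \<times> UNIV) (\<lambda>(t, x). p t x) \<and>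
     (\<forall>t>0. \<forall>x. p t x > 0) \<and>
     (\<forall>t>0. \<forall>x. deriv (\<lambda>s. p s x) t = sub_laplacian (p t) x) \<and>
     (\<forall>t>0. has_bochner_integral lborel (p t) 1) \<and>
     (\<forall>g. continuous_on UNIV g \<and> bounded (range g) \<longrightarrow>
        ((\<lambda>t. \<integral>y. p t y * g y \<partial>lborel) \<longlongrightarrow> g (0, 0)) (at_right 0))"

text \<open>
  The semigroup is only applied to nonnegative functions, so it is taken with values in
  \<open>[0, \<infinity>]\<close>; then every integral is meaningful without an integrability condition.
\<close>

definition heat_semigroup ::
    "(real \<Rightarrow> heis \<Rightarrow> real) \<Rightarrow> real \<Rightarrow> (heis \<Rightarrow> ennreal) \<Rightarrow> heis \<Rightarrow> ennreal" where
  "heat_semigroup p t h x = (\<integral>\<^sup>+y. ennreal (p t (hinv y \<odot> x)) * h y \<partial>lborel)"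

definition Linf_norm :: "(heis \<Rightarrow> ennreal) \<Rightarrow> ennreal" where
  "Linf_norm h = esssup lborel h"

definition heat_norm :: "(real \<Rightarrow> heis \<Rightarrow> real) \<Rightarrow> (heis \<Rightarrow> real) \<Rightarrow> real \<Rightarrow> real" where
  "heat_norm p w \<tau> = enn2real (Linf_norm (heat_semigroup p \<tau> (\<lambda>y. ennreal (w y))))"


section \<open>The Cauchy problem\<close>

definition pos_C0_L1 :: "(heis \<Rightarrow> real) set" where
  "pos_C0_L1 = {w. (\<forall>x. w x > 0) \<and> continuous_on UNIV w \<and> (w \<longlongrightarrow> 0) at_infinity \<and>
                   integrable lborel w}"

text \<open>
  Solutions are understood in the mild sense: the initial condition is encoded in the Duhamel
  formula.  Since \<open>u t x\<close> is real, that formula also says that its right-hand side is finite.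
\<close>

definition global_solution ::
    "(real \<Rightarrow> heis \<Rightarrow> real) \<Rightarrow> (real \<Rightarrow> real) \<Rightarrow> (real \<Rightarrow> real) \<Rightarrow> (heis \<Rightarrow> real) \<Rightarrow>
     (real \<Rightarrow> heis \<Rightarrow> real) \<Rightarrow> bool" where
  "global_solution p \<phi> f u\<^sub>0 u \<longleftrightarrow>
     (\<lambda>(t, x). u t x) \<in> borel_measurable (restrict_space borel ({0<..} \<times> UNIV)) \<and>
     (\<forall>t>0. \<forall>x. u t x > 0) \<and>
     (\<forall>t>0. \<forall>x. ennreal (u t x) =
        heat_semigroup p t (\<lambda>y. ennreal (u\<^sub>0 y)) x +
        (\<integral>\<^sup>+\<tau>\<in>{0<..<t}. heat_semigroup p (t - \<tau>) (\<lambda>y. ennreal (\<phi> \<tau> * f (u \<tau> y))) x \<partial>lborel)) \<and>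
     (\<forall>t>0. Linf_norm (\<lambda>x. ennreal (u t x)) < \<infinity>)"

definition lower_ratio :: "(real \<Rightarrow> real) \<Rightarrow> real \<Rightarrow> ennreal" where
  "lower_ratio f v = (INF \<alpha>\<in>{0<..<1}. ennreal (f (\<alpha> * v) / f \<alpha>))"

definition upper_ratio :: "(real \<Rightarrow> real) \<Rightarrow> real \<Rightarrow> ennreal" where
  "upper_ratio f v = (SUP \<alpha>\<in>{0<..<1}. ennreal (f (\<alpha> * v) / f \<alpha>))"

end

theory Submission
  imports Defs
begin

text \<open>
  The kernel is only known through its defining properties, so scaling and symmetry come from
  uniqueness. By a maximum principle for solutions bounded below, the evolution of compactly
  supported data is unique; as the reflected dilations \<open>(\<xi>, \<zeta>) \<mapsto> (c \<xi>\<^sup>*, - \<bar>c\<bar>\<^sup>2 \<zeta>)\<close>, where \<open>\<xi>\<^sup>*\<close> is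
  the complex conjugate, preserve the heat equation up to the factor \<open>\<bar>c\<bar>\<^sup>2\<close> in time, this gives
  \<open>p t x = t\<^sup>-\<^sup>2 p 1 (\<dots>)\<close> and \<open>p t (x\<^sup>-\<^sup>1) = p t x\<close>. The same principle gives
  \<open>p s * p t \<le> p (s + t)\<close>, and symmetry then bounds \<open>p 2\<close> by \<open>p 2 0\<close>. Hence norms of linear
  evolutions decay exactly like \<open>t\<^sup>-\<^sup>2\<close>, and (a) and (b) are equivalent by monotonicity of \<open>f v / v\<close>.

  If (b) fails, \<open>u\<^sub>0\<close> small makes twice the linear evolution a supersolution, and monotone
  iteration yields a global solution. If (b) holds, let \<open>\<Lambda> T\<close> be the mass of a global solution at
  time \<open>T\<close> in a box \<open>B\<^sub>T\<close> of parabolic size \<open>T\<close>. The heat flow keeps a fixed fraction of the mass of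
  the smaller boxes inside \<open>B\<^sub>T\<close>, so Jensen's inequality gives
  \<open>\<Lambda> T \<ge> c (1 + \<integral>\<^sub>1\<^sup>T \<phi> \<tau> \<bar>B\<^sub>\<tau>\<bar> f(\<Lambda> \<tau> / \<bar>B\<^sub>\<tau>\<bar>) d\<tau>)\<close>, which is incompatible with (b) since \<open>1 / f\<^sub>m\<close> is
  integrable.
\<close>

section \<open>Lebesgue measure on the group\<close>

text \<open>The obstacle is that no formula and no Gaussian estimate for the kernel is at hand:
  everything must come from smoothness, positivity, mass 1, the equation and the weak limit. Besides
  the semigroup inequality, two kernel bounds suffice, an upper bound of order t^-2 everywhere and a
  lower bound of the same order on the parabolic region of scale t; scaling reduces each to a single
  time. Boxes replace Gaussian weights: their volume 8 T^2 is reciprocal to the kernel decay, and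
  membership is checked coordinate by coordinate. The family \<open>refl_dil\<close> does double
  duty: the modulus of its parameter gives scaling, and for each point some unimodular parameter
  carries it to its inverse. The two ratio conditions enter once each. The lower ratio bounds
  \<open>f (\<alpha> * W)\<close> below by a time weight \<open>f \<alpha>\<close> times a growth
  factor \<open>fm W\<close>, which separates the variables in the mass inequality. The upper ratio
  is needed because failure of (b) only makes an integral finite, whereas the supersolution needs it
  to be at most 1/2: lowering the data by a suitable factor \<open>s\<close> brings in an
  arbitrarily small factor \<open>q\<close>.\<close>

lemma nn_integral_lborel_translate:
  fixes t :: "'a::euclidean_space"
  assumes [measurable]: "F \<in> borel_measurable borel"
  shows "(\<integral>\<^sup>+x. F (t + x) \<partial>lborel) = (\<integral>\<^sup>+x. F x \<partial>lborel)"
proof -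
  have "(\<integral>\<^sup>+x. F x \<partial>lborel) = (\<integral>\<^sup>+x. F x \<partial>distr lborel borel ((+) t))"
    by (simp add: lborel_distr_plus)
  also have "\<dots> = (\<integral>\<^sup>+x. F (t + x) \<partial>lborel)"
    by (subst nn_integral_distr) auto
  finally show ?thesis by simp
qed

text \<open>Boxes determine Lebesgue measure, and \<open>Complex\<close> carries rectangles to
  boxes. This opens integrals over the complex plane to one-dimensional substitutions.\<close>

lemma lborel_complex_eq_distr:
  "(lborel :: complex measure) = distr (lborel \<Otimes>\<^sub>M lborel) borel (\<lambda>(x, y). Complex x y)"
proof (rule lborel_eqI)
  have meas: "(\<lambda>(x, y). Complex x y) \<in> borel_measurable (lborel \<Otimes>\<^sub>M lborel)"
  proof -
    have "continuous_on UNIV (\<lambda>(x, y). Complex x y)"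
      by (auto simp: Complex_eq split_beta intro!: continuous_intros)
    then show ?thesis
      by (subst lborel_prod) (simp add: borel_measurable_continuous_onI)
  qed
  fix l u :: complex
  assume lu: "\<And>b. b \<in> Basis \<Longrightarrow> l \<bullet> b \<le> u \<bullet> b"
  have le: "Re l \<le> Re u" "Im l \<le> Im u"
    using lu[of 1] lu[of \<i>] by (auto simp: Basis_complex_def inner_complex_def)
  have "(\<lambda>(x, y). Complex x y) -` box l u \<inter> space (lborel \<Otimes>\<^sub>M lborel) =
      {Re l<..<Re u} \<times> {Im l<..<Im u}"
    by (auto simp: box_def Basis_complex_def inner_complex_def space_pair_measure)
  then show "emeasure (distr (lborel \<Otimes>\<^sub>M lborel) borel (\<lambda>(x, y). Complex x y)) (box l u) =
      ennreal (\<Prod>b\<in>Basis. (u - l) \<bullet> b)"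
    using le by (simp add: emeasure_distr meas lborel.emeasure_pair_measure_Times
        Basis_complex_def inner_complex_def ennreal_mult)
qed simp

lemma nn_integral_lborel_complex:
  assumes [measurable]: "F \<in> borel_measurable borel"
  shows "(\<integral>\<^sup>+z. F z \<partial>(lborel :: complex measure)) = (\<integral>\<^sup>+y. \<integral>\<^sup>+x. F (Complex x y) \<partial>lborel \<partial>lborel)"
proof -
  have "continuous_on UNIV (\<lambda>(x, y). Complex x y)"
    by (auto simp: Complex_eq split_beta intro!: continuous_intros)
  then have [measurable]: "(\<lambda>(x, y). Complex x y) \<in> borel_measurable (lborel \<Otimes>\<^sub>M lborel)"
    by (subst lborel_prod) (simp add: borel_measurable_continuous_onI)
  have "(\<integral>\<^sup>+z. F z \<partial>(lborel :: complex measure)) =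
      (\<integral>\<^sup>+w. F (Complex (fst w) (snd w)) \<partial>(lborel \<Otimes>\<^sub>M lborel))"
    by (subst lborel_complex_eq_distr, subst nn_integral_distr) (auto simp: split_beta)
  also have "\<dots> = (\<integral>\<^sup>+y. \<integral>\<^sup>+x. F (Complex x y) \<partial>lborel \<partial>lborel)"
    by (subst lborel_pair.nn_integral_snd[symmetric]) (auto simp: split_beta)
  finally show ?thesis .
qed

lemma nn_integral_lborel_heis:
  assumes [measurable]: "F \<in> borel_measurable (borel :: heis measure)"
  shows "(\<integral>\<^sup>+z. F z \<partial>lborel) = (\<integral>\<^sup>+\<xi>. \<integral>\<^sup>+\<zeta>. F (\<xi>, \<zeta>) \<partial>lborel \<partial>lborel)"
proof -
  have "F \<in> borel_measurable (lborel \<Otimes>\<^sub>M lborel)"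
    unfolding lborel_prod using assms by simp
  from lborel.nn_integral_fst[OF this] show ?thesis
    unfolding lborel_prod by simp
qed

text \<open>The map is real linear with matrix rows \<open>(a, b)\<close> and
  \<open>(b, - a)\<close>, hence with determinant of modulus |c|^2. Two one-dimensional affine
  substitutions, one per variable, replace a change of variables in the plane.\<close>

lemma nn_integral_conj_rot:
  assumes [measurable]: "F \<in> borel_measurable (borel :: complex measure)" and "c \<noteq> 0"
  shows "ennreal ((cmod c)\<^sup>2) * (\<integral>\<^sup>+z. F (c * cnj z) \<partial>lborel) = (\<integral>\<^sup>+z. F z \<partial>lborel)"
proof -
  define a b where "a = Re c" and "b = Im c"
  have comp: "c * cnj (Complex x y) = Complex (a * x + b * y) (b * x - a * y)" for x y
    by (simp add: complex_eq_iff a_def b_def)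
  have cm: "(cmod c)\<^sup>2 = a\<^sup>2 + b\<^sup>2"
    by (simp add: cmod_power2 a_def b_def)
  have C[measurable]: "(\<lambda>w. Complex (g w) (h w)) \<in> borel_measurable M"
    if [measurable]: "g \<in> borel_measurable M" "h \<in> borel_measurable M" for g h and M :: "'x measure"
    unfolding Complex_eq by measurable
  have [measurable]: "(\<lambda>z. F (c * cnj z)) \<in> borel_measurable borel"
    by (intro measurable_compose[OF _ assms(1)] borel_measurable_continuous_onI continuous_intros)
  have fub: "(\<integral>\<^sup>+v. \<integral>\<^sup>+u. G u v \<partial>lborel \<partial>lborel) = (\<integral>\<^sup>+u. \<integral>\<^sup>+v. G u v \<partial>lborel \<partial>lborel)"
    if [measurable]: "(\<lambda>(u, v). G u v) \<in> borel_measurable (lborel \<Otimes>\<^sub>M lborel)"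
    for G :: "real \<Rightarrow> real \<Rightarrow> ennreal"
    by (rule lborel_pair.Fubini') (use that in measurable)
  have fubF: "(\<integral>\<^sup>+v. \<integral>\<^sup>+u. F (Complex u v) \<partial>lborel \<partial>lborel) =
      (\<integral>\<^sup>+u. \<integral>\<^sup>+v. F (Complex u v) \<partial>lborel \<partial>lborel)"
    by (rule fub) measurable
  show ?thesis
  proof (cases "a = 0")
    case False
    \<comment> \<open>Eliminating \<open>x\<close> through \<open>u = a * x + b * y\<close> turns
      the second coordinate \<open>b * x - a * y\<close> into \<open>b / a * u + k * y\<close>; the
      moduli of the two scale factors multiply to \<open>a\<^sup>2 + b\<^sup>2\<close>.\<close>
    define k where "k = - ((a\<^sup>2 + b\<^sup>2) / a)"
    have pos: "a\<^sup>2 + b\<^sup>2 > 0"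
      using False by (simp add: sum_power2_gt_zero_iff)
    have k: "k \<noteq> 0" "\<bar>k\<bar> * \<bar>a\<bar> = a\<^sup>2 + b\<^sup>2"
      using False pos by (auto simp: k_def abs_mult[symmetric])
    have 1: "ennreal \<bar>a\<bar> * (\<integral>\<^sup>+x. F (Complex (a * x + b * y) (b * x - a * y)) \<partial>lborel) =
        (\<integral>\<^sup>+u. F (Complex u (b / a * u + k * y)) \<partial>lborel)" for y
    proof -
      have "b / a * (b * y + a * x) + k * y = b * x - a * y" for x
        using False by (simp add: k_def field_simps power2_eq_square)
      then show ?thesis
        using False
        by (subst nn_integral_real_affine[of "\<lambda>u. F (Complex u (b / a * u + k * y))" a "b * y"])
           (simp_all add: add.commute)
    qed
    have 2: "ennreal \<bar>k\<bar> * (\<integral>\<^sup>+y. F (Complex u (b / a * u + k * y)) \<partial>lborel) =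
        (\<integral>\<^sup>+v. F (Complex u v) \<partial>lborel)" for u
      using k(1)
      by (subst nn_integral_real_affine[of "\<lambda>v. F (Complex u v)" k "b / a * u"]) auto
    have "ennreal ((cmod c)\<^sup>2) * (\<integral>\<^sup>+z. F (c * cnj z) \<partial>lborel) =
        ennreal \<bar>k\<bar> * (\<integral>\<^sup>+y. ennreal \<bar>a\<bar> * (\<integral>\<^sup>+x. F (c * cnj (Complex x y)) \<partial>lborel) \<partial>lborel)"
      by (subst nn_integral_lborel_complex)
         (auto simp: cm k(2)[symmetric] ennreal_mult comp nn_integral_cmult mult.assoc)
    also have "\<dots> = ennreal \<bar>k\<bar> * (\<integral>\<^sup>+y. \<integral>\<^sup>+u. F (Complex u (b / a * u + k * y)) \<partial>lborel \<partial>lborel)"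
      by (simp add: comp 1)
    also have "\<dots> = ennreal \<bar>k\<bar> * (\<integral>\<^sup>+u. \<integral>\<^sup>+y. F (Complex u (b / a * u + k * y)) \<partial>lborel \<partial>lborel)"
      by (subst fub) auto
    also have "\<dots> = (\<integral>\<^sup>+u. ennreal \<bar>k\<bar> * (\<integral>\<^sup>+y. F (Complex u (b / a * u + k * y)) \<partial>lborel) \<partial>lborel)"
      by (simp add: nn_integral_cmult)
    also have "\<dots> = (\<integral>\<^sup>+z. F z \<partial>lborel)"
      by (simp add: 2[simplified] nn_integral_lborel_complex fubF)
    finally show ?thesis .
  next
    \<comment> \<open>Now the matrix is antidiagonal: each new coordinate is a multiple of a single
      old variable.\<close>
    case True
    then have b: "b \<noteq> 0" "\<bar>b\<bar> * \<bar>b\<bar> = b\<^sup>2" using \<open>c \<noteq> 0\<close>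
      by (auto simp: a_def b_def complex_eq_iff power2_eq_square)
    have 1: "ennreal \<bar>b\<bar> * (\<integral>\<^sup>+x. F (Complex u (b * x)) \<partial>lborel) = (\<integral>\<^sup>+v. F (Complex u v) \<partial>lborel)" for u
      using b(1) by (subst nn_integral_real_affine[of "\<lambda>v. F (Complex u v)" b 0]) auto
    have 2: "ennreal \<bar>b\<bar> * (\<integral>\<^sup>+y. \<integral>\<^sup>+v. F (Complex (b * y) v) \<partial>lborel \<partial>lborel) =
        (\<integral>\<^sup>+u. \<integral>\<^sup>+v. F (Complex u v) \<partial>lborel \<partial>lborel)"
      using b(1) by (subst nn_integral_real_affine[of "\<lambda>u. \<integral>\<^sup>+v. F (Complex u v) \<partial>lborel" b 0]) auto
    have bb: "ennreal ((cmod c)\<^sup>2) = ennreal \<bar>b\<bar> * ennreal \<bar>b\<bar>"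
      unfolding cm by (simp add: True ennreal_mult[symmetric] power2_eq_square)
    have "ennreal ((cmod c)\<^sup>2) * (\<integral>\<^sup>+z. F (c * cnj z) \<partial>lborel) =
        ennreal \<bar>b\<bar> * (\<integral>\<^sup>+y. ennreal \<bar>b\<bar> * (\<integral>\<^sup>+x. F (c * cnj (Complex x y)) \<partial>lborel) \<partial>lborel)"
      by (subst nn_integral_lborel_complex)
         (auto simp: bb comp True nn_integral_cmult mult.assoc)
    also have "\<dots> = (\<integral>\<^sup>+z. F z \<partial>lborel)"
      by (simp add: comp True 1 2 nn_integral_lborel_complex fubF)
    finally show ?thesis .
  qed
qed

text \<open>Conjugation reverses the sign of \<open>Im (\<xi> * cnj \<xi>')\<close>, so the last
  coordinate has to be negated for the map to be a group automorphism; the scale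
  \<open>(cmod c)\<^sup>2\<close> there is the parabolic one.\<close>

definition refl_dil :: "complex \<Rightarrow> heis \<Rightarrow> heis" where
  "refl_dil c z = (c * cnj (fst z), - (cmod c)\<^sup>2 * snd z)"

lemma continuous_on_hmul [continuous_intros]:
  assumes "continuous_on S g" "continuous_on S h"
  shows "continuous_on S (\<lambda>x. g x \<odot> h x)"
proof -
  have "g x \<odot> h x = (fst (g x) + fst (h x),
      snd (g x) + snd (h x) + 2 * Im (fst (g x) * cnj (fst (h x))))" for x
    by (cases "g x"; cases "h x") simp
  then show ?thesis
    using assms by (auto intro!: continuous_intros)
qed

lemma continuous_on_hinv [continuous_intros]:
  "continuous_on S g \<Longrightarrow> continuous_on S (\<lambda>x. hinv (g x))"
  unfolding hinv_def by (auto intro!: continuous_intros)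

lemma continuous_on_refl_dil [continuous_intros]:
  "continuous_on S g \<Longrightarrow> continuous_on S (\<lambda>x. refl_dil c (g x))"
  unfolding refl_dil_def by (auto intro!: continuous_intros)

lemma measurable_hmul [measurable (raw)]:
  assumes [measurable]: "g \<in> borel_measurable M" "h \<in> borel_measurable M"
  shows "(\<lambda>x. g x \<odot> h x) \<in> borel_measurable M"
proof -
  have "continuous_on UNIV (\<lambda>z. fst z \<odot> snd z)"
    by (intro continuous_intros)
  from measurable_compose[OF borel_measurable_Pair[OF assms] borel_measurable_continuous_onI[OF this]]
  show ?thesis by simp
qed

lemma measurable_hinv [measurable (raw)]:
  assumes "g \<in> borel_measurable M"
  shows "(\<lambda>x. hinv (g x)) \<in> borel_measurable M"
  by (rule measurable_compose[OF assms borel_measurable_continuous_onI]) (intro continuous_intros)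

lemma measurable_refl_dil [measurable (raw)]:
  assumes "g \<in> borel_measurable M"
  shows "(\<lambda>x. refl_dil c (g x)) \<in> borel_measurable M"
  by (rule measurable_compose[OF assms borel_measurable_continuous_onI]) (intro continuous_intros)

text \<open>For fixed \<open>\<xi>\<close> the last coordinate is shifted by an amount that depends
  on \<open>w\<close> and \<open>\<xi>\<close> alone, so translation invariance applies in
  \<open>\<zeta>\<close> and afterwards in \<open>\<xi>\<close>.\<close>

lemma nn_integral_hmul_left:
  assumes [measurable]: "F \<in> borel_measurable borel"
  shows "(\<integral>\<^sup>+z. F (w \<odot> z) \<partial>lborel) = (\<integral>\<^sup>+z. F z \<partial>lborel)"
proof -
  have "(\<integral>\<^sup>+z. F (w \<odot> z) \<partial>lborel) =
      (\<integral>\<^sup>+\<xi>. \<integral>\<^sup>+\<zeta>. F (fst w + \<xi>, (snd w + 2 * Im (fst w * cnj \<xi>)) + \<zeta>) \<partial>lborel \<partial>lborel)"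
    by (subst nn_integral_lborel_heis, simp) (cases w, simp add: algebra_simps)
  also have "\<dots> = (\<integral>\<^sup>+\<xi>. \<integral>\<^sup>+\<zeta>. F (fst w + \<xi>, \<zeta>) \<partial>lborel \<partial>lborel)"
    by (subst nn_integral_lborel_translate[of "\<lambda>\<zeta>. F (fst w + \<xi>, \<zeta>)" for \<xi>]) auto
  also have "\<dots> = (\<integral>\<^sup>+\<xi>. \<integral>\<^sup>+\<zeta>. F (\<xi>, \<zeta>) \<partial>lborel \<partial>lborel)"
    by (subst nn_integral_lborel_translate[of "\<lambda>\<xi>. \<integral>\<^sup>+\<zeta>. F (\<xi>, \<zeta>) \<partial>lborel"]) auto
  finally show ?thesis
    by (simp add: nn_integral_lborel_heis)
qed

text \<open>One factor \<open>(cmod c)\<^sup>2\<close> comes from the complex coordinate and one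
  from the last coordinate; the exponent 4 is the homogeneous dimension.\<close>

lemma nn_integral_refl_dil:
  assumes [measurable]: "F \<in> borel_measurable borel" and c: "c \<noteq> 0"
  shows "ennreal (cmod c ^ 4) * (\<integral>\<^sup>+z. F (refl_dil c z) \<partial>lborel) = (\<integral>\<^sup>+z. F z \<partial>lborel)"
proof -
  have 1: "ennreal ((cmod c)\<^sup>2) * (\<integral>\<^sup>+\<zeta>. F (\<xi>, - (cmod c)\<^sup>2 * \<zeta>) \<partial>lborel) =
      (\<integral>\<^sup>+\<zeta>. F (\<xi>, \<zeta>) \<partial>lborel)" for \<xi>
    using c by (subst nn_integral_real_affine[of "\<lambda>\<zeta>. F (\<xi>, \<zeta>)" "- (cmod c)\<^sup>2" 0]) auto
  have [measurable]: "cnj \<in> borel_measurable borel"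
    by (intro borel_measurable_continuous_onI continuous_intros)
  have [measurable]: "(\<lambda>\<xi>. \<integral>\<^sup>+\<zeta>. F (c * cnj \<xi>, - (cmod c)\<^sup>2 * \<zeta>) \<partial>lborel) \<in> borel_measurable borel"
    by measurable
  have "ennreal (cmod c ^ 4) * (\<integral>\<^sup>+z. F (refl_dil c z) \<partial>lborel) =
      ennreal ((cmod c)\<^sup>2) * (\<integral>\<^sup>+\<xi>. ennreal ((cmod c)\<^sup>2) *
        (\<integral>\<^sup>+\<zeta>. F (c * cnj \<xi>, - (cmod c)\<^sup>2 * \<zeta>) \<partial>lborel) \<partial>lborel)"
    by (subst nn_integral_lborel_heis, measurable)
       (auto simp: refl_dil_def nn_integral_cmult mult.assoc[symmetric] ennreal_mult[symmetric] power_add[symmetric])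
  also have "\<dots> = (\<integral>\<^sup>+\<xi>. \<integral>\<^sup>+\<zeta>. F (\<xi>, \<zeta>) \<partial>lborel \<partial>lborel)"
    by (subst 1) (rule nn_integral_conj_rot; use c in measurable)
  finally show ?thesis
    by (simp add: nn_integral_lborel_heis)
qed

lemma nn_integral_hinv:
  assumes [measurable]: "F \<in> borel_measurable borel"
  shows "(\<integral>\<^sup>+z. F (hinv z) \<partial>lborel) = (\<integral>\<^sup>+z. F z \<partial>lborel)"
proof -
  have "(lborel :: heis measure) = distr lborel borel uminus"
    using lborel_affine[of "-1" "0 :: heis"] by (simp add: density_1)
  then have "(\<integral>\<^sup>+z. F z \<partial>lborel) = (\<integral>\<^sup>+z. F z \<partial>distr lborel borel (uminus :: heis \<Rightarrow> heis))"
    by simp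
  also have "\<dots> = (\<integral>\<^sup>+z. F (hinv z) \<partial>lborel)"
    by (subst nn_integral_distr) (auto simp: hinv_def uminus_prod_def)
  finally show ?thesis ..
qed

lemma hinv_hmul: "hinv (x \<odot> y) = hinv y \<odot> hinv x"
  by (cases x; cases y) (simp add: hinv_def algebra_simps)

lemma hinv_hinv [simp]: "hinv (hinv x) = x"
  by (simp add: hinv_def)

lemma hmul_0_right: "x \<odot> (0, 0) = x"
  by (cases x) simp

lemma hmul_hinv_right: "x \<odot> hinv x = (0, 0)"
  using hmul_hinv_left[of "hinv x"] by simp

text \<open>The semigroup evaluates the kernel at \<open>hinv y \<odot> x\<close>. As a function of
  \<open>y\<close> this is left translation by \<open>hinv x\<close> followed by inversion, and both
  preserve the measure.\<close>

lemma nn_integral_hinv_hmul: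
  assumes [measurable]: "F \<in> borel_measurable borel"
  shows "(\<integral>\<^sup>+y. F (hinv y \<odot> x) \<partial>lborel) = (\<integral>\<^sup>+y. F y \<partial>lborel)"
proof -
  have "(\<integral>\<^sup>+y. F (hinv y \<odot> x) \<partial>lborel) = (\<integral>\<^sup>+y. F (hinv (hinv x \<odot> y)) \<partial>lborel)"
    by (simp add: hinv_hmul)
  also have "\<dots> = (\<integral>\<^sup>+y. F (hinv y) \<partial>lborel)"
    by (subst nn_integral_hmul_left[of "\<lambda>z. F (hinv z)"]) auto
  finally show ?thesis by (simp add: nn_integral_hinv)
qed

text \<open>Turns invariance of nonnegative integrals into invariance of the measure, so that it
  also serves Bochner integrals of signed functions.\<close>

lemma distr_lborel_eqI:
  fixes T :: "'a::euclidean_space \<Rightarrow> 'a"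
  assumes [measurable]: "T \<in> borel_measurable borel"
    and "\<And>F. F \<in> borel_measurable borel \<Longrightarrow> (\<integral>\<^sup>+y. F (T y) \<partial>lborel) = (\<integral>\<^sup>+y. F y \<partial>lborel)"
  shows "distr lborel borel T = lborel"
proof (rule measure_eqI)
  fix S assume "S \<in> sets (distr lborel borel T)"
  then have [measurable]: "S \<in> sets borel" by simp
  have "emeasure (distr lborel borel T) S = (\<integral>\<^sup>+y. indicator S y \<partial>distr lborel borel T)"
    by simp
  also have "\<dots> = emeasure lborel S"
    by (subst nn_integral_distr) (auto simp: assms(2))
  finally show "emeasure (distr lborel borel T) S = emeasure lborel S" .
qed simp

lemma distr_hinv_hmul: "distr lborel borel (\<lambda>y. hinv y \<odot> x) = lborel"
  by (rule distr_lborel_eqI) (auto simp: nn_integral_hinv_hmul)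

lemma integral_hinv_hmul:
  fixes F :: "heis \<Rightarrow> real"
  assumes "F \<in> borel_measurable borel"
  shows "(\<integral>y. F (hinv y \<odot> x) \<partial>lborel) = (\<integral>y. F y \<partial>lborel)"
proof -
  have "(\<lambda>y. hinv y \<odot> x) \<in> lborel \<rightarrow>\<^sub>M borel" by measurable
  from integral_distr[OF this assms] show ?thesis
    by (simp add: distr_hinv_hmul)
qed

section \<open>Derivatives along left-invariant directions\<close>

text \<open>Right multiplication by \<open>(of_real s * c, 0)\<close> is affine in \<open>s\<close>,
  so these curves are Euclidean lines and derivatives along them are ordinary directional
  derivatives.\<close>

lemma hmul_line:
  "x \<odot> (of_real s * c, 0) = x + s *\<^sub>R (c, 2 * Im (fst x * cnj c))"
  by (cases x) (simp add: scaleR_conv_of_real algebra_simps)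

lemma differentiable_line_derivative:
  fixes F :: "'a::euclidean_space \<Rightarrow> real"
  assumes "F differentiable (at (z + s *\<^sub>R w))"
  shows "((\<lambda>r. F (z + r *\<^sub>R w)) has_field_derivative frechet_derivative F (at (z + s *\<^sub>R w)) w) (at s)"
proof -
  let ?F' = "frechet_derivative F (at (z + s *\<^sub>R w))"
  have F: "(F has_derivative ?F') (at (z + s *\<^sub>R w))"
    using assms by (simp add: frechet_derivative_works)
  have "((\<lambda>r. z + r *\<^sub>R w) has_derivative (\<lambda>r. r *\<^sub>R w)) (at s)"
    by (auto intro!: derivative_eq_intros)
  from has_derivative_compose[OF this F]
  have "((\<lambda>r. F (z + r *\<^sub>R w)) has_derivative (\<lambda>r. ?F' (r *\<^sub>R w))) (at s)" .
  moreover have "?F' (r *\<^sub>R w) = ?F' w * r" for r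
    using has_derivative_linear[OF F] by (simp add: linear_scale)
  ultimately show ?thesis
    by (simp add: has_field_derivative_def mult_commute_abs)
qed

lemma frechet_derivative_Basis:
  fixes F :: "'a::euclidean_space \<Rightarrow> real"
  assumes "F differentiable (at z)"
  shows "frechet_derivative F (at z) w = (\<Sum>b\<in>Basis. (w \<bullet> b) * frechet_derivative F (at z) b)"
proof -
  have "linear (frechet_derivative F (at z))"
    using assms by (simp add: linear_frechet_derivative)
  then show ?thesis
    by (subst euclidean_representation[of w, symmetric])
       (simp add: linear_sum linear_scale del: euclidean_representation)
qed

text \<open>The field is defined from partial derivatives; full differentiability is what assembles
  \<open>d_g\<close> and \<open>d_zeta\<close> into the derivative in direction
  \<open>(1, 2 * Im \<xi>)\<close>.\<close>

lemma X_field_line_derivative: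
  assumes "h differentiable (at x)"
  shows "((\<lambda>s. h (x \<odot> (of_real s, 0))) has_field_derivative X_field h x) (at 0)"
proof -
  obtain \<xi> \<zeta> where x: "x = (\<xi>, \<zeta>)" by force
  have lin: "linear (frechet_derivative h (at x))"
    using assms by (simp add: linear_frechet_derivative)
  have "d_g h x = frechet_derivative h (at x) (1, 0)"
  proof -
    \<comment> \<open>The line is started at real part 0, so that its parameter is the real part
      itself, the variable in which \<open>d_g\<close> differentiates.\<close>
    have "(Complex 0 (Im \<xi>), \<zeta>) + r *\<^sub>R (1, 0) = (Complex r (Im \<xi>), \<zeta>)" for r
      by (simp add: complex_eq_iff)
    then show ?thesis
      using differentiable_line_derivative[of h "(Complex 0 (Im \<xi>), \<zeta>)" "Re \<xi>" "(1, 0)"] assms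
      by (simp only: d_g_def x split complex.collapse) (simp add: DERIV_imp_deriv)
  qed
  moreover have "d_zeta h x = frechet_derivative h (at x) (0, 1)"
    using differentiable_line_derivative[of h "(\<xi>, 0)" \<zeta> "(0, 1)"] assms
    by (simp add: d_zeta_def x DERIV_imp_deriv)
  ultimately have "X_field h x = frechet_derivative h (at x) ((1, 0) + (2 * Im \<xi>) *\<^sub>R (0, 1))"
    by (simp add: X_field_def x linear_add[OF lin[unfolded x]] linear_scale[OF lin[unfolded x]]
        del: scaleR_Pair)
  also have "\<dots> = frechet_derivative h (at x) (1, 2 * Im \<xi>)" by simp
  finally show ?thesis
    using differentiable_line_derivative[of h x 0 "(1, 2 * Im \<xi>)"] assms
    by (simp add: x scaleR_conv_of_real algebra_simps)
qed

lemma Y_field_line_derivative: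
  assumes "h differentiable (at x)"
  shows "((\<lambda>s. h (x \<odot> (of_real s * \<i>, 0))) has_field_derivative Y_field h x) (at 0)"
proof -
  obtain \<xi> \<zeta> where x: "x = (\<xi>, \<zeta>)" by force
  have lin: "linear (frechet_derivative h (at x))"
    using assms by (simp add: linear_frechet_derivative)
  have "d_v h x = frechet_derivative h (at x) (\<i>, 0)"
  proof -
    have "(Complex (Re \<xi>) 0, \<zeta>) + r *\<^sub>R (\<i>, 0) = (Complex (Re \<xi>) r, \<zeta>)" for r
      by (simp add: complex_eq_iff)
    then show ?thesis
      using differentiable_line_derivative[of h "(Complex (Re \<xi>) 0, \<zeta>)" "Im \<xi>" "(\<i>, 0)"] assms
      by (simp only: d_v_def x split complex.collapse) (simp add: DERIV_imp_deriv)
  qed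
  moreover have "d_zeta h x = frechet_derivative h (at x) (0, 1)"
    using differentiable_line_derivative[of h "(\<xi>, 0)" \<zeta> "(0, 1)"] assms
    by (simp add: d_zeta_def x DERIV_imp_deriv)
  ultimately have "Y_field h x = frechet_derivative h (at x) ((\<i>, 0) + (- 2 * Re \<xi>) *\<^sub>R (0, 1))"
    by (simp add: Y_field_def x linear_diff[OF lin[unfolded x]] linear_scale[OF lin[unfolded x]]
        del: scaleR_Pair)
  also have "\<dots> = frechet_derivative h (at x) (\<i>, - 2 * Re \<xi>)" by simp
  finally show ?thesis
    using differentiable_line_derivative[of h x 0 "(\<i>, - 2 * Re \<xi>)"] assms
    by (simp add: x scaleR_conv_of_real algebra_simps)
qed

text \<open>
  Derivatives of \<open>v\<close> along the curves \<open>s \<mapsto> x \<odot> (s c, 0)\<close>, the integral curves of the left-invariant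
  field \<open>(Re c) X + (Im c) Y\<close>.  The frame \<open>c, \<plusminus>\<i> c\<close> is allowed to vary because the reflections
  of the group do not preserve the frame \<open>X, Y\<close>.
\<close>

definition caloric_jet ::
    "(real \<Rightarrow> heis \<Rightarrow> real) \<Rightarrow> (complex \<Rightarrow> real \<Rightarrow> heis \<Rightarrow> real) \<Rightarrow> (complex \<Rightarrow> real \<Rightarrow> heis \<Rightarrow> real) \<Rightarrow>
     (real \<Rightarrow> heis \<Rightarrow> real) \<Rightarrow> bool" where
  "caloric_jet v D1 D2 Dt \<longleftrightarrow>
     (\<forall>t>0. \<forall>x. ((\<lambda>s. v s x) has_field_derivative Dt t x) (at t)) \<and>
     (\<forall>t>0. \<forall>c x s. ((\<lambda>s. v t (x \<odot> (of_real s * c, 0))) has_field_derivative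
        D1 c t (x \<odot> (of_real s * c, 0))) (at s)) \<and>
     (\<forall>t>0. \<forall>c x s. ((\<lambda>s. D1 c t (x \<odot> (of_real s * c, 0))) has_field_derivative
        D2 c t (x \<odot> (of_real s * c, 0))) (at s)) \<and>
     (\<forall>t>0. \<forall>c b x. b\<^sup>2 = - (c\<^sup>2) \<longrightarrow> (cmod c)\<^sup>2 * Dt t x = D2 c t x + D2 b t x)"

lemma caloric_jetD:
  assumes "caloric_jet v D1 D2 Dt" "t > 0"
  shows "((\<lambda>s. v s x) has_field_derivative Dt t x) (at t)"
    and "((\<lambda>s. v t (x \<odot> (of_real s * c, 0))) has_field_derivative D1 c t (x \<odot> (of_real s * c, 0))) (at s)"
    and "((\<lambda>s. D1 c t (x \<odot> (of_real s * c, 0))) has_field_derivative D2 c t (x \<odot> (of_real s * c, 0))) (at s)"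
    and "b\<^sup>2 = - (c\<^sup>2) \<Longrightarrow> (cmod c)\<^sup>2 * Dt t x = D2 c t x + D2 b t x"
  using assms unfolding caloric_jet_def by blast+

abbreviation heat_domain :: "(real \<times> heis) set" where
  "heat_domain \<equiv> {0<..} \<times> UNIV"

text \<open>Smoothness enters up to order two. Continuity of the jets is carried along for
  differentiation under the integral in \<open>heat_evol_jet\<close>.\<close>

lemma heat_kernel_jet:
  assumes hk: "heat_kernel p"
  obtains D1 D2 Dt where "caloric_jet p D1 D2 Dt"
    "continuous_on heat_domain (\<lambda>(t, x). p t x)"
    "continuous_on heat_domain (\<lambda>(t, x). Dt t x)"
    "\<And>c. continuous_on heat_domain (\<lambda>(t, x). D1 c t x)"
    "\<And>c. continuous_on heat_domain (\<lambda>(t, x). D2 c t x)"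
proof -
  define P where "P = (\<lambda>(t, x). p t x)"
  define dP where "dP b z = frechet_derivative P (at z) b" for b z
  define ddP where "ddP b b' z = frechet_derivative (dP b) (at z) b'" for b b' z
  define W :: "complex \<Rightarrow> heis \<Rightarrow> real \<times> heis" where "W c x = (0, (c, 2 * Im (fst x * cnj c)))" for c x
  define D1 where "D1 c t x = (\<Sum>b\<in>Basis. (W c x \<bullet> b) * dP b (t, x))" for c t x
  define D2 where "D2 c t x = (\<Sum>b\<in>Basis. (W c x \<bullet> b) * (\<Sum>b'\<in>Basis. (W c x \<bullet> b') * ddP b b' (t, x)))" for c t x
  define Dt where "Dt t x = dP (1, 0) (t, x)" for t x
  have op: "open heat_domain" by (intro open_Times) auto
  have "Ck_on (Suc (Suc 0)) heat_domain P"
    using hk unfolding heat_kernel_def smooth_on_def P_def by blast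
  then have "P differentiable_on heat_domain" and dd: "\<And>b. b \<in> Basis \<Longrightarrow> dP b differentiable_on heat_domain"
    and cdd: "\<And>b b'. b \<in> Basis \<Longrightarrow> b' \<in> Basis \<Longrightarrow> continuous_on heat_domain (ddP b b')"
    by (auto simp: dP_def[abs_def] ddP_def[abs_def])
  then have dif: "\<And>t x. t > 0 \<Longrightarrow> P differentiable (at (t, x))"
    and ddif: "\<And>b t x. b \<in> Basis \<Longrightarrow> t > 0 \<Longrightarrow> dP b differentiable (at (t, x))"
    and cP: "continuous_on heat_domain P"
    and cdP: "\<And>b. b \<in> Basis \<Longrightarrow> continuous_on heat_domain (dP b)"
    by (auto simp: differentiable_on_eq_differentiable_at[OF op] intro: differentiable_imp_continuous_on)
  have line: "(t, x \<odot> (of_real s * c, 0)) = (t, x) + s *\<^sub>R W c x" for t x s c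
    by (simp only: hmul_line W_def) simp
  \<comment> \<open>Since \<open>c * cnj c\<close> is real, the direction \<open>W c\<close> is
    constant along its own curve; the second derivative therefore contains no derivative of
    \<open>W\<close>.\<close>
  have Wline: "W c (x \<odot> (of_real s * c, 0)) = W c x" for c x s
    by (cases x) (simp add: W_def algebra_simps)
  have der1: "((\<lambda>s. p t (x \<odot> (of_real s * c, 0))) has_field_derivative
      D1 c t (x \<odot> (of_real s * c, 0))) (at s)" if "t > 0" for t c x s
  proof -
    have d: "P differentiable (at ((t, x) + s *\<^sub>R W c x))"
      using dif[OF \<open>t > 0\<close>, of "x \<odot> (of_real s * c, 0)"] by (simp only: line)
    have "((\<lambda>s. P (t, x \<odot> (of_real s * c, 0))) has_field_derivative
        D1 c t (x \<odot> (of_real s * c, 0))) (at s)"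
      using differentiable_line_derivative[OF d] frechet_derivative_Basis[OF d, of "W c x"]
      by (simp only: line D1_def Wline dP_def)
    then show ?thesis by (simp add: P_def)
  qed
  have der2: "((\<lambda>s. D1 c t (x \<odot> (of_real s * c, 0))) has_field_derivative
      D2 c t (x \<odot> (of_real s * c, 0))) (at s)" if "t > 0" for t c x s
  proof -
    have "((\<lambda>s. dP b (t, x \<odot> (of_real s * c, 0))) has_field_derivative
        (\<Sum>b'\<in>Basis. (W c x \<bullet> b') * ddP b b' (t, x \<odot> (of_real s * c, 0)))) (at s)"
      if b: "b \<in> Basis" for b
    proof -
      have d: "dP b differentiable (at ((t, x) + s *\<^sub>R W c x))"
        using ddif[OF b \<open>t > 0\<close>, of "x \<odot> (of_real s * c, 0)"] by (simp only: line)
      show ?thesis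
        using differentiable_line_derivative[OF d] frechet_derivative_Basis[OF d, of "W c x"]
        by (simp only: line ddP_def)
    qed
    then show ?thesis
      unfolding D1_def D2_def Wline by (intro DERIV_sum DERIV_cmult) auto
  qed
  have dert: "((\<lambda>s. p s x) has_field_derivative Dt t x) (at t)" if "t > 0" for t x
    using differentiable_line_derivative[of P "(0, x)" t "(1, 0)"] dif[OF that, of x]
    by (simp add: P_def Dt_def dP_def)
  have slice: "(\<lambda>x. G (t, x)) differentiable (at x)" if "G differentiable (at (t, x))"
    for G :: "real \<times> heis \<Rightarrow> real" and t x
    using differentiable_chain_at[of "\<lambda>x. (t, x)" x G] that
    by (auto simp: o_def intro!: derivative_intros)
  have D1dif: "D1 c t differentiable (at x)" if "t > 0" for c t x
  proof -
    have "(\<lambda>x. W c x \<bullet> b) differentiable (at x)" for b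
    proof -
      have "((\<lambda>x. W c x) has_derivative (\<lambda>y. (0, (0, 2 * Im (fst y * cnj c))))) (at x)"
        unfolding W_def by (auto intro!: derivative_eq_intros simp: zero_prod_def)
      then show ?thesis
        unfolding differentiable_def
        by (intro exI) (rule has_derivative_inner_left)
    qed
    then have "(\<lambda>x. (W c x \<bullet> b) * dP b (t, x)) differentiable (at x)" if "b \<in> Basis" for b
      using slice[OF ddif[OF that \<open>t > 0\<close>]] by (rule differentiable_mult)
    then show ?thesis
      unfolding D1_def[abs_def] by (intro differentiable_sum) auto
  qed
  have pdif: "p t differentiable (at x)" if "t > 0" for t x
    using slice[OF dif[OF that]] by (simp add: P_def)
  have X: "X_field (p t) = D1 1 t" if "t > 0" for t
    using DERIV_unique[OF X_field_line_derivative[OF pdif[OF that]] der1[OF that, where c = 1 and s = 0, simplified]]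
    by (auto simp: hmul_0_right)
  have Y: "Y_field (p t) = D1 \<i> t" if "t > 0" for t
    using DERIV_unique[OF Y_field_line_derivative[OF pdif[OF that]] der1[OF that, where c = \<i> and s = 0]]
    by (auto simp: hmul_0_right)
  have XX: "X_field (D1 1 t) x = D2 1 t x" if "t > 0" for t x
    using DERIV_unique[OF X_field_line_derivative[OF D1dif[OF that]] der2[OF that, where c = 1 and s = 0, simplified]]
    by (auto simp: hmul_0_right)
  have YY: "Y_field (D1 \<i> t) x = D2 \<i> t x" if "t > 0" for t x
    using DERIV_unique[OF Y_field_line_derivative[OF D1dif[OF that]] der2[OF that, where c = \<i> and s = 0]]
    by (auto simp: hmul_0_right)
  have heat: "Dt t x = D2 1 t x + D2 \<i> t x" if "t > 0" for t x
  proof -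
    have "deriv (\<lambda>s. p s x) t = sub_laplacian (p t) x"
      using hk that unfolding heat_kernel_def by blast
    then show ?thesis
      using dert[OF that, of x] by (simp add: DERIV_imp_deriv sub_laplacian_def X Y XX YY that)
  qed
  define q where "q w w' t x = (\<Sum>b\<in>Basis. (w \<bullet> b) * (\<Sum>b'\<in>Basis. (w' \<bullet> b') * ddP b b' (t, x)))"
    for w w' :: "real \<times> heis" and t x
  have q_add: "q (r *\<^sub>R w + s *\<^sub>R w') (r' *\<^sub>R w + s' *\<^sub>R w') t x =
      r * r' * q w w t x + r * s' * q w w' t x + s * r' * q w' w t x + s * s' * q w' w' t x"
    for r s r' s' w w' t x
    unfolding q_def
    by (simp add: inner_add_left sum.distrib sum_distrib_left algebra_simps)
  \<comment> \<open>The hypothesis forces \<open>b\<close> to be \<open>\<i> * c\<close> up to sign.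
    The mixed second-order terms enter with weights \<open>Re c * Im c\<close> and
    \<open>Re b * Im b\<close>, which cancel, and the pure terms recombine with weight
    |c|^2.\<close>
  have rot: "D2 c t x + D2 b t x = (cmod c)\<^sup>2 * (D2 1 t x + D2 \<i> t x)"
    if "b\<^sup>2 = - (c\<^sup>2)" for c b t x
  proof -
    have "b\<^sup>2 = (\<i> * c)\<^sup>2" using that by (simp add: power_mult_distrib)
    then have "b = \<i> * c \<or> b = - (\<i> * c)" by (simp only: power2_eq_iff)
    then have b: "(Re b)\<^sup>2 = (Im c)\<^sup>2" "(Im b)\<^sup>2 = (Re c)\<^sup>2" "Re b * Im b = - (Re c * Im c)"
      by auto
    have Wc: "W c x = Re c *\<^sub>R W 1 x + Im c *\<^sub>R W \<i> x" for c
      by (simp add: W_def complex_eq_iff algebra_simps)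
    have e: "D2 c t x = (Re c)\<^sup>2 * D2 1 t x + Re c * Im c * (q (W 1 x) (W \<i> x) t x + q (W \<i> x) (W 1 x) t x)
        + (Im c)\<^sup>2 * D2 \<i> t x" for c
    proof -
      have D2q: "D2 c t x = q (W c x) (W c x) t x" for c
        by (simp add: D2_def q_def)
      have "D2 c t x = q (Re c *\<^sub>R W 1 x + Im c *\<^sub>R W \<i> x) (Re c *\<^sub>R W 1 x + Im c *\<^sub>R W \<i> x) t x"
        by (simp only: D2q Wc[symmetric])
      then show ?thesis
        by (simp only: q_add D2q) (simp add: power2_eq_square algebra_simps)
    qed
    show ?thesis
      by (simp only: e[of c] e[of b] b cmod_power2) (simp add: algebra_simps)
  qed
  have eq: "(cmod c)\<^sup>2 * Dt t x = D2 c t x + D2 b t x" if "t > 0" "b\<^sup>2 = - (c\<^sup>2)" for c b t x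
    using rot[OF that(2)] heat[OF that(1)] by simp
  have "caloric_jet p D1 D2 Dt"
    unfolding caloric_jet_def using der1 der2 dert eq by blast
  moreover have "continuous_on heat_domain (\<lambda>(t, x). p t x)"
    using cP by (simp add: P_def)
  moreover have "continuous_on heat_domain (\<lambda>(t, x). Dt t x)"
  proof -
    have "(1, 0) \<in> (Basis :: (real \<times> heis) set)" by (simp add: Basis_prod_def)
    from cdP[OF this] show ?thesis by (simp add: Dt_def split_beta')
  qed
  moreover have cW: "continuous_on heat_domain (\<lambda>z. W c (snd z))" for c
    unfolding W_def by (intro continuous_intros)
  moreover have "continuous_on heat_domain (\<lambda>(t, x). D1 c t x)" for c
    unfolding D1_def split_beta' using cdP cW by (intro continuous_intros) auto
  moreover have "continuous_on heat_domain (\<lambda>(t, x). D2 c t x)" for c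
    unfolding D2_def split_beta' using cdd cW by (intro continuous_intros) auto
  ultimately show thesis by (intro that[of D1 D2 Dt]) auto
qed

section \<open>The maximum principle\<close>

lemma second_derivative_at_min:
  fixes g g1 :: "real \<Rightarrow> real"
  assumes g: "\<And>s. (g has_field_derivative g1 s) (at s)"
    and g1: "(g1 has_field_derivative g2) (at 0)"
    and min: "\<And>s. g 0 \<le> g s"
  shows "g2 \<ge> 0"
proof (rule ccontr)
  assume "\<not> g2 \<ge> 0"
  then obtain d where d: "d > 0" "\<And>h. h > 0 \<Longrightarrow> h < d \<Longrightarrow> g1 h < g1 0"
    using DERIV_neg_dec_right[OF g1] by force
  have "g1 0 = 0"
    using DERIV_local_min[OF g, of 1 0] min by auto
  obtain z where "0 < z" "z < d / 2" "g (d / 2) - g 0 = (d / 2 - 0) * g1 z"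
    using MVT2[of 0 "d / 2" g g1] g d(1) by auto
  moreover have "g1 z < 0"
    using d(2)[of z] \<open>g1 0 = 0\<close> \<open>0 < z\<close> \<open>z < d / 2\<close> d(1) by simp
  then have "d / 2 * g1 z < 0"
    using d(1) by (intro mult_pos_neg) auto
  ultimately show False using min[of "d / 2"] by simp
qed

text \<open>
  The barrier \<open>e\<^bsup>9t\<^esup> (1 + \<parallel>x\<parallel>\<^sup>2)\<close> is a strict supersolution because
  \<open>(X\<^sup>2 + Y\<^sup>2) \<parallel>x\<parallel>\<^sup>2 = 4 + 8 \<bar>\<xi>\<bar>\<^sup>2\<close>.
\<close>

lemma caloric_nonneg:
  assumes jet: "caloric_jet v D1 D2 Dt"
    and cont: "continuous_on heat_domain (\<lambda>(t, x). v t x)"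
    and bdd: "\<And>t x. t > 0 \<Longrightarrow> v t x \<ge> - M"
    and init: "\<And>R e. e > 0 \<Longrightarrow> \<exists>\<delta>>0. \<forall>t x. 0 < t \<and> t < \<delta> \<and> norm x \<le> R \<longrightarrow> v t x \<ge> - e"
    and T: "T > 0"
  shows "v T x \<ge> 0"
proof (rule ccontr)
  assume neg: "\<not> v T x \<ge> 0"
  define \<psi> where "\<psi> t x = exp (9 * t) * (1 + (norm x)\<^sup>2)" for t and x :: heis
  \<comment> \<open>With this size of the barrier, \<open>w T x\<close> is half of
    \<open>v T x\<close> and so still negative.\<close>
  define \<eta> where "\<eta> = - v T x / (2 * \<psi> T x)"
  define w where "w t y = v t y + \<eta> * \<psi> t y" for t y
  have \<psi>pos: "\<psi> t y > 0" for t y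
    unfolding \<psi>_def by (intro mult_pos_pos add_pos_nonneg) auto
  have \<eta>: "\<eta> > 0"
    using neg \<psi>pos[of T x] by (simp add: \<eta>_def divide_neg_pos)
  have wTx: "w T x < 0"
    using neg \<psi>pos[of T x] by (simp add: w_def \<eta>_def)
  have \<psi>ge: "\<psi> t y \<ge> 1 + (norm y)\<^sup>2" if "t > 0" for t y
  proof -
    have "1 * (1 + (norm y)\<^sup>2) \<le> exp (9 * t) * (1 + (norm y)\<^sup>2)"
      using that by (intro mult_right_mono) auto
    then show ?thesis by (simp add: \<psi>_def)
  qed
  \<comment> \<open>Beyond this radius the barrier outweighs the lower bound \<open>- M\<close>,
    which confines a negative minimum to a compact set.\<close>
  define R where "R = sqrt (\<bar>M\<bar> / \<eta>)"
  have far: "w t y > 0" if "t > 0" "norm y > R" for t y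
  proof -
    have "R\<^sup>2 = \<bar>M\<bar> / \<eta>" using \<eta> by (simp add: R_def)
    moreover have "R \<ge> 0" using \<eta> by (simp add: R_def)
    then have "R\<^sup>2 < (norm y)\<^sup>2"
      using that by (intro power_strict_mono) auto
    ultimately have "\<bar>M\<bar> / \<eta> < (norm y)\<^sup>2" by simp
    then have "\<bar>M\<bar> < \<eta> * (norm y)\<^sup>2"
      using \<eta> by (simp add: pos_divide_less_eq mult.commute)
    also have "\<dots> \<le> \<eta> * \<psi> t y"
      using \<psi>ge[OF that(1), of y] \<eta> by (intro mult_left_mono) auto
    finally show ?thesis
      using bdd[OF that(1), of y] by (simp add: w_def)
  qed
  obtain \<delta> where \<delta>: "\<delta> > 0" "\<And>t y. 0 < t \<Longrightarrow> t < \<delta> \<Longrightarrow> norm y \<le> R \<Longrightarrow> v t y \<ge> - \<eta>"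
    using init[OF \<eta>, of R] by blast
  have early: "w t y \<ge> 0" if "0 < t" "t < \<delta>" "norm y \<le> R" for t y
  proof -
    have "\<eta> * 1 \<le> \<eta> * \<psi> t y"
      using order_trans[OF _ \<psi>ge[OF that(1), of y], of 1] \<eta> by (intro mult_left_mono) auto
    then show ?thesis using \<delta>(2)[OF that] by (simp add: w_def)
  qed
  \<comment> \<open>Starting at half of \<open>\<delta>\<close> matters: a negative minimum cannot
    occur before \<open>\<delta>\<close>, so there is room to step back in time from it.\<close>
  define K where "K = {\<delta>/2..T} \<times> cball (0 :: heis) R"
  have "norm x \<le> R" using far[OF T, of x] wTx by fastforce
  then have "\<delta> \<le> T" using early[OF T, of x] wTx by fastforce
  have Tx: "(T, x) \<in> K" using \<open>norm x \<le> R\<close> \<open>\<delta> \<le> T\<close> \<delta>(1) by (simp add: K_def)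
  have "continuous_on K (\<lambda>z. w (fst z) (snd z))"
  proof -
    have "continuous_on K (\<lambda>z. v (fst z) (snd z))"
      using cont[unfolded split_beta'] by (rule continuous_on_subset) (use \<delta>(1) in \<open>auto simp: K_def split_beta'\<close>)
    then show ?thesis
      unfolding w_def \<psi>_def by (intro continuous_intros)
  qed
  moreover have "compact K" unfolding K_def by (intro compact_Times) auto
  ultimately obtain t0 x0 where z0: "(t0, x0) \<in> K" and
    "\<And>t y. (t, y) \<in> K \<Longrightarrow> w t0 x0 \<le> w t y"
    using continuous_attains_inf[of K "\<lambda>z. w (fst z) (snd z)"] Tx by fastforce
  then have minK: "w t0 x0 \<le> w t y" if "\<delta> / 2 \<le> t" "t \<le> T" "norm y \<le> R" for t y
    using that by (simp add: K_def)
  have m: "w t0 x0 < 0"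
    using minK[of T x] wTx \<open>norm x \<le> R\<close> \<open>\<delta> \<le> T\<close> \<delta>(1) by simp
  have t0: "t0 \<ge> \<delta>" "t0 \<le> T" "norm x0 \<le> R"
    using early[of t0 x0] m z0 \<delta>(1) by (auto simp: K_def intro: ccontr)
  have t0pos: "t0 > 0" using t0 \<delta>(1) by simp
  have min: "w t0 x0 \<le> w t0 y" for y
    using minK[of t0 y] far[of t0 y] m t0 \<delta>(1) by fastforce
  define E where "E = \<eta> * exp (9 * t0)"
  have E: "E > 0" using \<eta> by (simp add: E_def)
  \<comment> \<open>The minimum may sit at the final time \<open>T\<close>, so only earlier times
    can be compared; this gives a sign for the time derivative instead of its vanishing.\<close>
  have time: "Dt t0 x0 + 9 * E * (1 + (norm x0)\<^sup>2) \<le> 0"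
  proof (rule ccontr)
    assume "\<not> ?thesis"
    moreover have "((\<lambda>t. w t x0) has_field_derivative Dt t0 x0 + 9 * E * (1 + (norm x0)\<^sup>2)) (at t0)"
      unfolding w_def \<psi>_def E_def
      by (auto intro!: derivative_eq_intros caloric_jetD(1)[OF jet t0pos])
    ultimately obtain d where d: "d > 0" "\<And>h. 0 < h \<Longrightarrow> h < d \<Longrightarrow> w (t0 - h) x0 < w t0 x0"
      using DERIV_pos_inc_left[of "\<lambda>t. w t x0"] by force
    define h where "h = min (d / 2) (\<delta> / 2)"
    have h: "0 < h" "h < d" "h \<le> \<delta> / 2" using d(1) \<delta>(1) by (auto simp: h_def min_def)
    show False
      using d(2)[OF h(1,2)] minK[of "t0 - h" x0] h t0 by auto
  qed
  have space: "D2 c t0 x0 + 2 * E * ((cmod c)\<^sup>2 + 4 * (Im (fst x0 * cnj c))\<^sup>2) \<ge> 0" for c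
  proof -
    define W where "W = (c, 2 * Im (fst x0 * cnj c))"
    have W: "W \<bullet> W = (cmod c)\<^sup>2 + 4 * (Im (fst x0 * cnj c))\<^sup>2"
      unfolding cmod_power2 W_def by (simp add: inner_complex_def power2_eq_square algebra_simps)
    have line: "x0 \<odot> (of_real s * c, 0) = x0 + s *\<^sub>R W" for s
      by (simp only: hmul_line W_def)
    have nrm: "(norm (x0 + s *\<^sub>R W))\<^sup>2 = (norm x0)\<^sup>2 + 2 * s * (x0 \<bullet> W) + s\<^sup>2 * (W \<bullet> W)" for s
      unfolding power2_norm_eq_inner by (simp add: inner_simps power2_eq_square inner_commute)
    have g: "((\<lambda>s. w t0 (x0 + s *\<^sub>R W)) has_field_derivative
        D1 c t0 (x0 + s *\<^sub>R W) + E * (2 * (x0 \<bullet> W) + 2 * s * (W \<bullet> W))) (at s)" for s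
      unfolding w_def \<psi>_def nrm E_def
      by (auto intro!: derivative_eq_intros caloric_jetD(2)[OF jet t0pos, where x = x0 and c = c, unfolded line] simp: algebra_simps)
    have g1: "((\<lambda>s. D1 c t0 (x0 + s *\<^sub>R W) + E * (2 * (x0 \<bullet> W) + 2 * s * (W \<bullet> W))) has_field_derivative
        D2 c t0 (x0 + 0 *\<^sub>R W) + E * (2 * (W \<bullet> W))) (at 0)"
      using caloric_jetD(3)[OF jet t0pos, where x = x0 and c = c and s = 0, unfolded line]
      by (auto intro!: derivative_eq_intros)
    have "D2 c t0 (x0 + 0 *\<^sub>R W) + E * (2 * (W \<bullet> W)) \<ge> 0"
      by (rule second_derivative_at_min[OF g g1]) (simp add: min)
    then show ?thesis unfolding W by (simp add: mult.assoc mult.left_commute)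
  qed
  have "Dt t0 x0 = D2 1 t0 x0 + D2 \<i> t0 x0"
    using caloric_jetD(4)[OF jet t0pos, of \<i> 1 x0] by simp
  moreover have "(norm x0)\<^sup>2 = (Re (fst x0))\<^sup>2 + (Im (fst x0))\<^sup>2 + (snd x0)\<^sup>2"
    by (cases x0) (simp add: norm_Pair cmod_power2)
  \<comment> \<open>The growth rate 9 of the barrier beats its sub-Laplacian: 9 (1 + |x|^2) - (4 + 8
    |xi|^2) is 5 + |xi|^2 + 9 zeta^2.\<close>
  ultimately have "E * (5 + (Re (fst x0))\<^sup>2 + (Im (fst x0))\<^sup>2 + 9 * (snd x0)\<^sup>2) \<le> 0"
    using space[of 1] space[of \<i>] time by (simp add: algebra_simps)
  moreover have "5 + (Re (fst x0))\<^sup>2 + (Im (fst x0))\<^sup>2 + 9 * (snd x0)\<^sup>2 > 0"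
    by (intro add_pos_nonneg) auto
  ultimately show False
    using E by (simp add: mult_le_0_iff)
qed

section \<open>Evolution of compactly supported data\<close>

text \<open>A real-valued companion of \<open>heat_semigroup\<close>, which admits signed data and
  differentiation under the integral.\<close>

definition heat_evol :: "(real \<Rightarrow> heis \<Rightarrow> real) \<Rightarrow> (heis \<Rightarrow> real) \<Rightarrow> real \<Rightarrow> heis \<Rightarrow> real" where
  "heat_evol p g t x = (\<integral>y. p t (hinv y \<odot> x) * g y \<partial>lborel)"

definition compactly_supported :: "(heis \<Rightarrow> real) \<Rightarrow> bool" where
  "compactly_supported g \<longleftrightarrow> continuous_on UNIV g \<and> (\<exists>r. \<forall>y. norm y > r \<longrightarrow> g y = 0)"

text \<open>A box fits the integrals over \<open>cbox\<close> used for the Leibniz rule. Its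
  nonempty interior serves the vanishing-integral argument in \<open>p_refl_dil\<close>.\<close>

lemma compactly_supported_cbox:
  assumes "compactly_supported g"
  obtains a b where "\<And>y. y \<notin> cbox a b \<Longrightarrow> g y = 0" "box a b \<noteq> {}"
proof -
  obtain r where r: "\<And>y. norm y > r \<Longrightarrow> g y = 0"
    using assms unfolding compactly_supported_def by blast
  obtain a where a: "cball (0 :: heis) (\<bar>r\<bar> + 1) \<subseteq> cbox (- a) a"
    using bounded_subset_cbox_symmetric[OF bounded_cball] by blast
  have "ball (0 :: heis) (\<bar>r\<bar> + 1) \<subseteq> interior (cbox (- a) a)"
    using a by (intro interior_maximal) auto
  then have "box (- a) a \<noteq> {}"
    by (auto simp: interior_cbox)
  moreover have "g y = 0" if "y \<notin> cbox (- a) a" for y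
  proof -
    have "y \<notin> cball 0 (\<bar>r\<bar> + 1)" using a that by blast
    then show ?thesis by (intro r) simp
  qed
  ultimately show thesis using that by blast
qed

lemma compactly_supported_bounded:
  assumes "compactly_supported g"
  obtains M where "M > 0" "\<And>y. \<bar>g y\<bar> \<le> M"
proof -
  obtain a b where ab: "\<And>y. y \<notin> cbox a b \<Longrightarrow> g y = 0"
    using compactly_supported_cbox[OF assms] by blast
  have "continuous_on (cbox a b) g"
    using assms continuous_on_subset unfolding compactly_supported_def by blast
  then have "bounded (g ` cbox a b)"
    by (intro compact_imp_bounded compact_continuous_image) auto
  then obtain M where "M > 0" "\<And>y. y \<in> cbox a b \<Longrightarrow> \<bar>g y\<bar> \<le> M"
    unfolding bounded_pos by auto
  then show thesis using ab by (intro that[of M]) (metis abs_zero less_imp_le)+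
qed

lemma integral_lborel_cbox:
  fixes F :: "'a::euclidean_space \<Rightarrow> real"
  assumes "continuous_on (cbox a b) F" "\<And>y. y \<notin> cbox a b \<Longrightarrow> F y = 0"
  shows "integrable lborel F" "(\<integral>y. F y \<partial>lborel) = integral (cbox a b) F"
proof -
  have F: "F = (\<lambda>y. indicator (cbox a b) y *\<^sub>R F y)"
    using assms(2) by (auto simp: indicator_def fun_eq_iff)
  have 1: "integrable lborel (\<lambda>y. indicator (cbox a b) y *\<^sub>R F y)"
    using assms(1) by (intro borel_integrable_compact) auto
  then show "integrable lborel F" using F by simp
  have "(\<integral>y. F y \<partial>lborel) = set_lebesgue_integral lborel (cbox a b) F"
    unfolding set_lebesgue_integral_def using F by simp
  also have "\<dots> = integral (cbox a b) F"
    using 1 by (intro set_borel_integral_eq_integral) (simp add: set_integrable_def)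
  finally show "(\<integral>y. F y \<partial>lborel) = integral (cbox a b) F" .
qed

locale heis_heat =
  fixes p :: "real \<Rightarrow> heis \<Rightarrow> real"
  assumes heat_kernel: "heat_kernel p"
begin

lemma p_pos: "t > 0 \<Longrightarrow> p t x > 0"
  using heat_kernel unfolding heat_kernel_def by blast

lemma p_integrable: "t > 0 \<Longrightarrow> integrable lborel (p t)"
  using heat_kernel unfolding heat_kernel_def by (blast intro: integrable.intros)

lemma p_integral: "t > 0 \<Longrightarrow> (\<integral>y. p t y \<partial>lborel) = 1"
  using heat_kernel unfolding heat_kernel_def by (blast intro: has_bochner_integral_integral_eq)

lemma p_continuous: "continuous_on heat_domain (\<lambda>(t, x). p t x)"
  using heat_kernel_jet[OF heat_kernel] by blast

lemma p_measurable: "t > 0 \<Longrightarrow> p t \<in> borel_measurable borel"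
  using borel_measurable_integrable[OF p_integrable] by simp

lemma continuous_on_p:
  assumes "continuous_on S f" "continuous_on S g" "\<And>x. x \<in> S \<Longrightarrow> f x > 0"
  shows "continuous_on S (\<lambda>x. p (f x) (g x))"
  using continuous_on_compose2[OF p_continuous continuous_on_Pair[OF assms(1,2)]] assms(3)
  by auto

lemma heat_evol_cbox:
  assumes "t > 0" "continuous_on UNIV g" "\<And>y. y \<notin> cbox a b \<Longrightarrow> g y = 0"
  shows "heat_evol p g t x = integral (cbox a b) (\<lambda>y. p t (hinv y \<odot> x) * g y)"
  unfolding heat_evol_def using assms
  by (intro integral_lborel_cbox continuous_intros continuous_on_p)
     (auto intro: continuous_on_subset)

text \<open>By associativity the curve moves past \<open>hinv y\<close>, so all derivatives fall on
  the kernel; compact support confines the integral to a fixed box, where the Leibniz rule applies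
  to the continuous jets.\<close>

lemma heat_evol_jet:
  assumes g: "compactly_supported g"
  obtains D1 D2 Dt where "caloric_jet (heat_evol p g) D1 D2 Dt"
    "continuous_on heat_domain (\<lambda>(t, x). heat_evol p g t x)"
proof -
  obtain a b where ab: "\<And>y. y \<notin> cbox a b \<Longrightarrow> g y = 0"
    using compactly_supported_cbox[OF g] by blast
  have cg: "continuous_on UNIV g" using g by (simp add: compactly_supported_def)
  have cg': "continuous_on S (\<lambda>z. g (h z))" if "continuous_on S h" for S :: "'x::topological_space set" and h
    using continuous_on_compose2[OF cg that] by simp
  obtain D1 D2 Dt where jet: "caloric_jet p D1 D2 Dt"
    and "continuous_on heat_domain (\<lambda>(t, x). p t x)"
    and cDt: "continuous_on heat_domain (\<lambda>(t, x). Dt t x)"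
    and cD1: "\<And>c. continuous_on heat_domain (\<lambda>(t, x). D1 c t x)"
    and cD2: "\<And>c. continuous_on heat_domain (\<lambda>(t, x). D2 c t x)"
    by (rule heat_kernel_jet[OF heat_kernel]) (rule that)
  have comp: "continuous_on S (\<lambda>z. G (h z) (k z))"
    if "continuous_on heat_domain (\<lambda>(t, x). G t x)" "continuous_on S h" "continuous_on S k"
      "\<And>z. z \<in> S \<Longrightarrow> h z > 0" for S :: "'x::topological_space set" and G :: "real \<Rightarrow> heis \<Rightarrow> real" and h k
    using continuous_on_compose2[OF that(1) continuous_on_Pair[OF that(2,3)]] that(4) by auto
  define I where "I G t x = integral (cbox a b) (\<lambda>y. G t (hinv y \<odot> x) * g y)"
    for G :: "real \<Rightarrow> heis \<Rightarrow> real" and t x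
  have int: "(\<lambda>y. G t (hinv y \<odot> x) * g y) integrable_on cbox a b"
    if "continuous_on heat_domain (\<lambda>(t, x). G t x)" "t > 0" for G t x
    by (intro integrable_continuous continuous_intros comp[OF that(1)] cg') (use that in auto)
  have I: "heat_evol p g t x = I p t x" if "t > 0" for t x
    unfolding I_def using that cg ab by (rule heat_evol_cbox)
  have time: "((\<lambda>s. heat_evol p g s x) has_field_derivative I Dt t x) (at t)" if t: "t > 0" for t x
  proof -
    have "((\<lambda>s. integral (cbox a b) (\<lambda>y. p s (hinv y \<odot> x) * g y)) has_field_derivative
        integral (cbox a b) (\<lambda>y. Dt t (hinv y \<odot> x) * g y)) (at t within {0<..})"
    proof (rule leibniz_rule_field_derivative)
      show "((\<lambda>s. p s (hinv y \<odot> x) * g y) has_field_derivative Dt s (hinv y \<odot> x) * g y)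
          (at s within {0<..})" if "s \<in> {0<..}" for s y
        by (rule DERIV_cmult_right, rule has_field_derivative_at_within, rule caloric_jetD(1)[OF jet])
           (use that in simp)
      show "continuous_on ({0<..} \<times> cbox a b) (\<lambda>(s, y). Dt s (hinv y \<odot> x) * g y)"
        unfolding split_beta' by (intro continuous_intros comp[OF cDt] cg') auto
      show "(\<lambda>y. p s (hinv y \<odot> x) * g y) integrable_on cbox a b" if "s \<in> {0<..}" for s
        by (rule int[OF p_continuous]) (use that in simp)
      show "t \<in> {0<..}" using t by simp
      show "convex ({0<..} :: real set)" by simp
    qed
    then have "((\<lambda>s. I p s x) has_field_derivative I Dt t x) (at t)"
      unfolding I_def by (subst (asm) at_within_open) (use t in \<open>simp_all only: greaterThan_iff open_greaterThan\<close>)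
    then show ?thesis
      by (rule has_field_derivative_transform_within_open[where S = "{0<..}"]) (use t I in auto)
  qed
  have space: "((\<lambda>s. I G t (x \<odot> (of_real s * c, 0))) has_field_derivative
      I G' t (x \<odot> (of_real s * c, 0))) (at s)"
    if t: "t > 0" and G: "continuous_on heat_domain (\<lambda>(t, x). G t x)"
      and G': "continuous_on heat_domain (\<lambda>(t, x). G' t x)"
      and der: "\<And>x s. ((\<lambda>s. G t (x \<odot> (of_real s * c, 0))) has_field_derivative
        G' t (x \<odot> (of_real s * c, 0))) (at s)" for G G' t x c s
    unfolding I_def
  proof (rule leibniz_rule_field_derivative)
    show "((\<lambda>s. G t (hinv y \<odot> (x \<odot> (of_real s * c, 0))) * g y) has_field_derivative
        G' t (hinv y \<odot> (x \<odot> (of_real s * c, 0))) * g y) (at s within UNIV)" for y s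
      using DERIV_cmult_right[OF der[of "hinv y \<odot> x" s]] by (simp add: hmul_assoc)
    show "continuous_on (UNIV \<times> cbox a b) (\<lambda>(s, y). G' t (hinv y \<odot> (x \<odot> (of_real s * c, 0))) * g y)"
      unfolding split_beta' by (intro continuous_intros comp[OF G'] cg') (use t in auto)
    show "(\<lambda>y. G t (hinv y \<odot> (x \<odot> (of_real s * c, 0))) * g y) integrable_on cbox a b" for s
      by (rule int[OF G t])
    show "s \<in> UNIV" "convex UNIV" by simp_all
  qed
  have "caloric_jet (heat_evol p g) (\<lambda>c. I (D1 c)) (\<lambda>c. I (D2 c)) (I Dt)"
    unfolding caloric_jet_def
  proof (intro conjI allI impI)
    fix t :: real and c b' :: complex and x s
    assume t: "t > 0"
    show "((\<lambda>s. heat_evol p g s x) has_field_derivative I Dt t x) (at t)"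
      by (rule time[OF t])
    show "((\<lambda>s. heat_evol p g t (x \<odot> (of_real s * c, 0))) has_field_derivative
        I (D1 c) t (x \<odot> (of_real s * c, 0))) (at s)"
      unfolding I[OF t] by (rule space[OF t p_continuous cD1 caloric_jetD(2)[OF jet t]])
    show "((\<lambda>s. I (D1 c) t (x \<odot> (of_real s * c, 0))) has_field_derivative
        I (D2 c) t (x \<odot> (of_real s * c, 0))) (at s)"
      by (rule space[OF t cD1 cD2 caloric_jetD(3)[OF jet t]])
    assume "b'\<^sup>2 = - (c\<^sup>2)"
    note e = caloric_jetD(4)[OF jet t this]
    have "(cmod c)\<^sup>2 * I Dt t x = integral (cbox a b) (\<lambda>y. (cmod c)\<^sup>2 * Dt t (hinv y \<odot> x) * g y)"
      unfolding I_def by (simp add: mult.assoc integral_mult_right)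
    also have "\<dots> = integral (cbox a b) (\<lambda>y. D2 c t (hinv y \<odot> x) * g y + D2 b' t (hinv y \<odot> x) * g y)"
      by (simp only: e distrib_right)
    also have "\<dots> = I (D2 c) t x + I (D2 b') t x"
      unfolding I_def by (intro integral_add int[OF cD2 t])
    finally show "(cmod c)\<^sup>2 * I Dt t x = I (D2 c) t x + I (D2 b') t x" .
  qed
  moreover have "continuous_on heat_domain (\<lambda>z. integral (cbox a b) (\<lambda>y. p (fst z) (hinv y \<odot> snd z) * g y))"
    by (rule integral_continuous_on_param, unfold split_beta')
       (intro continuous_intros continuous_on_p cg', auto)
  then have "continuous_on heat_domain (\<lambda>(t, x). heat_evol p g t x)"
    by (rule continuous_on_eq) (auto simp: I I_def)
  ultimately show thesis by (rule that)
qed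

lemma heat_evol_integrable:
  assumes "t > 0" "compactly_supported g"
  shows "integrable lborel (\<lambda>y. p t (hinv y \<odot> x) * g y)"
proof -
  obtain a b where "\<And>y. y \<notin> cbox a b \<Longrightarrow> g y = 0"
    using compactly_supported_cbox[OF assms(2)] by blast
  then show ?thesis
    using assms unfolding compactly_supported_def
    by (intro integral_lborel_cbox(1)[of a b] continuous_intros continuous_on_p)
       (auto intro: continuous_on_subset)
qed

text \<open>In this form \<open>x\<close> appears only in the datum, so bounds and initial values
  can be read off from mass 1 and the weak limit of the kernel.\<close>

lemma heat_evol_right:
  assumes "t > 0" "compactly_supported g"
  shows "heat_evol p g t x = (\<integral>z. p t z * g (x \<odot> hinv z) \<partial>lborel)"
    and "integrable lborel (\<lambda>z. p t z * g (x \<odot> hinv z))"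
proof -
  have [measurable]: "g \<in> borel_measurable borel"
    using assms(2) by (simp add: compactly_supported_def borel_measurable_continuous_onI)
  note [measurable] = p_measurable[OF assms(1)]
  have e: "x \<odot> hinv (hinv y \<odot> x) = y" for y
    by (simp add: hinv_hmul hmul_assoc[symmetric] hmul_hinv_right hmul_0_left)
  show "heat_evol p g t x = (\<integral>z. p t z * g (x \<odot> hinv z) \<partial>lborel)"
    using integral_hinv_hmul[of "\<lambda>z. p t z * g (x \<odot> hinv z)" x]
    by (simp add: heat_evol_def e)
  obtain M where M: "M > 0" "\<And>y. \<bar>g y\<bar> \<le> M"
    using compactly_supported_bounded[OF assms(2)] by blast
  show "integrable lborel (\<lambda>z. p t z * g (x \<odot> hinv z))"
    using M p_pos[OF assms(1)]
    by (intro Bochner_Integration.integrable_bound[OF integrable_mult_left[OF p_integrable[OF assms(1)], of M]])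
       (simp_all add: abs_mult mult_left_mono AE_I2)
qed

lemma heat_evol_bounded:
  assumes "t > 0" "compactly_supported g" "\<And>y. \<bar>g y\<bar> \<le> M"
  shows "\<bar>heat_evol p g t x\<bar> \<le> M"
proof -
  have "\<bar>heat_evol p g t x\<bar> \<le> (\<integral>z. \<bar>p t z * g (x \<odot> hinv z)\<bar> \<partial>lborel)"
    unfolding heat_evol_right[OF assms(1,2)] by (rule integral_abs_bound)
  also have "\<dots> \<le> (\<integral>z. p t z * M \<partial>lborel)"
    using heat_evol_right(2)[OF assms(1,2)] p_integrable[OF assms(1)] p_pos[OF assms(1)] assms(3)
    by (intro integral_mono integrable_abs integrable_mult_left)
       (auto simp: abs_mult less_imp_le intro!: mult_left_mono)
  also have "\<dots> = M" using p_integral[OF assms(1)] by simp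
  finally show ?thesis .
qed

text \<open>The weak limit in the definition of the kernel is pointwise, but
  \<open>caloric_nonneg\<close> asks for closeness uniformly on balls. Uniform continuity of
  \<open>g\<close> near the ball handles small \<open>z\<close>, and one test function handles the
  remaining mass for all \<open>x\<close> at once.\<close>

lemma heat_evol_initial:
  assumes g: "compactly_supported g" and e: "e > 0"
  shows "\<exists>\<delta>>0. \<forall>t x. 0 < t \<and> t < \<delta> \<and> norm x \<le> R \<longrightarrow> \<bar>heat_evol p g t x - g x\<bar> \<le> e"
proof -
  obtain M where M: "M > 0" "\<And>y. \<bar>g y\<bar> \<le> M"
    using compactly_supported_bounded[OF g] by blast
  have cg: "continuous_on UNIV g" using g by (simp add: compactly_supported_def)
  have "uniformly_continuous_on (cball 0 R \<times> cball 0 1) (\<lambda>(x, z). g (x \<odot> hinv z))"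
    unfolding split_beta'
    by (intro compact_uniformly_continuous compact_Times continuous_on_compose2[OF cg] continuous_intros) auto
  then obtain d where d: "d > 0" "\<And>w w'. w \<in> cball 0 R \<times> cball 0 1 \<Longrightarrow> w' \<in> cball 0 R \<times> cball 0 1 \<Longrightarrow>
      dist w' w < d \<Longrightarrow> \<bar>g (fst w' \<odot> hinv (snd w')) - g (fst w \<odot> hinv (snd w))\<bar> < e / 2"
    unfolding uniformly_continuous_on_def split_beta' using e by (metis dist_real_def half_gt_zero)
  define d' where "d' = min d 1"
  have d': "d' > 0" "d' \<le> d" "d' \<le> 1" using d(1) by (auto simp: d'_def)
  \<comment> \<open>\<open>h\<close> vanishes at the identity and is 1 away from it, so its integral
    against \<open>p t\<close> tends to 0 and dominates the kernel mass far from the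
    identity.\<close>
  define h where "h z = min 1 (norm z / d')" for z :: heis
  have near: "\<bar>g (x \<odot> hinv z) - g x\<bar> \<le> e / 2 + 2 * M * h z" if x: "norm x \<le> R" for x z
  proof (cases "norm z < d'")
    case True
    then have "\<bar>g (x \<odot> hinv z) - g (x \<odot> hinv 0)\<bar> < e / 2"
      using d(2)[of "(x, 0)" "(x, z)"] x d' by (auto simp: dist_Pair_Pair)
    moreover have "x \<odot> hinv 0 = x"
      by (cases x) (simp add: hinv_def zero_prod_def)
    moreover have "2 * M * h z \<ge> 0" using M(1) d' by (simp add: h_def)
    ultimately show ?thesis using e by simp
  next
    case False
    then have "h z = 1" using d' by (simp add: h_def)
    then show ?thesis using M(2)[of x] M(2)[of "x \<odot> hinv z"] e by simp
  qed
  have ch: "continuous_on UNIV h" unfolding h_def using d' by (intro continuous_intros) auto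
  have hb: "0 \<le> h z" "h z \<le> 1" for z using d' by (auto simp: h_def)
  have hint: "integrable lborel (\<lambda>z. p t z * h z)" if "t > 0" for t
    using hb p_pos[OF that] borel_measurable_continuous_onI[OF ch] p_measurable[OF that]
    by (intro Bochner_Integration.integrable_bound[OF p_integrable[OF that]])
       (simp_all add: abs_mult mult_left_le AE_I2)
  have "bounded (range h)" using hb by (intro boundedI[of _ 1]) auto
  then have "((\<lambda>t. \<integral>y. p t y * h y \<partial>lborel) \<longlongrightarrow> h (0, 0)) (at_right 0)"
    using heat_kernel ch unfolding heat_kernel_def by blast
  moreover have "h (0, 0) = 0" by (simp add: h_def norm_Pair)
  ultimately have "eventually (\<lambda>t. (\<integral>y. p t y * h y \<partial>lborel) < e / (4 * M)) (at_right 0)"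
    using e M(1) by (intro order_tendstoD(2)) auto
  then obtain \<delta> where \<delta>: "\<delta> > 0" "\<And>t. 0 < t \<Longrightarrow> t < \<delta> \<Longrightarrow> (\<integral>y. p t y * h y \<partial>lborel) < e / (4 * M)"
    unfolding eventually_at_right_field by auto
  have "\<bar>heat_evol p g t x - g x\<bar> \<le> e" if "0 < t" "t < \<delta>" "norm x \<le> R" for t x
  proof -
    have "heat_evol p g t x - g x = (\<integral>z. p t z * g (x \<odot> hinv z) \<partial>lborel) - (\<integral>z. p t z * g x \<partial>lborel)"
      using heat_evol_right(1)[OF that(1) g] p_integral[OF that(1)] by simp
    also have "\<dots> = (\<integral>z. p t z * (g (x \<odot> hinv z) - g x) \<partial>lborel)"
      using heat_evol_right(2)[OF that(1) g] p_integrable[OF that(1)]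
      by (subst Bochner_Integration.integral_diff[symmetric]) (auto simp: right_diff_distrib)
    finally have "\<bar>heat_evol p g t x - g x\<bar> \<le> (\<integral>z. \<bar>p t z * (g (x \<odot> hinv z) - g x)\<bar> \<partial>lborel)"
      using integral_abs_bound by metis
    also have "\<dots> \<le> (\<integral>z. e / 2 * p t z + 2 * M * (p t z * h z) \<partial>lborel)"
    proof (rule integral_mono)
      show "integrable lborel (\<lambda>z. \<bar>p t z * (g (x \<odot> hinv z) - g x)\<bar>)"
        using heat_evol_right(2)[OF that(1) g] p_integrable[OF that(1)]
        by (intro integrable_abs) (auto simp: right_diff_distrib)
      show "integrable lborel (\<lambda>z. e / 2 * p t z + 2 * M * (p t z * h z))"
        using p_integrable[OF that(1)] hint[OF that(1)] by auto
      show "\<bar>p t z * (g (x \<odot> hinv z) - g x)\<bar> \<le> e / 2 * p t z + 2 * M * (p t z * h z)" for z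
        using mult_left_mono[OF near[OF that(3), of z] less_imp_le[OF p_pos[OF that(1), of z]]]
          p_pos[OF that(1), of z] unfolding abs_mult by (simp add: algebra_simps)
    qed
    also have "\<dots> = e / 2 + 2 * M * (\<integral>z. p t z * h z \<partial>lborel)"
      using p_integrable[OF that(1)] hint[OF that(1)] p_integral[OF that(1)] by simp
    also have "\<dots> \<le> e / 2 + 2 * M * (e / (4 * M))"
      using \<delta>(2)[OF that(1,2)] M(1) by (intro add_left_mono mult_left_mono) auto
    also have "\<dots> = e" using M(1) by simp
    finally show ?thesis .
  qed
  then show ?thesis using \<delta>(1) by blast
qed

end

section \<open>Symmetries of the heat kernel\<close>

lemma caloric_jet_diff:
  assumes v: "caloric_jet v D1 D2 Dt" and w: "caloric_jet w D1' D2' Dt'"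
  shows "caloric_jet (\<lambda>t x. w t x - v t x) (\<lambda>c t x. D1' c t x - D1 c t x)
    (\<lambda>c t x. D2' c t x - D2 c t x) (\<lambda>t x. Dt' t x - Dt t x)"
  unfolding caloric_jet_def
proof (intro conjI allI impI)
  fix t :: real and c b :: complex and x s
  assume t: "t > 0"
  note v' = caloric_jetD[OF v t] and w' = caloric_jetD[OF w t]
  show "((\<lambda>s. w s x - v s x) has_field_derivative Dt' t x - Dt t x) (at t)"
    by (rule DERIV_diff[OF w'(1) v'(1)])
  show "((\<lambda>s. w t (x \<odot> (of_real s * c, 0)) - v t (x \<odot> (of_real s * c, 0))) has_field_derivative
      D1' c t (x \<odot> (of_real s * c, 0)) - D1 c t (x \<odot> (of_real s * c, 0))) (at s)"
    by (rule DERIV_diff[OF w'(2) v'(2)])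
  show "((\<lambda>s. D1' c t (x \<odot> (of_real s * c, 0)) - D1 c t (x \<odot> (of_real s * c, 0))) has_field_derivative
      D2' c t (x \<odot> (of_real s * c, 0)) - D2 c t (x \<odot> (of_real s * c, 0))) (at s)"
    by (rule DERIV_diff[OF w'(3) v'(3)])
  assume "b\<^sup>2 = - (c\<^sup>2)"
  then show "(cmod c)\<^sup>2 * (Dt' t x - Dt t x) = D2' c t x - D2 c t x + (D2' b t x - D2 b t x)"
    using v'(4)[of b c x] w'(4)[of b c x] by (simp add: right_diff_distrib)
qed

text \<open>Only one-sided conditions are imposed, because the shifted kernel to which this is
  applied in \<open>heat_evol_cutoff_le\<close> is not yet known to be bounded.\<close>

lemma caloric_le:
  assumes v: "caloric_jet v D1 D2 Dt" and w: "caloric_jet w D1' D2' Dt'"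
    and "continuous_on heat_domain (\<lambda>(t, x). v t x)"
    and "continuous_on heat_domain (\<lambda>(t, x). w t x)"
    and bdd: "\<And>t x. t > 0 \<Longrightarrow> v t x \<le> w t x + M"
    and init: "\<And>R e. e > 0 \<Longrightarrow> \<exists>\<delta>>0. \<forall>t x. 0 < t \<and> t < \<delta> \<and> norm x \<le> R \<longrightarrow> v t x \<le> w t x + e"
    and "T > 0"
  shows "v T x \<le> w T x"
proof -
  have "w T x - v T x \<ge> 0"
  proof (rule caloric_nonneg[OF caloric_jet_diff[OF v w]])
    show "continuous_on heat_domain (\<lambda>(t, x). w t x - v t x)"
      using assms(3,4) unfolding split_beta' by (intro continuous_intros)
    show "- M \<le> w t x - v t x" if "t > 0" for t x
      using bdd[OF that, of x] by simp
    show "\<exists>\<delta>>0. \<forall>t x. 0 < t \<and> t < \<delta> \<and> norm x \<le> R \<longrightarrow> - e \<le> w t x - v t x"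
      if e: "e > 0" for R e
    proof -
      obtain \<delta> where "\<delta> > 0" "\<And>t x. 0 < t \<Longrightarrow> t < \<delta> \<Longrightarrow> norm x \<le> R \<Longrightarrow> v t x \<le> w t x + e"
        using init[OF e, of R] by blast
      then show ?thesis by (intro exI[of _ \<delta>]) (auto simp: algebra_simps)
    qed
  qed fact
  then show ?thesis by simp
qed

lemma refl_dil_hmul: "refl_dil c (x \<odot> y) = refl_dil c x \<odot> refl_dil c y"
proof (cases x; cases y)
  fix \<xi> \<zeta> \<xi>' \<zeta>' assume xy: "x = (\<xi>, \<zeta>)" "y = (\<xi>', \<zeta>')"
  have "Im ((c * cnj \<xi>) * cnj (c * cnj \<xi>')) = - (cmod c)\<^sup>2 * Im (\<xi> * cnj \<xi>')"
    unfolding cmod_power2 by (simp add: algebra_simps power2_eq_square)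
  then show ?thesis by (simp add: refl_dil_def xy algebra_simps)
qed

lemma refl_dil_hinv: "refl_dil c (hinv x) = hinv (refl_dil c x)"
  by (simp add: refl_dil_def hinv_def)

text \<open>The inverse parameter is \<open>1 / cnj c\<close> and not \<open>1 / c\<close>, since
  the outer map conjugates the inner parameter.\<close>

lemma refl_dil_inverse:
  assumes "c \<noteq> 0"
  shows "refl_dil (1 / cnj c) (refl_dil c x) = x" "refl_dil c (refl_dil (1 / cnj c) x) = x"
  using assms by (auto simp: refl_dil_def norm_divide power_divide prod_eq_iff)

lemma norm_refl_dil: "norm (refl_dil c x) \<le> (cmod c + (cmod c)\<^sup>2) * norm x"
proof -
  have "norm (refl_dil c x) \<le> norm (c * cnj (fst x)) + norm (- (cmod c)\<^sup>2 * snd x)"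
    unfolding refl_dil_def by (rule norm_Pair_le)
  also have "\<dots> = cmod c * norm (fst x) + (cmod c)\<^sup>2 * norm (snd x)"
    by (simp add: norm_mult abs_mult)
  also have "\<dots> \<le> cmod c * norm x + (cmod c)\<^sup>2 * norm x"
    using norm_fst_le[of "fst x" "snd x"] norm_snd_le[of "snd x" "fst x"]
    by (intro add_mono mult_left_mono) auto
  finally show ?thesis by (simp add: distrib_right)
qed

lemma compactly_supported_refl_dil:
  assumes "compactly_supported g" "c \<noteq> 0"
  shows "compactly_supported (\<lambda>y. g (refl_dil c y))"
proof -
  obtain r where g: "continuous_on UNIV g" and r: "\<And>y. norm y > r \<Longrightarrow> g y = 0"
    using assms(1) unfolding compactly_supported_def by blast
  define d where "d = 1 / cnj c"
  define K where "K = cmod d + (cmod d)\<^sup>2"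
  have K: "K > 0" using assms(2) by (auto simp: K_def d_def intro: add_pos_nonneg)
  have "g (refl_dil c y) = 0" if "norm y > K * r" for y
  proof (rule r)
    have "norm y \<le> K * norm (refl_dil c y)"
      using norm_refl_dil[of d "refl_dil c y"] refl_dil_inverse(1)[OF assms(2)] by (simp add: d_def K_def)
    with that have "K * r < K * norm (refl_dil c y)" by simp
    then show "norm (refl_dil c y) > r" using K by simp
  qed
  moreover have "continuous_on UNIV (\<lambda>y. g (refl_dil c y))"
    by (intro continuous_on_compose2[OF g] continuous_intros) auto
  ultimately show ?thesis unfolding compactly_supported_def by blast
qed

lemma lborel_refl_dil:
  assumes "c \<noteq> 0"
  shows "density (distr lborel borel (refl_dil c)) (\<lambda>_. ennreal (cmod c ^ 4)) = lborel"
proof (rule measure_eqI)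
  have [measurable]: "refl_dil c \<in> borel_measurable borel" by measurable
  fix S assume "S \<in> sets (density (distr lborel borel (refl_dil c)) (\<lambda>_. ennreal (cmod c ^ 4)))"
  then have [measurable]: "S \<in> sets borel" by simp
  have "emeasure (density (distr lborel borel (refl_dil c)) (\<lambda>_. ennreal (cmod c ^ 4))) S =
      ennreal (cmod c ^ 4) * (\<integral>\<^sup>+y. indicator S (refl_dil c y) \<partial>lborel)"
  proof -
    have "emeasure (distr lborel borel (refl_dil c)) S = (\<integral>\<^sup>+y. indicator S y \<partial>distr lborel borel (refl_dil c))"
      by simp
    also have "\<dots> = (\<integral>\<^sup>+y. indicator S (refl_dil c y) \<partial>lborel)"
      by (rule nn_integral_distr) auto
    finally show ?thesis
      by (subst emeasure_density) (auto simp: nn_integral_cmult)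
  qed
  also have "\<dots> = emeasure lborel S"
    using nn_integral_refl_dil[of "indicator S" c] assms by simp
  finally show "emeasure (density (distr lborel borel (refl_dil c)) (\<lambda>_. ennreal (cmod c ^ 4))) S =
      emeasure lborel S" .
qed simp

lemma integral_refl_dil:
  fixes F :: "heis \<Rightarrow> real"
  assumes [measurable]: "F \<in> borel_measurable borel" and c: "c \<noteq> 0"
  shows "cmod c ^ 4 * (\<integral>y. F (refl_dil c y) \<partial>lborel) = (\<integral>y. F y \<partial>lborel)"
proof -
  have [measurable]: "refl_dil c \<in> borel_measurable lborel" by measurable
  have "(\<integral>y. F y \<partial>lborel) = (\<integral>y. F y \<partial>density (distr lborel borel (refl_dil c)) (\<lambda>_. ennreal (cmod c ^ 4)))"
    by (simp add: lborel_refl_dil[OF c])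
  also have "\<dots> = (\<integral>y. (cmod c ^ 4) *\<^sub>R F y \<partial>distr lborel borel (refl_dil c))"
    by (rule integral_density) auto
  also have "\<dots> = (\<integral>y. (cmod c ^ 4) *\<^sub>R F (refl_dil c y) \<partial>lborel)"
    by (rule integral_distr) auto
  finally show ?thesis by simp
qed

lemma compactly_supported_mult_cutoff:
  assumes "continuous_on UNIV h"
  shows "compactly_supported (\<lambda>y. max 0 (min 1 (r - norm y)) * h y)"
  unfolding compactly_supported_def using assms
  by (auto intro!: continuous_intros exI[of _ r])

context heis_heat
begin

text \<open>Both sides solve the equation, are bounded and start from \<open>g\<close>, so
  \<open>caloric_le\<close> in both directions identifies them. The automorphism carries a curve of
  direction \<open>b\<close> to one of direction \<open>c * cnj b\<close>, which is where rotated
  frames are indispensable.\<close>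

lemma heat_evol_refl_dil:
  assumes g: "compactly_supported g" and c: "c \<noteq> 0" and t: "t > 0"
  shows "heat_evol p g t x = heat_evol p (\<lambda>y. g (refl_dil (1 / cnj c) y)) ((cmod c)\<^sup>2 * t) (refl_dil c x)"
proof -
  define g' where "g' y = g (refl_dil (1 / cnj c) y)" for y
  define u where "u = heat_evol p g'"
  define v where "v t x = u ((cmod c)\<^sup>2 * t) (refl_dil c x)" for t x
  have c2: "(cmod c)\<^sup>2 > 0" using c by simp
  have g': "compactly_supported g'"
    unfolding g'_def[abs_def] using g c by (intro compactly_supported_refl_dil) auto
  obtain D1 D2 Dt where "caloric_jet (heat_evol p g') D1 D2 Dt"
    "continuous_on heat_domain (\<lambda>(t, x). heat_evol p g' t x)"
    by (rule heat_evol_jet[OF g']) (rule that)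
  then have jet: "caloric_jet u D1 D2 Dt" and cont: "continuous_on heat_domain (\<lambda>(t, x). u t x)"
    by (simp_all add: u_def)
  obtain E1 E2 Et where jet0: "caloric_jet (heat_evol p g) E1 E2 Et"
    and cont0: "continuous_on heat_domain (\<lambda>(t, x). heat_evol p g t x)"
    by (rule heat_evol_jet[OF g]) (rule that)
  have line: "refl_dil c (x \<odot> (of_real s * b, 0)) = refl_dil c x \<odot> (of_real s * (c * cnj b), 0)" for x s b
  proof -
    have "refl_dil c (of_real s * b, 0) = (of_real s * (c * cnj b), 0)"
      by (simp add: refl_dil_def)
    then show ?thesis by (simp only: refl_dil_hmul)
  qed
  have jetv: "caloric_jet v (\<lambda>b t x. D1 (c * cnj b) ((cmod c)\<^sup>2 * t) (refl_dil c x))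
      (\<lambda>b t x. D2 (c * cnj b) ((cmod c)\<^sup>2 * t) (refl_dil c x))
      (\<lambda>t x. (cmod c)\<^sup>2 * Dt ((cmod c)\<^sup>2 * t) (refl_dil c x))"
    unfolding caloric_jet_def
  proof (intro conjI allI impI)
    fix t :: real and b b' :: complex and x s
    assume "t > 0"
    then have t: "(cmod c)\<^sup>2 * t > 0" using c2 by simp
    note j = caloric_jetD[OF jet t]
    have "((\<lambda>s. (cmod c)\<^sup>2 * s) has_field_derivative (cmod c)\<^sup>2) (at t)"
      by (auto intro!: derivative_eq_intros)
    from DERIV_chain2[OF j(1) this]
    show "((\<lambda>s. v s x) has_field_derivative (cmod c)\<^sup>2 * Dt ((cmod c)\<^sup>2 * t) (refl_dil c x)) (at t)"
      by (simp add: v_def mult.commute)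
    show "((\<lambda>s. v t (x \<odot> (of_real s * b, 0))) has_field_derivative
        D1 (c * cnj b) ((cmod c)\<^sup>2 * t) (refl_dil c (x \<odot> (of_real s * b, 0)))) (at s)"
      unfolding v_def line by (rule j(2))
    show "((\<lambda>s. D1 (c * cnj b) ((cmod c)\<^sup>2 * t) (refl_dil c (x \<odot> (of_real s * b, 0)))) has_field_derivative
        D2 (c * cnj b) ((cmod c)\<^sup>2 * t) (refl_dil c (x \<odot> (of_real s * b, 0)))) (at s)"
      unfolding line by (rule j(3))
    assume "b'\<^sup>2 = - (b\<^sup>2)"
    then have "(cnj b')\<^sup>2 = - ((cnj b)\<^sup>2)"
      by (metis complex_cnj_minus complex_cnj_power)
    then have "(c * cnj b')\<^sup>2 = - ((c * cnj b)\<^sup>2)"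
      by (simp add: power_mult_distrib)
    from j(4)[OF this, of "refl_dil c x"]
    show "(cmod b)\<^sup>2 * ((cmod c)\<^sup>2 * Dt ((cmod c)\<^sup>2 * t) (refl_dil c x)) =
        D2 (c * cnj b) ((cmod c)\<^sup>2 * t) (refl_dil c x) + D2 (c * cnj b') ((cmod c)\<^sup>2 * t) (refl_dil c x)"
      by (simp add: norm_mult power_mult_distrib mult_ac)
  qed
  have contv: "continuous_on heat_domain (\<lambda>(t, x). v t x)"
  proof -
    have "continuous_on heat_domain (\<lambda>z. ((cmod c)\<^sup>2 * fst z, refl_dil c (snd z)))"
      by (intro continuous_intros)
    moreover have "(\<lambda>z. ((cmod c)\<^sup>2 * fst z, refl_dil c (snd z))) ` heat_domain \<subseteq> heat_domain"
      using c2 by auto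
    ultimately show ?thesis
      using continuous_on_compose2[OF cont, of heat_domain "\<lambda>z. ((cmod c)\<^sup>2 * fst z, refl_dil c (snd z))"]
      by (simp add: v_def split_beta')
  qed
  obtain M where M: "M > 0" "\<And>y. \<bar>g y\<bar> \<le> M"
    using compactly_supported_bounded[OF g] by blast
  have b1: "\<bar>heat_evol p g t x\<bar> \<le> M" if "t > 0" for t x
    using that g M(2) by (rule heat_evol_bounded)
  have b2: "\<bar>v t x\<bar> \<le> M" if "t > 0" for t x
    unfolding v_def u_def by (rule heat_evol_bounded) (use that c2 g' M(2) in \<open>auto simp: g'_def\<close>)
  have close: "\<exists>\<delta>>0. \<forall>t x. 0 < t \<and> t < \<delta> \<and> norm x \<le> R \<longrightarrow> \<bar>heat_evol p g t x - v t x\<bar> \<le> e"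
    if e: "e > 0" for R e
  proof -
    obtain \<delta>1 where \<delta>1: "\<delta>1 > 0"
      "\<And>t x. 0 < t \<Longrightarrow> t < \<delta>1 \<Longrightarrow> norm x \<le> R \<Longrightarrow> \<bar>heat_evol p g t x - g x\<bar> \<le> e / 2"
      using heat_evol_initial[OF g, of "e / 2" R] e by auto
    obtain \<delta>2 where \<delta>2: "\<delta>2 > 0"
      "\<And>t x. 0 < t \<Longrightarrow> t < \<delta>2 \<Longrightarrow> norm x \<le> (cmod c + (cmod c)\<^sup>2) * R \<Longrightarrow> \<bar>u t x - g' x\<bar> \<le> e / 2"
      using heat_evol_initial[OF g', of "e / 2" "(cmod c + (cmod c)\<^sup>2) * R"] e unfolding u_def by auto
    define \<delta> where "\<delta> = min \<delta>1 (\<delta>2 / (cmod c)\<^sup>2)"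
    have "\<bar>heat_evol p g t x - v t x\<bar> \<le> e" if "0 < t" "t < \<delta>" "norm x \<le> R" for t x
    proof -
      have "(cmod c)\<^sup>2 * t < \<delta>2" using that c2 by (simp add: \<delta>_def pos_less_divide_eq mult.commute)
      moreover have "norm (refl_dil c x) \<le> (cmod c + (cmod c)\<^sup>2) * R"
        using norm_refl_dil[of c x] that(3) by (rule order_trans[OF _ mult_left_mono]) auto
      ultimately have "\<bar>v t x - g' (refl_dil c x)\<bar> \<le> e / 2"
        unfolding v_def using that c2 by (intro \<delta>2(2)) auto
      moreover have "g' (refl_dil c x) = g x"
        using c by (simp add: g'_def refl_dil_inverse)
      moreover have "\<bar>heat_evol p g t x - g x\<bar> \<le> e / 2"
        using that by (intro \<delta>1(2)) (auto simp: \<delta>_def)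
      ultimately show ?thesis by linarith
    qed
    moreover have "\<delta> > 0" using \<delta>1(1) \<delta>2(1) c2 by (simp add: \<delta>_def)
    ultimately show ?thesis by blast
  qed
  have close_le: "\<exists>\<delta>>0. \<forall>t x. 0 < t \<and> t < \<delta> \<and> norm x \<le> R \<longrightarrow> heat_evol p g t x \<le> v t x + e"
    "\<exists>\<delta>>0. \<forall>t x. 0 < t \<and> t < \<delta> \<and> norm x \<le> R \<longrightarrow> v t x \<le> heat_evol p g t x + e"
    if e: "e > 0" for R e
  proof -
    obtain \<delta> where \<delta>: "\<delta> > 0"
      "\<And>t x. 0 < t \<Longrightarrow> t < \<delta> \<Longrightarrow> norm x \<le> R \<Longrightarrow> \<bar>heat_evol p g t x - v t x\<bar> \<le> e"
      using close[OF e, of R] by blast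
    have "heat_evol p g t x \<le> v t x + e" "v t x \<le> heat_evol p g t x + e"
      if "0 < t" "t < \<delta>" "norm x \<le> R" for t x
      using \<delta>(2)[OF that] by (auto simp: abs_le_iff)
    then show "\<exists>\<delta>>0. \<forall>t x. 0 < t \<and> t < \<delta> \<and> norm x \<le> R \<longrightarrow> heat_evol p g t x \<le> v t x + e"
      "\<exists>\<delta>>0. \<forall>t x. 0 < t \<and> t < \<delta> \<and> norm x \<le> R \<longrightarrow> v t x \<le> heat_evol p g t x + e"
      using \<delta>(1) by blast+
  qed
  have bdd: "heat_evol p g t x \<le> v t x + 2 * M" "v t x \<le> heat_evol p g t x + 2 * M" if "t > 0" for t x
    using b1[OF that, of x] b2[OF that, of x] by (auto simp: abs_le_iff)
  have "heat_evol p g t x \<le> v t x"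
    by (rule caloric_le[OF jet0 jetv cont0 contv bdd(1) close_le(1) t])
  moreover have "v t x \<le> heat_evol p g t x"
    by (rule caloric_le[OF jetv jet0 contv cont0 bdd(2) close_le(2) t])
  ultimately show ?thesis by (simp add: v_def u_def g'_def[abs_def])
qed

text \<open>At the identity, \<open>heat_evol_refl_dil\<close> says that both kernels, after
  inversion, have the same integral against every compactly supported \<open>g\<close>. Taking
  \<open>g\<close> to be a cutoff times their difference makes the resulting integrand nonnegative
  and continuous with integral 0.\<close>

lemma p_refl_dil:
  assumes t: "t > 0" and c: "c \<noteq> 0"
  shows "p t z = cmod c ^ 4 * p ((cmod c)\<^sup>2 * t) (refl_dil c z)"
proof -
  define q where "q z = cmod c ^ 4 * p ((cmod c)\<^sup>2 * t) (refl_dil c z)" for z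
  define h where "h y = p t (hinv y) - q (hinv y)" for y
  have t': "(cmod c)\<^sup>2 * t > 0" using t c by simp
  have ch: "continuous_on UNIV (\<lambda>y. p t (hinv y))" "continuous_on UNIV (\<lambda>y. q (hinv y))"
    unfolding q_def using t t' by (intro continuous_intros continuous_on_p; simp)+
  then have "continuous_on UNIV h" unfolding h_def by (intro continuous_intros)
  define y0 where "y0 = hinv z"
  \<comment> \<open>The cutoff equals 1 at \<open>y0\<close>, so vanishing of
    \<open>h y0 * g y0\<close> forces \<open>h y0 = 0\<close>.\<close>
  define g where "g y = max 0 (min 1 ((norm y0 + 1) - norm y)) * h y" for y
  have g: "compactly_supported g"
    unfolding g_def[abs_def] by (rule compactly_supported_mult_cutoff) fact
  then obtain a b where ab: "\<And>y. y \<notin> cbox a b \<Longrightarrow> g y = 0" "box a b \<noteq> {}"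
    using compactly_supported_cbox by blast
  have cg: "continuous_on UNIV g" using g by (simp add: compactly_supported_def)
  have "(\<integral>y. p t (hinv y) * g y \<partial>lborel) = heat_evol p g t (0, 0)"
    by (simp add: heat_evol_def hmul_0_right)
  also have "\<dots> = (\<integral>y. p ((cmod c)\<^sup>2 * t) (hinv y) * g (refl_dil (1 / cnj c) y) \<partial>lborel)"
    using heat_evol_refl_dil[OF g c t, of "(0, 0)"]
    by (simp add: heat_evol_def hmul_0_right refl_dil_def[of c "(0, 0)"])
  also have "\<dots> = cmod c ^ 4 * (\<integral>y. p ((cmod c)\<^sup>2 * t) (hinv (refl_dil c y)) * g y \<partial>lborel)"
  proof -
    have "(\<lambda>y. p ((cmod c)\<^sup>2 * t) (hinv y) * g (refl_dil (1 / cnj c) y)) \<in> borel_measurable borel"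
      using t' by (intro borel_measurable_continuous_onI continuous_intros continuous_on_p
          continuous_on_compose2[OF cg]) auto
    from integral_refl_dil[OF this c] show ?thesis
      by (simp add: refl_dil_inverse[OF c])
  qed
  also have "\<dots> = (\<integral>y. q (hinv y) * g y \<partial>lborel)"
    by (simp add: q_def refl_dil_hinv mult.assoc)
  finally have eq: "(\<integral>y. p t (hinv y) * g y \<partial>lborel) = (\<integral>y. q (hinv y) * g y \<partial>lborel)" .
  have cont: "continuous_on (cbox a b) (\<lambda>y. p t (hinv y) * g y)"
      "continuous_on (cbox a b) (\<lambda>y. q (hinv y) * g y)" "continuous_on (cbox a b) (\<lambda>y. h y * g y)"
    using ch \<open>continuous_on UNIV h\<close> cg by (auto intro!: continuous_intros intro: continuous_on_subset)
  have "integral (cbox a b) (\<lambda>y. h y * g y) =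
      integral (cbox a b) (\<lambda>y. p t (hinv y) * g y) - integral (cbox a b) (\<lambda>y. q (hinv y) * g y)"
    using cont by (subst integral_diff[symmetric]) (auto simp: h_def left_diff_distrib intro: integrable_continuous)
  also have "\<dots> = 0"
    using eq integral_lborel_cbox(2)[OF cont(1)] integral_lborel_cbox(2)[OF cont(2)] ab(1) by simp
  finally have int0: "integral (cbox a b) (\<lambda>y. h y * g y) = 0" .
  have "h y * g y \<ge> 0" for y
  proof -
    have "h y * g y = max 0 (min 1 ((norm y0 + 1) - norm y)) * (h y * h y)"
      by (simp add: g_def)
    also have "\<dots> \<ge> 0" by (intro mult_nonneg_nonneg zero_le_square) simp
    finally show ?thesis .
  qed
  then have "\<forall>y\<in>cbox a b. h y * g y = 0"
    using int0 integral_cbox_eq_0_iff[OF cont(3) ab(2)] by blast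
  then have "h y0 * g y0 = 0" using ab(1) by (cases "y0 \<in> cbox a b") auto
  then have "h y0 = 0" by (simp add: g_def)
  then show ?thesis by (simp add: h_def q_def y0_def)
qed

lemma p_hinv:
  assumes "t > 0"
  shows "p t (hinv x) = p t x"
proof -
  \<comment> \<open>This unimodular \<open>c\<close> satisfies
    \<open>c * cnj (fst x) = - fst x\<close>, so the reflection agrees with inversion at this one
    point.\<close>
  define c where "c = (if fst x = 0 then 1 else - (fst x / cnj (fst x)))"
  have "cmod c = 1" by (simp add: c_def norm_divide)
  moreover have "refl_dil c x = hinv x"
    using \<open>cmod c = 1\<close> by (simp add: refl_dil_def hinv_def) (simp add: c_def)
  moreover have "c \<noteq> 0" using \<open>cmod c = 1\<close> by auto
  ultimately show ?thesis using p_refl_dil[OF assms, of c x] by simp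
qed

lemma p_scaling:
  assumes "t > 0" "s > 0"
  shows "p t x = (s / t)\<^sup>2 * p s (refl_dil (of_real (sqrt (s / t))) x)"
proof -
  have "sqrt (s / t) ^ 4 = (sqrt (s / t) ^ 2) ^ 2" by (simp flip: power_mult)
  then show ?thesis
    using p_refl_dil[OF assms(1), of "of_real (sqrt (s / t))" x] assms by simp
qed

section \<open>The semigroup law and kernel bounds\<close>

lemma p_nn_integral: "t > 0 \<Longrightarrow> (\<integral>\<^sup>+y. ennreal (p t y) \<partial>lborel) = 1"
  using nn_integral_eq_integral[OF p_integrable, of t] p_integral[of t] p_pos[of t]
  by (simp add: less_imp_le)

lemma caloric_jet_p_shift:
  assumes "caloric_jet p D1 D2 Dt" "s > 0"
  shows "caloric_jet (\<lambda>t x. p (t + s) x) (\<lambda>c t x. D1 c (t + s) x) (\<lambda>c t x. D2 c (t + s) x) (\<lambda>t x. Dt (t + s) x)"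
  unfolding caloric_jet_def
proof (intro conjI allI impI)
  fix t :: real and c b :: complex and x r
  assume "t > 0"
  then have ts: "t + s > 0" using assms(2) by simp
  note j = caloric_jetD[OF assms(1) ts]
  show "((\<lambda>r. p (r + s) x) has_field_derivative Dt (t + s) x) (at t)"
    using j(1)[of x] by (simp add: DERIV_shift)
  show "((\<lambda>r. p (t + s) (x \<odot> (of_real r * c, 0))) has_field_derivative
      D1 c (t + s) (x \<odot> (of_real r * c, 0))) (at r)"
    by (rule j(2))
  show "((\<lambda>r. D1 c (t + s) (x \<odot> (of_real r * c, 0))) has_field_derivative
      D2 c (t + s) (x \<odot> (of_real r * c, 0))) (at r)"
    by (rule j(3))
  assume "b\<^sup>2 = - (c\<^sup>2)"
  then show "(cmod c)\<^sup>2 * Dt (t + s) x = D2 c (t + s) x + D2 b (t + s) x"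
    by (rule j(4))
qed

lemma p_initial_uniform:
  assumes s: "s > 0" and e: "e > 0"
  shows "\<exists>\<delta>>0. \<forall>t x. 0 < t \<and> t < \<delta> \<and> norm x \<le> R \<longrightarrow> \<bar>p (t + s) x - p s x\<bar> \<le> e"
proof -
  have "uniformly_continuous_on ({s..s + 1} \<times> cball 0 R) (\<lambda>z. p (fst z) (snd z))"
    using s by (intro compact_uniformly_continuous compact_Times continuous_on_p continuous_intros) auto
  then obtain d where d: "d > 0" "\<And>z z'. z \<in> {s..s + 1} \<times> cball 0 R \<Longrightarrow> z' \<in> {s..s + 1} \<times> cball 0 R \<Longrightarrow>
      dist z' z < d \<Longrightarrow> dist (p (fst z') (snd z')) (p (fst z) (snd z)) < e"
    unfolding uniformly_continuous_on_def using e by metis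
  have "\<bar>p (t + s) x - p s x\<bar> \<le> e" if "0 < t" "t < min d 1" "norm x \<le> R" for t x
    using d(2)[of "(s, x)" "(t + s, x)"] that by (auto simp: dist_Pair_Pair dist_real_def)
  then show ?thesis using d(1) by (intro exI[of _ "min d 1"]) auto
qed

text \<open>Both sides solve the equation, and at time 0 the truncated \<open>p s\<close> lies below
  \<open>p s\<close>; the maximum principle preserves the order. Truncation makes the datum
  compactly supported, and the inequality survives its removal in
  \<open>p_convolution_le\<close>.\<close>

lemma heat_evol_cutoff_le:
  assumes s: "s > 0" and t: "t > 0"
  shows "heat_evol p (\<lambda>y. max 0 (min 1 (r - norm y)) * p s y) t x \<le> p (t + s) x"
proof -
  define g where "g y = max 0 (min 1 (r - norm y)) * p s y" for y
  have cps: "continuous_on UNIV (p s)"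
    using s by (intro continuous_on_p continuous_intros) auto
  have g: "compactly_supported g"
    unfolding g_def[abs_def] by (rule compactly_supported_mult_cutoff) fact
  have gle: "g y \<le> p s y" for y
    unfolding g_def using p_pos[OF s, of y] by (intro mult_left_le_one_le) auto
  obtain D1 D2 Dt where jet: "caloric_jet (heat_evol p g) D1 D2 Dt"
    "continuous_on heat_domain (\<lambda>(t, x). heat_evol p g t x)"
    by (rule heat_evol_jet[OF g]) (rule that)
  obtain E1 E2 Et where jet0: "caloric_jet p E1 E2 Et"
    by (rule heat_kernel_jet[OF heat_kernel]) (rule that)
  obtain M where M: "M > 0" "\<And>y. \<bar>g y\<bar> \<le> M"
    using compactly_supported_bounded[OF g] by blast
  have "heat_evol p g t x \<le> p (t + s) x"
  proof (rule caloric_le[OF jet(1) caloric_jet_p_shift[OF jet0 s] jet(2) _ _ _ t])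
    show "continuous_on heat_domain (\<lambda>(t, x). p (t + s) x)"
      unfolding split_beta' using s by (intro continuous_on_p continuous_intros) auto
    show "heat_evol p g t x \<le> p (t + s) x + M" if "t > 0" for t x
      using heat_evol_bounded[OF that g M(2), of x] p_pos[of "t + s" x] that s by linarith
    show "\<exists>\<delta>>0. \<forall>t x. 0 < t \<and> t < \<delta> \<and> norm x \<le> R \<longrightarrow> heat_evol p g t x \<le> p (t + s) x + e"
      if e: "e > 0" for R e
    proof -
      obtain \<delta>1 where \<delta>1: "\<delta>1 > 0"
        "\<And>t x. 0 < t \<Longrightarrow> t < \<delta>1 \<Longrightarrow> norm x \<le> R \<Longrightarrow> \<bar>heat_evol p g t x - g x\<bar> \<le> e / 2"
        using heat_evol_initial[OF g, of "e / 2" R] e by auto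
      obtain \<delta>2 where \<delta>2: "\<delta>2 > 0"
        "\<And>t x. 0 < t \<Longrightarrow> t < \<delta>2 \<Longrightarrow> norm x \<le> R \<Longrightarrow> \<bar>p (t + s) x - p s x\<bar> \<le> e / 2"
        using p_initial_uniform[OF s, of "e / 2" R] e by auto
      have "heat_evol p g t x \<le> p (t + s) x + e"
        if "0 < t" "t < min \<delta>1 \<delta>2" "norm x \<le> R" for t x
      proof -
        have "\<bar>heat_evol p g t x - g x\<bar> \<le> e / 2" "\<bar>p (t + s) x - p s x\<bar> \<le> e / 2"
          using \<delta>1(2)[of t x] \<delta>2(2)[of t x] that by auto
        then show ?thesis using gle[of x] by linarith
      qed
      then show ?thesis using \<delta>1(1) \<delta>2(1) by (intro exI[of _ "min \<delta>1 \<delta>2"]) auto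
    qed
  qed
  then show ?thesis by (simp add: g_def[abs_def])
qed

text \<open>Monotone convergence in the cutoff radius \<open>n\<close> removes the truncation from
  \<open>heat_evol_cutoff_le\<close>.\<close>

lemma p_convolution_le:
  assumes s: "s > 0" and t: "t > 0"
  shows "(\<integral>\<^sup>+y. ennreal (p t (hinv y \<odot> x)) * ennreal (p s y) \<partial>lborel) \<le> ennreal (p (t + s) x)"
proof -
  note [measurable] = p_measurable[OF s] p_measurable[OF t]
  define g where "g n y = max 0 (min 1 (real n - norm y)) * p s y" for n and y :: heis
  have cps: "continuous_on UNIV (p s)"
    using s by (intro continuous_on_p continuous_intros) auto
  have g: "compactly_supported (g n)" for n
    unfolding g_def[abs_def] by (rule compactly_supported_mult_cutoff) fact
  have g0: "g n y \<ge> 0" for n y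
    unfolding g_def using p_pos[OF s, of y] by (intro mult_nonneg_nonneg) auto
  have [measurable]: "g n \<in> borel_measurable borel" for n
    using g[of n] by (simp add: compactly_supported_def borel_measurable_continuous_onI)
  define F where "F n y = ennreal (p t (hinv y \<odot> x) * g n y)" for n y
  have [measurable]: "F n \<in> borel_measurable lborel" for n unfolding F_def by measurable
  have inc: "incseq F"
    unfolding F_def incseq_def le_fun_def g_def
  proof (intro allI impI ennreal_leI mult_left_mono mult_right_mono)
    show "max 0 (min 1 (real m - norm y)) \<le> max 0 (min 1 (real n - norm y))" if "m \<le> n" for m n and y :: heis
      using that by auto
  qed (use p_pos[OF s] p_pos[OF t] in \<open>simp_all add: less_imp_le\<close>)
  have "(\<integral>\<^sup>+y. ennreal (p t (hinv y \<odot> x)) * ennreal (p s y) \<partial>lborel) \<le> (\<integral>\<^sup>+y. (SUP n. F n y) \<partial>lborel)"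
  proof (rule nn_integral_mono)
    fix y :: heis
    obtain n where "real n \<ge> norm y + 1" using real_arch_simple by blast
    then have "g n y = p s y" by (simp add: g_def)
    then have "ennreal (p t (hinv y \<odot> x)) * ennreal (p s y) = F n y"
      using p_pos[OF s, of y] p_pos[OF t, of "hinv y \<odot> x"] by (simp add: F_def ennreal_mult less_imp_le)
    then show "ennreal (p t (hinv y \<odot> x)) * ennreal (p s y) \<le> (SUP n. F n y)"
      by (auto intro: SUP_upper)
  qed
  also have "\<dots> = (SUP n. \<integral>\<^sup>+y. F n y \<partial>lborel)"
    by (rule nn_integral_monotone_convergence_SUP[OF inc]) simp
  also have "\<dots> \<le> ennreal (p (t + s) x)"
  proof (rule SUP_least)
    fix n
    have "(\<integral>\<^sup>+y. F n y \<partial>lborel) = ennreal (heat_evol p (g n) t x)"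
      unfolding F_def heat_evol_def using heat_evol_integrable[OF t g] g0 p_pos[OF t]
      by (intro nn_integral_eq_integral AE_I2 mult_nonneg_nonneg) (simp_all add: less_imp_le)
    also have "\<dots> \<le> ennreal (p (t + s) x)"
      unfolding g_def[abs_def] by (intro ennreal_leI heat_evol_cutoff_le s t)
    finally show "(\<integral>\<^sup>+y. F n y \<partial>lborel) \<le> ennreal (p (t + s) x)" .
  qed
  finally show ?thesis .
qed

text \<open>
  Both sides of the Chapman--Kolmogorov inequality have mass \<open>1\<close>, so they agree almost everywhere;
  then \<open>p 2 x = \<integral> p 1 (y\<^sup>-\<^sup>1 x) p 1 y dy \<le> \<parallel>p 1\<parallel>\<^sub>2\<^sup>2 \<le> p 2 0\<close> by the symmetry of \<open>p 1\<close>.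
\<close>

lemma p_2_le: "p 2 x \<le> p 2 (0, 0)"
proof -
  note [measurable] = p_measurable[of 1, simplified] p_measurable[of 2, simplified]
  define k where "k x = (\<integral>\<^sup>+y. ennreal (p 1 (hinv y \<odot> x)) * ennreal (p 1 y) \<partial>lborel)" for x
  have [measurable]: "k \<in> borel_measurable borel" unfolding k_def by measurable
  have k_le: "k x \<le> ennreal (p 2 x)" for x
    unfolding k_def using p_convolution_le[of 1 1 x] by simp
  have "(\<integral>\<^sup>+x. k x \<partial>lborel) = (\<integral>\<^sup>+y. \<integral>\<^sup>+x. ennreal (p 1 (hinv y \<odot> x)) * ennreal (p 1 y) \<partial>lborel \<partial>lborel)"
    unfolding k_def by (rule lborel_pair.Fubini') measurable
  also have "\<dots> = (\<integral>\<^sup>+y. (\<integral>\<^sup>+x. ennreal (p 1 x) \<partial>lborel) * ennreal (p 1 y) \<partial>lborel)"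
    by (subst nn_integral_multc, measurable) (simp add: nn_integral_hmul_left[of "\<lambda>x. ennreal (p 1 x)"])
  also have "\<dots> = 1" by (simp add: p_nn_integral)
  finally have k1: "(\<integral>\<^sup>+x. k x \<partial>lborel) = 1" .
  have "(\<integral>\<^sup>+x. ennreal (p 2 x) - k x \<partial>lborel) = (\<integral>\<^sup>+x. ennreal (p 2 x) \<partial>lborel) - (\<integral>\<^sup>+x. k x \<partial>lborel)"
    by (rule nn_integral_diff) (auto simp: k1 k_le)
  also have "\<dots> = 0" by (simp add: k1 p_nn_integral)
  finally have AE: "AE x in lborel. ennreal (p 2 x) - k x = 0"
    by (subst (asm) nn_integral_0_iff_AE) auto
  define S where "S = (\<integral>\<^sup>+y. ennreal ((p 1 y)\<^sup>2) \<partial>lborel)"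
  \<comment> \<open>The pointwise bound 2 a b <= a^2 + b^2 takes the place of the Cauchy-Schwarz
    inequality: by invariance of the measure both squares integrate to \<open>S\<close>, whether
    finite or not.\<close>
  have k_S: "k x \<le> S" for x
  proof -
    have "k x \<le> (\<integral>\<^sup>+y. ennreal (1 / 2) * (ennreal ((p 1 (hinv y \<odot> x))\<^sup>2) + ennreal ((p 1 y)\<^sup>2)) \<partial>lborel)"
      unfolding k_def
    proof (rule nn_integral_mono)
      fix y
      have "p 1 (hinv y \<odot> x) * p 1 y \<le> 1 / 2 * ((p 1 (hinv y \<odot> x))\<^sup>2 + (p 1 y)\<^sup>2)"
        using sum_squares_bound[of "p 1 (hinv y \<odot> x)" "p 1 y"] by simp
      then have "ennreal (p 1 (hinv y \<odot> x) * p 1 y) \<le> ennreal (1 / 2 * ((p 1 (hinv y \<odot> x))\<^sup>2 + (p 1 y)\<^sup>2))"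
        by (rule ennreal_leI)
      also have "\<dots> = ennreal (1 / 2) * ennreal ((p 1 (hinv y \<odot> x))\<^sup>2 + (p 1 y)\<^sup>2)"
        by (rule ennreal_mult) auto
      also have "ennreal ((p 1 (hinv y \<odot> x))\<^sup>2 + (p 1 y)\<^sup>2) =
          ennreal ((p 1 (hinv y \<odot> x))\<^sup>2) + ennreal ((p 1 y)\<^sup>2)"
        by (rule ennreal_plus) auto
      also have "ennreal (p 1 (hinv y \<odot> x) * p 1 y) = ennreal (p 1 (hinv y \<odot> x)) * ennreal (p 1 y)"
        using p_pos[of 1] by (intro ennreal_mult) (auto simp: less_imp_le)
      finally show "ennreal (p 1 (hinv y \<odot> x)) * ennreal (p 1 y) \<le>
          ennreal (1 / 2) * (ennreal ((p 1 (hinv y \<odot> x))\<^sup>2) + ennreal ((p 1 y)\<^sup>2))" .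
    qed
    also have "\<dots> = ennreal (1 / 2) * ((\<integral>\<^sup>+y. ennreal ((p 1 (hinv y \<odot> x))\<^sup>2) \<partial>lborel) + S)"
      unfolding S_def by (subst nn_integral_cmult, measurable) (subst nn_integral_add, auto)
    also have "\<dots> = ennreal (1 / 2) * (S + S)"
      by (simp add: S_def nn_integral_hinv_hmul[of "\<lambda>y. ennreal ((p 1 y)\<^sup>2)"])
    also have "\<dots> = ennreal (1 / 2) * ennreal 2 * S"
      by (simp add: mult_2 mult.assoc)
    also have "ennreal (1 / 2) * ennreal 2 = 1"
      by (subst ennreal_mult[symmetric]) auto
    finally have "k x \<le> 1 * S" .
    then show ?thesis by simp
  qed
  have "k (0, 0) = S"
    unfolding k_def S_def
    by (intro nn_integral_cong)
       (simp add: hmul_0_right p_hinv power2_eq_square ennreal_mult p_pos less_imp_le)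
  then have S_le: "S \<le> ennreal (p 2 (0, 0))" using k_le[of "(0, 0)"] by simp
  \<comment> \<open>Stated as membership in a closed set, so that the bound passes from almost every
    point to every point.\<close>
  have "AE x in lborel. x \<in> {x. p 2 x \<le> p 2 (0, 0)}"
    using AE
  proof eventually_elim
    case (elim x)
    then have "ennreal (p 2 x) \<le> k x" by (simp add: diff_eq_0_iff_ennreal)
    also have "\<dots> \<le> S" by (rule k_S)
    also note S_le
    finally show ?case using p_pos[of 2 "(0, 0)"] by (simp add: less_imp_le)
  qed
  moreover have "closed {x. p 2 x \<le> p 2 (0, 0)}"
    by (intro closed_Collect_le continuous_on_p continuous_intros) auto
  ultimately show ?thesis
    using mem_closed_if_AE_lebesgue[of "{x. p 2 x \<le> p 2 (0, 0)}" x] AE_completion by blast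
qed

text \<open>Scaling from time 2, where \<open>p_2_le\<close> bounds the kernel; the 4 is the square
  of this time.\<close>

lemma p_upper_bound:
  assumes "t > 0"
  shows "p t x \<le> 4 * p 2 (0, 0) / t\<^sup>2"
proof -
  have "p t x = (2 / t)\<^sup>2 * p 2 (refl_dil (of_real (sqrt (2 / t))) x)"
    using assms by (intro p_scaling) auto
  also have "\<dots> \<le> (2 / t)\<^sup>2 * p 2 (0, 0)"
    by (intro mult_left_mono p_2_le) auto
  finally show ?thesis by (simp add: power_divide)
qed

text \<open>Scaling to time 1 carries the parabolic region into a fixed compact set, on which the
  continuous positive \<open>p 1\<close> has a positive minimum.\<close>

lemma p_lower_bound:
  obtains \<kappa> where "\<kappa> > 0"
    "\<And>t z. t > 0 \<Longrightarrow> cmod (fst z) \<le> sqrt t \<Longrightarrow> \<bar>snd z\<bar> \<le> t \<Longrightarrow> p t z \<ge> \<kappa> / t\<^sup>2"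
proof -
  define K where "K = cball (0 :: complex) 1 \<times> cball (0 :: real) 1"
  have "compact K" "K \<noteq> {}" unfolding K_def by (auto intro: compact_Times)
  moreover have "continuous_on K (p 1)" by (intro continuous_on_p continuous_intros) auto
  ultimately obtain z0 where z0: "z0 \<in> K" "\<And>z. z \<in> K \<Longrightarrow> p 1 z0 \<le> p 1 z"
    using continuous_attains_inf[of K "p 1"] by auto
  have "p t z \<ge> p 1 z0 / t\<^sup>2" if t: "t > 0" and z: "cmod (fst z) \<le> sqrt t" "\<bar>snd z\<bar> \<le> t" for t z
  proof -
    have "cmod (of_real (sqrt (1 / t))) = 1 / sqrt t"
      unfolding norm_of_real using t by (simp add: real_sqrt_divide)
    then have "refl_dil (of_real (sqrt (1 / t))) z \<in> K"
      using t z unfolding K_def refl_dil_def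
      by (simp add: norm_mult power_divide abs_mult pos_divide_le_eq del: norm_of_real)
    then have "p 1 z0 \<le> p 1 (refl_dil (of_real (sqrt (1 / t))) z)"
      by (rule z0)
    then have "(1 / t)\<^sup>2 * p 1 z0 \<le> (1 / t)\<^sup>2 * p 1 (refl_dil (of_real (sqrt (1 / t))) z)"
      by (rule mult_left_mono) simp
    also have "\<dots> = p t z"
      using p_scaling[OF t zero_less_one, of z] by simp
    finally have "(1 / t)\<^sup>2 * p 1 z0 \<le> p t z" .
    then show ?thesis by (simp add: power_divide)
  qed
  then show thesis using p_pos[of 1 z0] by (intro that[of "p 1 z0"]) auto
qed

end

section \<open>Mass retained in parabolic boxes\<close>

text \<open>The side lengths follow the dilations of the group, of order \<open>sqrt T\<close>
  horizontally and \<open>T\<close> in the last coordinate.\<close>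

definition parabolic_box :: "real \<Rightarrow> heis set" where
  "parabolic_box T = cbox (Complex (- sqrt T) (- sqrt T), - T) (Complex (sqrt T) (sqrt T), T)"

lemma mem_heis_cbox:
  "(\<eta>, \<sigma> :: real) \<in> cbox (Complex a1 a2, a3) (Complex b1 b2, b3) \<longleftrightarrow>
     a1 \<le> Re \<eta> \<and> Re \<eta> \<le> b1 \<and> a2 \<le> Im \<eta> \<and> Im \<eta> \<le> b2 \<and> a3 \<le> \<sigma> \<and> \<sigma> \<le> b3"
  by (auto simp: cbox_Pair_eq cbox_complex_eq mem_box_real)

lemma emeasure_heis_cbox:
  assumes "a1 \<le> b1" "a2 \<le> b2" "a3 \<le> b3"
  shows "emeasure lborel (cbox (Complex a1 a2, a3) (Complex b1 b2, b3)) =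
    ennreal ((b1 - a1) * (b2 - a2) * (b3 - a3))"
proof -
  have B: "(Basis :: heis set) = {(1, 0), (\<i>, 0), (0, 1)}"
    by (auto simp: Basis_prod_def Basis_complex_def)
  show ?thesis
    using assms by (simp add: emeasure_lborel_cbox_eq B inner_complex_def mult.assoc)
qed

lemma mem_parabolic_box:
  "(\<xi>, \<zeta>) \<in> parabolic_box T \<longleftrightarrow> \<bar>Re \<xi>\<bar> \<le> sqrt T \<and> \<bar>Im \<xi>\<bar> \<le> sqrt T \<and> \<bar>\<zeta>\<bar> \<le> T"
  unfolding parabolic_box_def mem_heis_cbox by auto

lemma emeasure_parabolic_box:
  assumes "T \<ge> 0"
  shows "emeasure lborel (parabolic_box T) = ennreal (8 * T\<^sup>2)"
proof -
  have "(sqrt T - - sqrt T) * (sqrt T - - sqrt T) * (T - - T) = 8 * T\<^sup>2"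
    using assms by (simp add: algebra_simps power2_eq_square)
  then show ?thesis
    unfolding parabolic_box_def using assms by (subst emeasure_heis_cbox) auto
qed

lemma parabolic_box_sets [measurable]: "parabolic_box T \<in> sets borel"
  by (simp add: parabolic_box_def)

lemma parabolic_box_mono: "S \<le> T \<Longrightarrow> parabolic_box S \<subseteq> parabolic_box T"
proof
  fix x assume "S \<le> T" "x \<in> parabolic_box S"
  then show "x \<in> parabolic_box T"
    using real_sqrt_le_mono[of S T] by (cases x) (auto simp: mem_parabolic_box simp del: real_sqrt_le_iff)
qed

context heis_heat
begin

text \<open>
  Seen from a point \<open>y\<close> of the box, the box contains the part of a small parabolic box of scale \<open>s\<close>,
  contracted towards the origin, on which both contributions to the last coordinate point inwards.
\<close>

lemma box_retains_mass:
  obtains c where "c > 0"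
    "\<And>s T y. 0 < s \<Longrightarrow> s \<le> T \<Longrightarrow> y \<in> parabolic_box T \<Longrightarrow>
       (\<integral>\<^sup>+x\<in>parabolic_box T. ennreal (p s (hinv y \<odot> x)) \<partial>lborel) \<ge> ennreal c"
proof -
  obtain \<kappa> where \<kappa>: "\<kappa> > 0"
    "\<And>t z. t > 0 \<Longrightarrow> cmod (fst z) \<le> sqrt t \<Longrightarrow> \<bar>snd z\<bar> \<le> t \<Longrightarrow> p t z \<ge> \<kappa> / t\<^sup>2"
    using p_lower_bound by blast
  have "(\<integral>\<^sup>+x\<in>parabolic_box T. ennreal (p s (hinv y \<odot> x)) \<partial>lborel) \<ge> ennreal (\<kappa> / 256)"
    if s: "0 < s" "s \<le> T" and y: "y \<in> parabolic_box T" for s T y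
  proof -
    note [measurable] = p_measurable[OF s(1)]
    obtain \<xi> \<zeta> where y_eq: "y = (\<xi>, \<zeta>)" by force
    have yT: "\<bar>Re \<xi>\<bar> \<le> sqrt T" "\<bar>Im \<xi>\<bar> \<le> sqrt T" "\<bar>\<zeta>\<bar> \<le> T"
      using y by (auto simp: y_eq mem_parabolic_box)
    \<comment> \<open>Adding \<open>- (r / 4)\<close> times \<open>\<xi>\<close> pulls the
      horizontal part inwards and leaves a margin of \<open>sqrt s / 4\<close> to the faces, more
      than the perturbation \<open>h\<close>. It does not move the last coordinate, because
      \<open>\<xi> * cnj \<xi>\<close> is real.\<close>
    define r where "r = sqrt s / sqrt T"
    have rT: "r * sqrt T = sqrt s" using s by (simp add: r_def)
    have r: "0 < r" "r \<le> 1" using s by (auto simp: r_def)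
    define h where "h = sqrt s / 8"
    have h: "h > 0" using s by (simp add: h_def)
    \<comment> \<open>Each of the three intervals lies on the side of 0 for which its contribution
      to the last coordinate has sign opposite to \<open>\<zeta>\<close>. Their sum \<open>w\<close>
      is at most \<open>T\<close> in modulus, so \<open>\<zeta> + w\<close> stays within
      \<open>T\<close> of 0.\<close>
    define l1 where "l1 = (if \<zeta> * Im \<xi> \<le> 0 then 0 else - h)"
    define l2 where "l2 = (if \<zeta> * Re \<xi> \<ge> 0 then 0 else - h)"
    define l3 where "l3 = (if \<zeta> \<le> 0 then 0 else - (s / 4))"
    define V where "V = cbox (Complex (l1 - r / 4 * Re \<xi>) (l2 - r / 4 * Im \<xi>), l3)
      (Complex (l1 - r / 4 * Re \<xi> + h) (l2 - r / 4 * Im \<xi> + h), l3 + s / 4)"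
    have V_sub: "cmod (fst z) \<le> sqrt s \<and> \<bar>snd z\<bar> \<le> s \<and> y \<odot> z \<in> parabolic_box T" if z: "z \<in> V" for z
    proof -
      obtain \<eta> \<sigma> where z_eq: "z = (\<eta>, \<sigma>)" by force
      define e1 where "e1 = Re \<eta> + r / 4 * Re \<xi>"
      define e2 where "e2 = Im \<eta> + r / 4 * Im \<xi>"
      have e: "l1 \<le> e1" "e1 \<le> l1 + h" "l2 \<le> e2" "e2 \<le> l2 + h" "l3 \<le> \<sigma>" "\<sigma> \<le> l3 + s / 4"
        using z unfolding V_def z_eq mem_heis_cbox e1_def e2_def by auto
      have abs_e: "\<bar>e1\<bar> \<le> h" "\<bar>e2\<bar> \<le> h" "\<bar>\<sigma>\<bar> \<le> s / 4"
        using e h s by (auto simp: l1_def l2_def l3_def split: if_splits)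
      have rg: "\<bar>r / 4 * Re \<xi>\<bar> \<le> sqrt s / 4" "\<bar>r / 4 * Im \<xi>\<bar> \<le> sqrt s / 4"
        using mult_left_mono[OF yT(1), of r] mult_left_mono[OF yT(2), of r] r rT by (auto simp: abs_mult)
      have "\<bar>Re \<eta>\<bar> \<le> sqrt s / 2" "\<bar>Im \<eta>\<bar> \<le> sqrt s / 2"
        using abs_e rg h unfolding e1_def e2_def h_def by linarith+
      then have "cmod \<eta> \<le> sqrt s"
        using cmod_le[of \<eta>] by linarith
      moreover have "\<bar>\<sigma>\<bar> \<le> s" using abs_e s by linarith
      moreover have "y \<odot> z \<in> parabolic_box T"
      proof -
        have contract: "\<bar>(1 - r / 4) * a\<bar> \<le> sqrt T - sqrt s / 4" if "\<bar>a\<bar> \<le> sqrt T" for a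
        proof -
          have "\<bar>(1 - r / 4) * a\<bar> = (1 - r / 4) * \<bar>a\<bar>" using r by (simp add: abs_mult)
          also have "\<dots> \<le> (1 - r / 4) * sqrt T" using r that by (intro mult_left_mono) auto
          also have "\<dots> = sqrt T - sqrt s / 4" using rT by (simp add: left_diff_distrib)
          finally show ?thesis .
        qed
        have Re: "Re (\<xi> + \<eta>) = (1 - r / 4) * Re \<xi> + e1" and Im: "Im (\<xi> + \<eta>) = (1 - r / 4) * Im \<xi> + e2"
          by (simp_all add: e1_def e2_def algebra_simps)
        have 1: "\<bar>Re (\<xi> + \<eta>)\<bar> \<le> sqrt T" "\<bar>Im (\<xi> + \<eta>)\<bar> \<le> sqrt T"
          unfolding Re Im using contract[OF yT(1)] contract[OF yT(2)] abs_e h unfolding h_def by linarith+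
        define w where "w = \<sigma> + 2 * (Im \<xi> * e1) - 2 * (Re \<xi> * e2)"
        have "Im (\<xi> * cnj \<eta>) = Im \<xi> * e1 - Re \<xi> * e2"
          by (simp add: e1_def e2_def algebra_simps)
        then have snd: "snd (y \<odot> z) = \<zeta> + w"
          by (simp add: y_eq z_eq w_def)
        have "(\<zeta> * Im \<xi>) * e1 \<le> 0"
          using e(1,2) by (cases "\<zeta> * Im \<xi> \<le> 0") (auto simp: l1_def intro: mult_nonpos_nonneg mult_nonneg_nonpos)
        moreover have "(\<zeta> * Re \<xi>) * e2 \<ge> 0"
          using e(3,4) by (cases "\<zeta> * Re \<xi> \<ge> 0") (auto simp: l2_def intro: mult_nonpos_nonpos)
        moreover have "\<zeta> * \<sigma> \<le> 0"
          using e(5,6) by (cases "\<zeta> \<le> 0") (auto simp: l3_def intro: mult_nonpos_nonneg mult_nonneg_nonpos)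
        ultimately have opp: "\<zeta> * w \<le> 0"
          unfolding w_def by (simp add: algebra_simps)
        have "\<bar>Im \<xi> * e1\<bar> \<le> sqrt T * h" "\<bar>Re \<xi> * e2\<bar> \<le> sqrt T * h"
          unfolding abs_mult using yT abs_e s by (auto intro!: mult_mono)
        moreover have "sqrt T * h \<le> T / 8"
          using s mult_left_mono[OF real_sqrt_le_mono[OF s(2)], of "sqrt T"] by (simp add: h_def)
        ultimately have "\<bar>w\<bar> \<le> T"
          using abs_e(3) s unfolding w_def by linarith
        then have "\<bar>\<zeta> + w\<bar> \<le> T"
          using opp yT(3) by (auto simp: mult_le_0_iff abs_le_iff)
        then show ?thesis
          using 1 snd by (simp add: y_eq z_eq mem_parabolic_box)
      qed
      ultimately show ?thesis by (simp add: z_eq)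
    qed
    \<comment> \<open>The sides \<open>h\<close>, \<open>h\<close> and \<open>s / 4\<close> give the
      256. The factor \<open>s\<^sup>2\<close> cancels against the kernel lower bound, leaving a
      constant independent of \<open>s\<close>, \<open>T\<close> and \<open>y\<close>.\<close>
    have "emeasure lborel V = ennreal (s\<^sup>2 / 256)"
    proof -
      have "h * h * (s / 4) = s\<^sup>2 / 256" using s by (simp add: h_def power2_eq_square)
      then show ?thesis
        unfolding V_def using h s by (subst emeasure_heis_cbox) auto
    qed
    then have "ennreal (\<kappa> / 256) = ennreal (\<kappa> / s\<^sup>2) * emeasure lborel V"
      using s \<kappa>(1) by (simp flip: ennreal_mult')
    also have "\<dots> = (\<integral>\<^sup>+z\<in>V. ennreal (\<kappa> / s\<^sup>2) \<partial>lborel)"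
      by (subst nn_integral_cmult_indicator) (auto simp: V_def)
    also have "\<dots> \<le> (\<integral>\<^sup>+z. ennreal (p s (hinv y \<odot> (y \<odot> z))) * indicator (parabolic_box T) (y \<odot> z) \<partial>lborel)"
      using V_sub \<kappa>(2)[OF s(1)]
      by (intro nn_integral_mono)
         (auto simp: indicator_def hmul_assoc[symmetric] hmul_hinv_left hmul_0_left intro!: ennreal_leI)
    also have "\<dots> = (\<integral>\<^sup>+x\<in>parabolic_box T. ennreal (p s (hinv y \<odot> x)) \<partial>lborel)"
      by (rule nn_integral_hmul_left[of "\<lambda>x. ennreal (p s (hinv y \<odot> x)) * indicator (parabolic_box T) x"]) measurable
    finally show ?thesis .
  qed
  then show thesis using \<kappa>(1) by (intro that[of "\<kappa> / 256"]) auto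
qed

lemma heat_semigroup_measurable [measurable]:
  assumes "t > 0" and [measurable]: "w \<in> borel_measurable borel"
  shows "heat_semigroup p t w \<in> borel_measurable borel"
proof -
  note [measurable] = p_measurable[OF assms(1)]
  show ?thesis unfolding heat_semigroup_def[abs_def] by measurable
qed

text \<open>Fubini applied to \<open>box_retains_mass\<close>, counting only mass that already lies
  in the box. A single constant for all \<open>s \<le> T\<close> lets it serve both the datum, with
  \<open>s = T\<close>, and the source, with \<open>s = T - \<tau>\<close>.\<close>

lemma heat_semigroup_box_mass:
  obtains c where "c > 0"
    "\<And>s T w. 0 < s \<Longrightarrow> s \<le> T \<Longrightarrow> w \<in> borel_measurable borel \<Longrightarrow>
       (\<integral>\<^sup>+x\<in>parabolic_box T. heat_semigroup p s w x \<partial>lborel) \<ge> ennreal c * (\<integral>\<^sup>+y\<in>parabolic_box T. w y \<partial>lborel)"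
proof -
  obtain c where c: "c > 0"
    "\<And>s T y. 0 < s \<Longrightarrow> s \<le> T \<Longrightarrow> y \<in> parabolic_box T \<Longrightarrow>
       (\<integral>\<^sup>+x\<in>parabolic_box T. ennreal (p s (hinv y \<odot> x)) \<partial>lborel) \<ge> ennreal c"
    using box_retains_mass by blast
  have "(\<integral>\<^sup>+x\<in>parabolic_box T. heat_semigroup p s w x \<partial>lborel) \<ge> ennreal c * (\<integral>\<^sup>+y\<in>parabolic_box T. w y \<partial>lborel)"
    if s: "0 < s" "s \<le> T" and [measurable]: "w \<in> borel_measurable borel" for s T w
  proof -
    note [measurable] = p_measurable[OF s(1)]
    have "ennreal c * (\<integral>\<^sup>+y\<in>parabolic_box T. w y \<partial>lborel) =
        (\<integral>\<^sup>+y. ennreal c * (w y * indicator (parabolic_box T) y) \<partial>lborel)"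
      by (subst nn_integral_cmult) auto
    also have "\<dots> \<le> (\<integral>\<^sup>+y. (\<integral>\<^sup>+x\<in>parabolic_box T. ennreal (p s (hinv y \<odot> x)) \<partial>lborel) * w y \<partial>lborel)"
    proof (rule nn_integral_mono)
      fix y
      show "ennreal c * (w y * indicator (parabolic_box T) y) \<le>
          (\<integral>\<^sup>+x\<in>parabolic_box T. ennreal (p s (hinv y \<odot> x)) \<partial>lborel) * w y"
        using mult_right_mono[OF c(2)[OF s, of y], of "w y"] by (cases "y \<in> parabolic_box T") auto
    qed
    also have "\<dots> = (\<integral>\<^sup>+y. \<integral>\<^sup>+x. ennreal (p s (hinv y \<odot> x)) * w y * indicator (parabolic_box T) x \<partial>lborel \<partial>lborel)"
      by (subst nn_integral_multc[symmetric]) (auto intro!: nn_integral_cong simp: mult_ac)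
    also have "\<dots> = (\<integral>\<^sup>+x. \<integral>\<^sup>+y. ennreal (p s (hinv y \<odot> x)) * w y * indicator (parabolic_box T) x \<partial>lborel \<partial>lborel)"
      by (rule lborel_pair.Fubini') measurable
    also have "\<dots> = (\<integral>\<^sup>+x\<in>parabolic_box T. heat_semigroup p s w x \<partial>lborel)"
      unfolding heat_semigroup_def by (intro nn_integral_cong nn_integral_multc) measurable
    finally show ?thesis .
  qed
  with c(1) show thesis by (rule that)
qed

end

section \<open>Convexity and a nonlinear integral inequality\<close>

text \<open>The chord from the origin lies above the graph. This is monotonicity of
  \<open>f v / v\<close> in a form that includes \<open>u = 0\<close>.\<close>

lemma convex_ratio_mono:
  fixes f :: "real \<Rightarrow> real"
  assumes "convex_on {0..} f" "f 0 = 0" "0 \<le> u" "u \<le> v" "v > 0"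
  shows "f u \<le> u / v * f v"
  using convex_onD[OF assms(1), of "u / v" 0 v] assms by simp

text \<open>The slope is the right derivative at \<open>v0\<close>, nonnegative by monotonicity. The
  terms are arranged without subtraction, so that the inequality can be integrated in
  \<open>ennreal\<close>.\<close>

lemma convex_supporting_line:
  fixes f :: "real \<Rightarrow> real"
  assumes cvx: "convex_on {0..} f" and mono: "\<And>u v. 0 \<le> u \<Longrightarrow> u \<le> v \<Longrightarrow> f u \<le> f v" and v0: "v0 > 0"
  obtains m where "m \<ge> 0" "\<And>v. v \<ge> 0 \<Longrightarrow> f v0 + m * v \<le> f v + m * v0"
proof -
  define m where "m = Inf ((\<lambda>t. (f v0 - f t) / (v0 - t)) ` ({v0<..} \<inter> {0..}))"
  have int: "v0 \<in> interior {0..}" using v0 by simp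
  have "m \<ge> 0"
    unfolding m_def
  proof (rule cINF_greatest)
    show "{v0<..} \<inter> {0..} \<noteq> {}"
    proof -
      have "v0 + 1 \<in> {v0<..} \<inter> {0..}" using v0 by simp
      then show ?thesis by blast
    qed
    show "0 \<le> (f v0 - f t) / (v0 - t)" if "t \<in> {v0<..} \<inter> {0..}" for t
      using that v0 mono[of v0 t] by (auto intro!: divide_nonpos_neg)
  qed
  moreover have "f v0 + m * v \<le> f v + m * v0" if "v \<ge> 0" for v
    using convex_le_Inf_differential[OF cvx int, of v] that by (simp add: m_def algebra_simps)
  ultimately show thesis by (rule that)
qed

text \<open>Serves the dyadic level sets in \<open>nonlinear_gronwall_finite\<close>, where a good
  bound is available only for upper limits inside the set. If there is no largest such limit, a
  cofinal sequence in \<open>S\<close> and monotone convergence give the whole integral.\<close>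

lemma nn_integral_real_exhaust:
  fixes b :: "real \<Rightarrow> ennreal" and S :: "real set"
  assumes [measurable]: "b \<in> borel_measurable borel" "S \<in> sets borel"
    and bound: "\<And>T. T \<in> S \<Longrightarrow> (\<integral>\<^sup>+x\<in>S \<inter> {..T}. b x \<partial>lborel) \<le> M"
  shows "(\<integral>\<^sup>+x\<in>S. b x \<partial>lborel) \<le> M"
proof (cases "\<exists>T\<in>S. \<forall>x\<in>S. x \<le> T")
  case True
  then obtain T where "T \<in> S" "S \<inter> {..T} = S" by auto
  then show ?thesis using bound by metis
next
  case False
  then have up: "\<exists>y\<in>S. x < y" if "x \<in> S" for x using that by force
  show ?thesis
  proof (cases "S = {}")
    case False
    have "\<exists>U :: nat \<Rightarrow> real. (\<forall>n. U n \<in> S) \<and> (\<forall>x\<in>S. \<exists>n. x \<le> U n)"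
    proof (cases "bdd_above S")
      case True
      have "\<exists>y\<in>S. Sup S - 1 / real (Suc n) < y" for n
        using less_cSup_iff[OF \<open>S \<noteq> {}\<close> True, of "Sup S - 1 / real (Suc n)"] by auto
      then obtain U where U: "\<And>n. U n \<in> S" "\<And>n. Sup S - 1 / real (Suc n) < U n" by metis
      have "\<exists>n. x \<le> U n" if x: "x \<in> S" for x
      proof -
        obtain y where "y \<in> S" "x < y" using up[OF x] by blast
        then have "x < Sup S" using cSup_upper[OF _ True, of y] by simp
        then obtain n where "inverse (real (Suc n)) < Sup S - x"
          using reals_Archimedean[of "Sup S - x"] by auto
        then show ?thesis using U(2)[of n] by (intro exI[of _ n]) (simp add: inverse_eq_divide)
      qed
      then show ?thesis using U by blast
    next
      case False
      then have "\<exists>y\<in>S. real n < y" for n by (force simp: bdd_above_def not_le)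
      then obtain U where U: "\<And>n. U n \<in> S" "\<And>n. real n < U n" by metis
      then have "\<exists>n. x \<le> U n" for x
        using real_arch_simple[of x] by (meson less_imp_le order_trans)
      then show ?thesis using U by blast
    qed
    then obtain U :: "nat \<Rightarrow> real" where U: "\<And>n. U n \<in> S" "\<And>x. x \<in> S \<Longrightarrow> \<exists>n. x \<le> U n" by blast
    \<comment> \<open>Running maxima turn the cofinal sequence into an increasing one without
      leaving \<open>S\<close>.\<close>
    define V where "V n = Max (U ` {..n})" for n
    have V: "V n \<in> S" "U n \<le> V n" for n
    proof -
      have "V n \<in> U ` {..n}" unfolding V_def by (rule Max_in) auto
      then show "V n \<in> S" using U(1) by auto
      show "U n \<le> V n" unfolding V_def by (rule Max_ge) auto
    qed
    have Vmono: "V m \<le> V n" if "m \<le> n" for m n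
      unfolding V_def using that by (intro Max_mono) auto
    define F where "F n x = b x * indicator (S \<inter> {..V n}) x" for n x
    have "incseq F"
      unfolding incseq_def le_fun_def F_def
    proof (intro allI impI mult_left_mono)
      fix m n :: nat and x assume "m \<le> n"
      show "(indicator (S \<inter> {..V m}) x :: ennreal) \<le> indicator (S \<inter> {..V n}) x"
        using Vmono[OF \<open>m \<le> n\<close>] by (auto simp: indicator_def)
    qed simp
    have "(\<integral>\<^sup>+x\<in>S. b x \<partial>lborel) \<le> (\<integral>\<^sup>+x. (SUP n. F n x) \<partial>lborel)"
    proof (rule nn_integral_mono)
      fix x
      show "b x * indicator S x \<le> (SUP n. F n x)"
      proof (cases "x \<in> S")
        case True
        then obtain n where "x \<le> V n" using U(2) V(2) order_trans by meson
        then have "b x * indicator S x = F n x" using True by (simp add: F_def)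
        then show ?thesis by (auto intro: SUP_upper)
      qed simp
    qed
    also have "\<dots> = (SUP n. \<integral>\<^sup>+x. F n x \<partial>lborel)"
      by (rule nn_integral_monotone_convergence_SUP[OF \<open>incseq F\<close>]) (unfold F_def[abs_def], measurable)
    also have "\<dots> \<le> M"
      unfolding F_def by (intro SUP_least bound V(1))
    finally show ?thesis .
  qed simp
qed

text \<open>
  A substitute for separating variables in \<open>W' \<ge> c b F(W)\<close>: on the set where \<open>2\<^sup>i \<le> W < 2\<^sup>i\<^sup>+\<^sup>1\<close> the
  integral of \<open>b\<close> is at most \<open>2\<^sup>i\<^sup>+\<^sup>1 / (c F(2\<^sup>i))\<close>, and these bounds sum to a multiple of \<open>\<integral> 1/F\<close>.
\<close>

lemma nonlinear_gronwall_finite: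
  fixes b :: "real \<Rightarrow> ennreal" and W F :: "real \<Rightarrow> real"
  assumes [measurable]: "b \<in> borel_measurable borel"
    and W: "mono W" "\<And>T. W T \<ge> 1"
    and F: "mono_on {1..} F" "\<And>v. v \<ge> 1 \<Longrightarrow> F v \<ge> 1"
    and c: "c > 0"
    and ineq: "\<And>T. T \<ge> 1 \<Longrightarrow> ennreal c * (\<integral>\<^sup>+\<tau>\<in>{1..T}. b \<tau> * ennreal (F (W \<tau>)) \<partial>lborel) \<le> ennreal (W T)"
    and fin: "(\<integral>\<^sup>+v\<in>{1..}. ennreal (1 / F v) \<partial>lborel) < \<infinity>"
  shows "(\<integral>\<^sup>+\<tau>\<in>{1..}. b \<tau> \<partial>lborel) < \<infinity>"
proof -
  have [measurable]: "W \<in> borel_measurable borel" by (rule borel_measurable_mono) fact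
  define E where "E i = {1..} \<inter> W -` {2 ^ i..<2 ^ Suc i}" for i :: nat
  have [measurable]: "E i \<in> sets borel" for i
    unfolding E_def by (intro sets.Int measurable_sets_borel[OF \<open>W \<in> borel_measurable borel\<close>]) auto
  have one_le: "(1::real) \<le> 2 ^ i" for i :: nat by simp
  have Fpos: "F (2 ^ i) > 0" for i :: nat using F(2)[OF one_le, of i] by linarith
  have E_bound: "(\<integral>\<^sup>+\<tau>\<in>E i. b \<tau> \<partial>lborel) \<le> ennreal (2 ^ Suc i / (c * F (2 ^ i)))" for i
  proof (rule nn_integral_real_exhaust)
    fix T assume T: "T \<in> E i"
    have "ennreal (c * F (2 ^ i)) * (\<integral>\<^sup>+\<tau>\<in>E i \<inter> {..T}. b \<tau> \<partial>lborel) =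
        ennreal c * (\<integral>\<^sup>+\<tau>. ennreal (F (2 ^ i)) * (b \<tau> * indicator (E i \<inter> {..T}) \<tau>) \<partial>lborel)"
      using c Fpos[of i] by (subst nn_integral_cmult) (auto simp: ennreal_mult mult.assoc less_imp_le)
    also have "\<dots> \<le> ennreal c * (\<integral>\<^sup>+\<tau>\<in>{1..T}. b \<tau> * ennreal (F (W \<tau>)) \<partial>lborel)"
    proof (intro mult_left_mono nn_integral_mono)
      fix \<tau>
      show "ennreal (F (2 ^ i)) * (b \<tau> * indicator (E i \<inter> {..T}) \<tau>) \<le>
          b \<tau> * ennreal (F (W \<tau>)) * indicator {1..T} \<tau>"
      proof (cases "\<tau> \<in> E i \<inter> {..T}")
        case True
        then have "F (2 ^ i) \<le> F (W \<tau>)"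
          using one_le[of i] by (intro mono_onD[OF F(1)]) (auto simp: E_def W(2))
        then show ?thesis
          using True by (auto simp: E_def mult.commute intro!: mult_left_mono ennreal_leI)
      qed simp
    qed simp
    also have "\<dots> \<le> ennreal (W T)" using T by (intro ineq) (simp add: E_def)
    also have "\<dots> \<le> ennreal (2 ^ Suc i)" using T by (intro ennreal_leI) (simp add: E_def)
    finally have "ennreal (1 / (c * F (2 ^ i))) * (ennreal (c * F (2 ^ i)) * (\<integral>\<^sup>+\<tau>\<in>E i \<inter> {..T}. b \<tau> \<partial>lborel)) \<le>
        ennreal (1 / (c * F (2 ^ i))) * ennreal (2 ^ Suc i)"
      by (rule mult_left_mono) simp
    moreover have "ennreal (1 / (c * F (2 ^ i))) * ennreal (c * F (2 ^ i)) = 1"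
      using c Fpos[of i] by (subst ennreal_mult[symmetric]) auto
    moreover have "ennreal (1 / (c * F (2 ^ i))) * ennreal (2 ^ Suc i) = ennreal (2 ^ Suc i / (c * F (2 ^ i)))"
      using c Fpos[of i] by (subst ennreal_mult[symmetric]) auto
    ultimately show "(\<integral>\<^sup>+\<tau>\<in>E i \<inter> {..T}. b \<tau> \<partial>lborel) \<le> ennreal (2 ^ Suc i / (c * F (2 ^ i)))"
      by (simp add: mult.assoc[symmetric] del: power_Suc)
  qed auto
  define a where "a i = (2 ^ Suc i / (c * F (2 ^ i)))" for i
  define G where "G i = {2 ^ i..<2 ^ Suc i :: real}" for i :: nat
  \<comment> \<open>On \<open>G i\<close>, an interval of length 2^i, the least value of
    \<open>1 / F\<close> is bounded below by its value at the right end; this controls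
    \<open>a (Suc i)\<close>. The term \<open>a 0\<close> has no interval to its left within the
    half-line and is added at the end.\<close>
  have dyadic: "ennreal (a (Suc i)) \<le> ennreal (4 / c) * (\<integral>\<^sup>+v\<in>G i. ennreal (1 / F v) \<partial>lborel)" for i
  proof -
    have "ennreal (a (Suc i)) = ennreal (4 / c) * (ennreal (1 / F (2 ^ Suc i)) * emeasure lborel (G i))"
      using c Fpos[of "Suc i"]
      by (simp add: a_def G_def ennreal_mult[symmetric] del: times_divide_eq_right) (simp add: field_simps)
    also have "ennreal (1 / F (2 ^ Suc i)) * emeasure lborel (G i) = (\<integral>\<^sup>+v\<in>G i. ennreal (1 / F (2 ^ Suc i)) \<partial>lborel)"
      by (subst nn_integral_cmult_indicator) (auto simp: G_def)
    also have "\<dots> \<le> (\<integral>\<^sup>+v\<in>G i. ennreal (1 / F v) \<partial>lborel)"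
    proof (intro nn_integral_mono)
      fix v
      show "ennreal (1 / F (2 ^ Suc i)) * indicator (G i) v \<le> ennreal (1 / F v) * indicator (G i) v"
      proof (cases "v \<in> G i")
        case True
        then have v: "1 \<le> v" "v \<le> 2 ^ Suc i" using order_trans[OF one_le, of i v] by (auto simp: G_def)
        then have "F v \<le> F (2 ^ Suc i)" by (intro mono_onD[OF F(1)]) auto
        moreover have "F v > 0" using F(2)[OF v(1)] by simp
        ultimately show ?thesis using True by (auto intro!: ennreal_leI divide_left_mono)
      qed simp
    qed
    finally show ?thesis by (simp add: mult_left_mono)
  qed
  have G_ge: "v \<ge> 1" if "v \<in> G i" for v i
    using that order_trans[OF one_le, of i v] by (auto simp: G_def)
  \<comment> \<open>\<open>F\<close> is monotone only from 1 on; composing with \<open>max 1\<close>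
    gives a function monotone on the whole line, hence Borel.\<close>
  have Fm: "(\<lambda>v. ennreal (1 / F v) * indicator (G i) v) \<in> borel_measurable lborel" for i
  proof -
    have [measurable]: "(\<lambda>v. F (max 1 v)) \<in> borel_measurable borel"
      by (intro borel_measurable_mono monoI mono_onD[OF F(1)]) auto
    have "(\<lambda>v. ennreal (1 / F v) * indicator (G i) v) = (\<lambda>v. ennreal (1 / F (max 1 v)) * indicator (G i) v)"
      using G_ge by (auto simp: fun_eq_iff indicator_def max_def)
    then show ?thesis by (simp add: G_def)
  qed
  have G_disj: "(\<Sum>i. indicator (G i) v) \<le> (indicator {1..} v :: ennreal)" for v
  proof -
    have "disjoint_family G"
      unfolding disjoint_family_on_def
    proof (intro ballI impI)
      fix m n :: nat assume "m \<noteq> n"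
      then consider "Suc m \<le> n" | "Suc n \<le> m" by linarith
      then show "G m \<inter> G n = {}"
      proof cases
        case 1
        then have "(2::real) ^ Suc m \<le> 2 ^ n" by (intro power_increasing) auto
        then show ?thesis unfolding G_def by (auto simp del: power_Suc)
      next
        case 2
        then have "(2::real) ^ Suc n \<le> 2 ^ m" by (intro power_increasing) auto
        then show ?thesis unfolding G_def by (auto simp del: power_Suc)
      qed
    qed
    then have "(\<Sum>i. indicator (G i) v) = (indicator (\<Union>i. G i) v :: ennreal)"
      by (rule suminf_indicator)
    also have "\<dots> \<le> indicator {1..} v"
      using G_ge by (auto simp: indicator_def)
    finally show ?thesis .
  qed
  have "(\<Sum>i. ennreal (a (Suc i))) \<le> (\<Sum>i. ennreal (4 / c) * (\<integral>\<^sup>+v\<in>G i. ennreal (1 / F v) \<partial>lborel))"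
    by (intro suminf_le dyadic) auto
  also have "\<dots> = ennreal (4 / c) * (\<integral>\<^sup>+v. (\<Sum>i. ennreal (1 / F v) * indicator (G i) v) \<partial>lborel)"
    by (subst nn_integral_suminf[OF Fm]) simp
  also have "\<dots> \<le> ennreal (4 / c) * (\<integral>\<^sup>+v\<in>{1..}. ennreal (1 / F v) \<partial>lborel)"
    by (intro mult_left_mono nn_integral_mono) (auto intro!: mult_left_mono G_disj)
  also have "\<dots> < \<infinity>"
    using fin by (simp add: ennreal_mult_less_top)
  finally have tail: "(\<Sum>i. ennreal (a (Suc i))) < \<infinity>" .
  have "(\<integral>\<^sup>+\<tau>\<in>{1..}. b \<tau> \<partial>lborel) \<le> (\<integral>\<^sup>+\<tau>. (\<Sum>i. b \<tau> * indicator (E i) \<tau>) \<partial>lborel)"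
  proof (rule nn_integral_mono)
    fix \<tau>
    show "b \<tau> * indicator {1..} \<tau> \<le> (\<Sum>i. b \<tau> * indicator (E i) \<tau>)"
    proof (cases "\<tau> \<ge> 1")
      case True
      obtain i where "2 ^ i \<le> W \<tau>" "W \<tau> < 2 ^ Suc i"
      proof -
        define n where "n = (LEAST n. W \<tau> < 2 ^ n)"
        have "\<exists>n. W \<tau> < 2 ^ n" by (rule real_arch_pow) simp
        then have n: "W \<tau> < 2 ^ n" unfolding n_def by (rule LeastI_ex)
        then have "n \<noteq> 0" using W(2)[of \<tau>] by (intro notI) simp
        then obtain i where i: "n = Suc i" using not0_implies_Suc by blast
        have "\<not> W \<tau> < 2 ^ i" using not_less_Least[of i "\<lambda>n. W \<tau> < 2 ^ n"] i by (simp add: n_def)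
        then show thesis using n i by (intro that[of i]) auto
      qed
      then have "\<tau> \<in> E i" using True by (simp add: E_def)
      then have "b \<tau> * indicator {1..} \<tau> = sum (\<lambda>i. b \<tau> * indicator (E i) \<tau>) {i}" using True by simp
      also have "\<dots> \<le> (\<Sum>i. b \<tau> * indicator (E i) \<tau>)"
        by (intro sum_le_suminf) auto
      finally show ?thesis .
    qed simp
  qed
  also have "\<dots> = (\<Sum>i. \<integral>\<^sup>+\<tau>\<in>E i. b \<tau> \<partial>lborel)"
    by (rule nn_integral_suminf) measurable
  also have "\<dots> \<le> (\<Sum>i. ennreal (a i))"
    unfolding a_def by (intro suminf_le E_bound) auto
  also have "\<dots> = (\<Sum>i. ennreal (a (Suc i))) + ennreal (a 0)"
    using suminf_offset[of "\<lambda>i. ennreal (a i)" 1] by (simp add: add.commute)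
  also have "\<dots> < \<infinity>" using tail by simp
  finally show ?thesis .
qed

section \<open>Non-existence of global solutions\<close>

text \<open>Joint measurability in size and point makes the box mass of a solution a measurable
  function of time.\<close>

lemma parabolic_box_indicator_measurable [measurable (raw)]:
  assumes [measurable]: "g \<in> borel_measurable M" "h \<in> borel_measurable M"
  shows "(\<lambda>z. indicator (parabolic_box (g z)) (h z) :: ennreal) \<in> borel_measurable M"
proof -
  have "closed {z :: real \<times> heis. snd z \<in> parabolic_box (fst z)}"
  proof -
    have "{z :: real \<times> heis. snd z \<in> parabolic_box (fst z)} =
        {z. \<bar>Re (fst (snd z))\<bar> \<le> sqrt (fst z)} \<inter> {z. \<bar>Im (fst (snd z))\<bar> \<le> sqrt (fst z)} \<inter>
        {z. \<bar>snd (snd z)\<bar> \<le> fst z}"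
      by (auto simp: mem_parabolic_box)
    then show ?thesis
      by (simp only:) (intro closed_Int closed_Collect_le continuous_intros)
  qed
  then have "(\<lambda>z. indicator {z :: real \<times> heis. snd z \<in> parabolic_box (fst z)} z :: ennreal) \<in> borel_measurable borel"
    by (intro borel_measurable_indicator borel_closed)
  from measurable_compose[OF borel_measurable_Pair[OF assms] this]
  show ?thesis by (simp add: indicator_def)
qed

section \<open>Joint measurability of the semigroup in time and space\<close>

context heis_heat
begin

text \<open>The definition of the kernel constrains only positive times, hence the truncation to 0
  elsewhere.\<close>

lemma p_joint_measurable:
  assumes [measurable]: "g \<in> borel_measurable M" "h \<in> borel_measurable M"
  shows "(\<lambda>z. ennreal (if g z > 0 then p (g z) (h z) else 0)) \<in> borel_measurable M"
proof -
  have "heat_domain \<in> sets (borel :: (real \<times> heis) measure)"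
    by (intro borel_open open_Times) auto
  from borel_measurable_continuous_on_indicator[OF this p_continuous]
  have "(\<lambda>z. indicator heat_domain z *\<^sub>R (case z of (t, x) \<Rightarrow> p t x)) \<in> borel_measurable borel" .
  from measurable_compose[OF borel_measurable_Pair[OF assms] this]
  have "(\<lambda>z. indicator heat_domain (g z, h z) *\<^sub>R p (g z) (h z)) \<in> borel_measurable M" by simp
  also have "(\<lambda>z. indicator heat_domain (g z, h z) *\<^sub>R p (g z) (h z)) = (\<lambda>z. if g z > 0 then p (g z) (h z) else 0)"
    by (auto simp: fun_eq_iff)
  finally show ?thesis by measurable
qed

lemma heat_semigroup_joint_measurable:
  assumes [measurable]: "g \<in> borel_measurable M" "h \<in> borel_measurable M"
    and [measurable]: "(\<lambda>(z, y). W z y) \<in> borel_measurable (M \<Otimes>\<^sub>M borel)"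
  shows "(\<lambda>z. heat_semigroup p (g z) (W z) (h z) * indicator {0<..} (g z)) \<in> borel_measurable M"
proof -
  have [measurable]: "(\<lambda>(z, y). ennreal (if g z > 0 then p (g z) (hinv y \<odot> h z) else 0)) \<in> borel_measurable (M \<Otimes>\<^sub>M lborel)"
    unfolding split_beta' by (rule p_joint_measurable) measurable
  have "(\<lambda>z. \<integral>\<^sup>+y. ennreal (if g z > 0 then p (g z) (hinv y \<odot> h z) else 0) * W z y \<partial>lborel) \<in> borel_measurable M"
    by measurable
  also have "(\<lambda>z. \<integral>\<^sup>+y. ennreal (if g z > 0 then p (g z) (hinv y \<odot> h z) else 0) * W z y \<partial>lborel) =
      (\<lambda>z. heat_semigroup p (g z) (W z) (h z) * indicator {0<..} (g z))"
    by (auto simp: fun_eq_iff heat_semigroup_def indicator_def)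
  finally show ?thesis .
qed

text \<open>The three coordinate maps are arbitrary so that the lemma covers dependence on
  \<open>\<tau>\<close> alone as well as on time and space in either order, as Fubini
  demands.\<close>

lemma duhamel_kernel_measurable:
  assumes [measurable]: "g \<in> borel_measurable M" "h \<in> borel_measurable M" "k \<in> borel_measurable M"
    and G[measurable]: "G \<in> borel_measurable (borel :: (real \<times> heis) measure)"
  shows "(\<lambda>z. heat_semigroup p (g z - h z) (\<lambda>y. G (h z, y)) (k z) * indicator {0<..<g z} (h z)) \<in> borel_measurable M"
proof -
  have [measurable]: "(\<lambda>(z, y). G (h z, y)) \<in> borel_measurable (M \<Otimes>\<^sub>M borel)"
    unfolding split_beta' by (rule measurable_compose[OF _ G]) measurable
  have [measurable]: "(\<lambda>z. heat_semigroup p (g z - h z) (\<lambda>y. G (h z, y)) (k z) * indicator {0<..} (g z - h z))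
      \<in> borel_measurable M"
    by (rule heat_semigroup_joint_measurable) measurable
  have "(\<lambda>z. heat_semigroup p (g z - h z) (\<lambda>y. G (h z, y)) (k z) * indicator {0<..} (g z - h z) * indicator {0<..} (h z))
      \<in> borel_measurable M"
    by measurable
  also have "(\<lambda>z. heat_semigroup p (g z - h z) (\<lambda>y. G (h z, y)) (k z) * indicator {0<..} (g z - h z) * indicator {0<..} (h z)) =
      (\<lambda>z. heat_semigroup p (g z - h z) (\<lambda>y. G (h z, y)) (k z) * indicator {0<..<g z} (h z))"
    by (auto simp: fun_eq_iff indicator_def)
  finally show ?thesis .
qed

end

lemma pos_C0_L1_measurable: "w \<in> pos_C0_L1 \<Longrightarrow> w \<in> borel_measurable borel"
  by (simp add: pos_C0_L1_def borel_measurable_continuous_onI)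

lemma pos_C0_L1_box:
  assumes "w \<in> pos_C0_L1"
  obtains m where "m > 0" "ennreal m \<le> (\<integral>\<^sup>+y\<in>parabolic_box 1. ennreal (w y) \<partial>lborel)"
proof -
  have w: "continuous_on (parabolic_box 1) w" "\<And>x. w x > 0"
    using assms by (auto simp: pos_C0_L1_def intro: continuous_on_subset)
  have "compact (parabolic_box 1)"
    unfolding parabolic_box_def by (rule compact_cbox)
  moreover have "(0, 0) \<in> parabolic_box 1"
    by (simp add: mem_parabolic_box)
  ultimately obtain x0 where x0: "\<And>x. x \<in> parabolic_box 1 \<Longrightarrow> w x0 \<le> w x"
    using continuous_attains_inf[OF _ _ w(1)] by (metis empty_iff)
  have "ennreal (w x0 * 8) = ennreal (w x0) * emeasure lborel (parabolic_box 1)"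
    using w(2)[of x0] by (simp add: emeasure_parabolic_box ennreal_mult'')
  also have "\<dots> = (\<integral>\<^sup>+y\<in>parabolic_box 1. ennreal (w x0) \<partial>lborel)"
    by (subst nn_integral_cmult_indicator) auto
  also have "\<dots> \<le> (\<integral>\<^sup>+y\<in>parabolic_box 1. ennreal (w y) \<partial>lborel)"
    by (intro nn_integral_mono) (auto simp: indicator_def intro!: ennreal_leI x0)
  finally show thesis using w(2)[of x0] by (intro that[of "w x0 * 8"]) auto
qed

locale heis_cauchy = heis_heat p for p +
  fixes f \<phi> :: "real \<Rightarrow> real"
  assumes f_cont: "continuous_on {0..} f" and f_convex: "convex_on {0..} f"
    and f_zero: "f 0 = 0" and f_pos: "\<And>v. v > 0 \<Longrightarrow> f v > 0"
    and f_lower: "(\<integral>\<^sup>+v\<in>{1..}. 1 / lower_ratio f v \<partial>lborel) < \<infinity>"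
    and f_upper: "((\<lambda>v. upper_ratio f v / ennreal v) \<longlongrightarrow> 0) (at_right 0)"
    and \<phi>_cont: "continuous_on {0..} \<phi>" and \<phi>_nonneg: "\<And>t. t \<ge> 0 \<Longrightarrow> \<phi> t \<ge> 0"
begin

section \<open>The nonlinearity and its lower ratio\<close>

lemma f_nonneg: "v \<ge> 0 \<Longrightarrow> f v \<ge> 0"
  using f_pos[of v] f_zero by (cases "v = 0") auto

lemma f_ratio_mono: "0 \<le> u \<Longrightarrow> u \<le> v \<Longrightarrow> v > 0 \<Longrightarrow> f u \<le> u * (f v / v)"
  using convex_ratio_mono[OF f_convex f_zero, of u v] by simp

lemma f_mono:
  assumes "0 \<le> u" "u \<le> v"
  shows "f u \<le> f v"
proof (cases "v = 0")
  case False
  then have "f u \<le> u / v * f v" using assms by (intro convex_ratio_mono[OF f_convex f_zero]) auto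
  also have "\<dots> \<le> 1 * f v" using assms False by (intro mult_right_mono f_nonneg) auto
  finally show ?thesis by simp
qed (use assms in auto)

text \<open>Continuity of \<open>f\<close> is assumed on the half-line only; precomposing with
  \<open>max 0\<close> gives a continuous function on all reals. The same device for
  \<open>\<phi>\<close> explains the many occurrences of \<open>max 0\<close> below.\<close>

lemma f_measurable [measurable (raw)]:
  assumes [measurable]: "g \<in> borel_measurable M"
  shows "(\<lambda>x. f (max 0 (g x))) \<in> borel_measurable M"
proof -
  have "continuous_on UNIV (\<lambda>v. f (max 0 v))"
    by (rule continuous_on_compose2[OF f_cont]) (auto intro!: continuous_intros)
  then have "(\<lambda>v. f (max 0 v)) \<in> borel_measurable borel" by (rule borel_measurable_continuous_onI)
  from measurable_compose[OF assms this] show ?thesis .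
qed

lemma \<phi>_measurable [measurable (raw)]:
  assumes [measurable]: "g \<in> borel_measurable M"
  shows "(\<lambda>x. \<phi> (max 0 (g x))) \<in> borel_measurable M"
proof -
  have "continuous_on UNIV (\<lambda>v. \<phi> (max 0 v))"
    by (rule continuous_on_compose2[OF \<phi>_cont]) (auto intro!: continuous_intros)
  then have "(\<lambda>v. \<phi> (max 0 v)) \<in> borel_measurable borel" by (rule borel_measurable_continuous_onI)
  from measurable_compose[OF assms this] show ?thesis .
qed

text \<open>Real-valued form of the lower ratio, which is finite as an infimum of finite
  numbers.\<close>

definition fm :: "real \<Rightarrow> real" where
  "fm v = enn2real (lower_ratio f v)"

lemma lower_ratio_le: "0 < \<alpha> \<Longrightarrow> \<alpha> < 1 \<Longrightarrow> lower_ratio f v \<le> ennreal (f (\<alpha> * v) / f \<alpha>)"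
  unfolding lower_ratio_def by (intro INF_lower) auto

lemma lower_ratio_eq_fm: "lower_ratio f v = ennreal (fm v)"
  using lower_ratio_le[of "1 / 2" v] by (auto simp: fm_def ennreal_enn2real_if top_unique)

lemma fm_bound:
  assumes "0 < \<alpha>" "\<alpha> < 1" "v \<ge> 0"
  shows "f \<alpha> * fm v \<le> f (\<alpha> * v)"
proof -
  have "fm v \<le> f (\<alpha> * v) / f \<alpha>"
    using lower_ratio_le[OF assms(1,2), of v] f_nonneg[of "\<alpha> * v"] f_pos[OF assms(1)] assms
    by (simp add: lower_ratio_eq_fm)
  then show ?thesis
    using f_pos[OF assms(1)] by (simp add: pos_le_divide_eq mult.commute)
qed

lemma fm_ge_1:
  assumes "v \<ge> 1"
  shows "fm v \<ge> 1"
proof -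
  have "1 \<le> lower_ratio f v"
    unfolding lower_ratio_def
  proof (rule INF_greatest)
    fix \<alpha> :: real assume "\<alpha> \<in> {0<..<1}"
    then have "f \<alpha> \<le> f (\<alpha> * v)" "f \<alpha> > 0"
      using assms f_pos[of \<alpha>] by (auto intro!: f_mono)
    then show "1 \<le> ennreal (f (\<alpha> * v) / f \<alpha>)" by simp
  qed
  then show ?thesis
    by (simp add: lower_ratio_eq_fm)
qed

lemma fm_mono: "mono_on {1..} fm"
proof (rule mono_onI)
  fix u v :: real assume "u \<in> {1..}" "v \<in> {1..}" "u \<le> v"
  have "lower_ratio f u \<le> lower_ratio f v"
    unfolding lower_ratio_def
  proof (rule INF_mono)
    fix \<alpha> :: real assume \<alpha>: "\<alpha> \<in> {0<..<1}"
    then have "f (\<alpha> * u) / f \<alpha> \<le> f (\<alpha> * v) / f \<alpha>"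
      using f_pos[of \<alpha>] \<open>u \<in> {1..}\<close> \<open>u \<le> v\<close> by (intro divide_right_mono f_mono) auto
    then show "\<exists>\<beta>\<in>{0<..<1}. ennreal (f (\<beta> * u) / f \<beta>) \<le> ennreal (f (\<alpha> * v) / f \<alpha>)"
      using \<alpha> by (auto intro!: bexI[of _ \<alpha>] ennreal_leI)
  qed
  then show "fm u \<le> fm v"
    using fm_ge_1[of v] \<open>v \<in> {1..}\<close> by (simp add: lower_ratio_eq_fm)
qed

lemma fm_integral: "(\<integral>\<^sup>+v\<in>{1..}. ennreal (1 / fm v) \<partial>lborel) < \<infinity>"
proof -
  have "(\<integral>\<^sup>+v\<in>{1..}. ennreal (1 / fm v) \<partial>lborel) = (\<integral>\<^sup>+v\<in>{1..}. 1 / lower_ratio f v \<partial>lborel)"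
  proof (intro nn_integral_cong)
    fix v :: real
    show "ennreal (1 / fm v) * indicator {1..} v = 1 / lower_ratio f v * indicator {1..} v"
    proof (cases "v \<ge> 1")
      case True
      then show ?thesis
        using fm_ge_1[OF True] divide_ennreal[of 1 "fm v"] by (simp add: lower_ratio_eq_fm)
    qed simp
  qed
  then show ?thesis using f_lower by simp
qed

text \<open>Integrating the supporting line at the mean value
  \<open>m / (8 * \<tau>\<^sup>2)\<close> over the box puts the same finite term on both sides, and
  it cancels. The right-hand side is allowed to be infinite.\<close>

lemma jensen_box:
  fixes v :: "heis \<Rightarrow> real"
  assumes \<tau>: "\<tau> > 0" and v: "\<And>y. v y \<ge> 0" and [measurable]: "v \<in> borel_measurable borel"
    and m: "(\<integral>\<^sup>+y\<in>parabolic_box \<tau>. ennreal (v y) \<partial>lborel) = ennreal m" "m \<ge> 0"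
  shows "ennreal (8 * \<tau>\<^sup>2 * f (m / (8 * \<tau>\<^sup>2))) \<le> (\<integral>\<^sup>+y\<in>parabolic_box \<tau>. ennreal (f (v y)) \<partial>lborel)"
proof (cases "m = 0")
  case False
  define v0 where "v0 = m / (8 * \<tau>\<^sup>2)"
  have v0: "v0 > 0" "v0 * (8 * \<tau>\<^sup>2) = m" using False m(2) \<tau> by (auto simp: v0_def)
  obtain k where k: "k \<ge> 0" "\<And>v. v \<ge> 0 \<Longrightarrow> f v0 + k * v \<le> f v + k * v0"
    by (rule convex_supporting_line[OF f_convex f_mono v0(1)]) (assumption | rule that)+
  have [measurable]: "(\<lambda>y. f (v y)) \<in> borel_measurable borel"
    using f_measurable[of v borel] v by (simp add: max_def)
  have box: "(\<integral>\<^sup>+y\<in>parabolic_box \<tau>. ennreal a \<partial>lborel) = ennreal (a * (8 * \<tau>\<^sup>2))" if "a \<ge> 0" for a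
    using that \<tau> by (subst nn_integral_cmult_indicator) (auto simp: emeasure_parabolic_box ennreal_mult)
  have fv0: "f v0 \<ge> 0" using f_nonneg v0(1) by simp
  have km: "ennreal (k * m) = (\<integral>\<^sup>+y. ennreal k * (ennreal (v y) * indicator (parabolic_box \<tau>) y) \<partial>lborel)"
  proof -
    have "(\<integral>\<^sup>+y. ennreal k * (ennreal (v y) * indicator (parabolic_box \<tau>) y) \<partial>lborel) = ennreal k * ennreal m"
      unfolding m(1)[symmetric] by (rule nn_integral_cmult) measurable
    then show ?thesis using k(1) m(2) by (simp only: ennreal_mult)
  qed
  have "ennreal (k * m) + ennreal (8 * \<tau>\<^sup>2 * f v0) =
      (\<integral>\<^sup>+y. ennreal k * (ennreal (v y) * indicator (parabolic_box \<tau>) y) \<partial>lborel) +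
      (\<integral>\<^sup>+y\<in>parabolic_box \<tau>. ennreal (f v0) \<partial>lborel)"
    unfolding km box[OF fv0] by (simp only: mult_ac)
  also have "\<dots> = (\<integral>\<^sup>+y. (ennreal k * (ennreal (v y) * indicator (parabolic_box \<tau>) y) + ennreal (f v0) * indicator (parabolic_box \<tau>) y) \<partial>lborel)"
    by (rule nn_integral_add[symmetric]) measurable
  also have "\<dots> \<le> (\<integral>\<^sup>+y. (ennreal (k * v0) * indicator (parabolic_box \<tau>) y + ennreal (f (v y)) * indicator (parabolic_box \<tau>) y) \<partial>lborel)"
  proof (intro nn_integral_mono)
    fix y
    have "ennreal k * ennreal (v y) + ennreal (f v0) = ennreal (k * v y + f v0)"
      using k(1) v[of y] f_nonneg[of v0] v0(1) by (simp add: ennreal_mult)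
    also have "\<dots> \<le> ennreal (k * v0 + f (v y))"
      using k(2)[OF v[of y]] by (intro ennreal_leI) simp
    also have "\<dots> = ennreal (k * v0) + ennreal (f (v y))"
      using k(1) v0(1) f_nonneg[OF v[of y]] by simp
    finally show "ennreal k * (ennreal (v y) * indicator (parabolic_box \<tau>) y) + ennreal (f v0) * indicator (parabolic_box \<tau>) y
        \<le> ennreal (k * v0) * indicator (parabolic_box \<tau>) y + ennreal (f (v y)) * indicator (parabolic_box \<tau>) y"
      by (auto simp: indicator_def)
  qed
  also have "\<dots> = (\<integral>\<^sup>+y\<in>parabolic_box \<tau>. ennreal (k * v0) \<partial>lborel) +
      (\<integral>\<^sup>+y\<in>parabolic_box \<tau>. ennreal (f (v y)) \<partial>lborel)"
    by (rule nn_integral_add) measurable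
  also have "(\<integral>\<^sup>+y\<in>parabolic_box \<tau>. ennreal (k * v0) \<partial>lborel) = ennreal (k * m)"
    using k(1) v0 by (subst box) (simp_all add: mult.assoc)
  finally show ?thesis
    by (simp only: v0_def[symmetric] ennreal_add_left_cancel_le) simp
qed (simp add: f_zero)

end

lemma powi_minus_two: "(\<tau> :: real) powi (- 2) = 1 / \<tau>\<^sup>2"
  by (simp add: power_int_minus inverse_eq_divide)

lemma Linf_norm_le:
  assumes "h \<in> borel_measurable borel" "\<And>x. h x \<le> M"
  shows "Linf_norm h \<le> M"
  unfolding Linf_norm_def using assms by (intro esssup_I) auto

lemma box_integral_le_Linf:
  assumes "T \<ge> 0"
  shows "(\<integral>\<^sup>+x\<in>parabolic_box T. h x \<partial>lborel) \<le> Linf_norm h * ennreal (8 * T\<^sup>2)"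
proof -
  have "AE x in lborel. h x \<le> Linf_norm h"
    unfolding Linf_norm_def by (rule esssup_AE)
  then have "(\<integral>\<^sup>+x\<in>parabolic_box T. h x \<partial>lborel) \<le> (\<integral>\<^sup>+x\<in>parabolic_box T. Linf_norm h \<partial>lborel)"
    by (intro nn_integral_mono_AE) (auto elim!: eventually_mono intro: mult_right_mono)
  also have "\<dots> = Linf_norm h * ennreal (8 * T\<^sup>2)"
    using assms by (subst nn_integral_cmult_indicator) (auto simp: emeasure_parabolic_box)
  finally show ?thesis .
qed

section \<open>Growth of the box masses of a global solution\<close>

context heis_cauchy
begin

lemma weight_measurable [measurable]:
  "(\<lambda>\<tau>. ennreal (\<phi> (max 0 \<tau>) * \<tau>\<^sup>2 * f (max 0 (\<epsilon> * \<tau> powi (- 2))))) \<in> borel_measurable borel"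
  unfolding powi_minus_two by measurable

lemma weight_integral_max:
  assumes "\<epsilon> > 0"
  shows "(\<integral>\<^sup>+\<tau>\<in>{1..}. ennreal (\<phi> \<tau> * \<tau>\<^sup>2 * f (\<epsilon> * \<tau> powi (- 2))) \<partial>lborel) =
    (\<integral>\<^sup>+\<tau>\<in>{1..}. ennreal (\<phi> (max 0 \<tau>) * \<tau>\<^sup>2 * f (max 0 (\<epsilon> * \<tau> powi (- 2)))) \<partial>lborel)"
  using assms by (intro nn_integral_cong) (auto simp: indicator_def powi_minus_two max_def)

lemma no_global_solution:
  assumes div: "\<forall>\<epsilon>>0. (\<integral>\<^sup>+\<tau>\<in>{1..}. ennreal (\<phi> \<tau> * \<tau>\<^sup>2 * f (\<epsilon> * \<tau> powi (- 2))) \<partial>lborel) = \<infinity>"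
    and u0: "u\<^sub>0 \<in> pos_C0_L1" and sol: "global_solution p \<phi> f u\<^sub>0 u"
  shows False
proof -
  have u_pos: "\<And>t x. t > 0 \<Longrightarrow> u t x > 0"
    and duhamel: "\<And>t x. t > 0 \<Longrightarrow> ennreal (u t x) = heat_semigroup p t (\<lambda>y. ennreal (u\<^sub>0 y)) x +
        (\<integral>\<^sup>+\<tau>\<in>{0<..<t}. heat_semigroup p (t - \<tau>) (\<lambda>y. ennreal (\<phi> \<tau> * f (u \<tau> y))) x \<partial>lborel)"
    and Linf: "\<And>t. t > 0 \<Longrightarrow> Linf_norm (\<lambda>x. ennreal (u t x)) < \<infinity>"
    and u_meas: "(\<lambda>(t, x). u t x) \<in> borel_measurable (restrict_space borel heat_domain)"
    using sol unfolding global_solution_def by blast+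
  \<comment> \<open>Extension by 0 to nonpositive times turns measurability on the half-space into
    Borel measurability on all of space-time.\<close>
  define U where "U z = (if fst z > 0 then u (fst z) (snd z) else 0)" for z :: "real \<times> heis"
  have U_nonneg: "U z \<ge> 0" for z using u_pos by (simp add: U_def less_imp_le)
  have [measurable]: "U \<in> borel_measurable borel"
  proof -
    have "heat_domain \<inter> space (borel :: (real \<times> heis) measure) \<in> sets borel"
      by (auto intro!: borel_open open_Times)
    from u_meas[unfolded borel_measurable_restrict_space_iff[OF this]]
    have "(\<lambda>z. indicator heat_domain z *\<^sub>R (case z of (t, x) \<Rightarrow> u t x)) \<in> borel_measurable borel" .
    also have "(\<lambda>z. indicator heat_domain z *\<^sub>R (case z of (t, x) \<Rightarrow> u t x)) = U"
      by (auto simp: fun_eq_iff U_def indicator_def)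
    finally show ?thesis .
  qed
  have [measurable]: "(\<lambda>y. ennreal (u\<^sub>0 y)) \<in> borel_measurable borel"
    using pos_C0_L1_measurable[OF u0] by simp
  have [measurable]: "(fst :: real \<times> heis \<Rightarrow> real) \<in> borel_measurable borel"
    by (intro borel_measurable_continuous_onI continuous_intros)
  define G where "G z = ennreal (\<phi> (max 0 (fst z)) * f (max 0 (U z)))" for z
  have [measurable]: "G \<in> borel_measurable borel" unfolding G_def by measurable
  have G: "G (\<tau>, y) = ennreal (\<phi> \<tau> * f (u \<tau> y))" if "\<tau> > 0" for \<tau> y
    using that u_pos[OF that, of y] by (simp add: G_def U_def max_def)
  \<comment> \<open>Finite at each positive time because a global solution has finite sup norm
    there; this finiteness is what the argument contradicts.\<close>
  define \<Lambda> where "\<Lambda> T = (\<integral>\<^sup>+x\<in>parabolic_box T. ennreal (U (T, x)) \<partial>lborel)" for T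
  have [measurable]: "\<Lambda> \<in> borel_measurable borel" unfolding \<Lambda>_def by measurable
  have \<Lambda>_fin: "\<Lambda> T < \<infinity>" if "T > 0" for T
  proof -
    have "\<Lambda> T = (\<integral>\<^sup>+x\<in>parabolic_box T. ennreal (u T x) \<partial>lborel)"
      using that by (simp add: \<Lambda>_def U_def)
    also have "\<dots> \<le> Linf_norm (\<lambda>x. ennreal (u T x)) * ennreal (8 * T\<^sup>2)"
      using that by (intro box_integral_le_Linf) auto
    also have "\<dots> < \<infinity>" using Linf[OF that] by (simp add: ennreal_mult_less_top)
    finally show ?thesis .
  qed
  define l where "l T = enn2real (\<Lambda> T)" for T
  have [measurable]: "l \<in> borel_measurable borel" unfolding l_def by measurable
  have l: "ennreal (l T) = \<Lambda> T" if "T > 0" for T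
    using \<Lambda>_fin[OF that] by (simp add: l_def)
  have l_nonneg: "l T \<ge> 0" for T by (simp add: l_def)
  obtain c where c: "c > 0"
    "\<And>s T w. 0 < s \<Longrightarrow> s \<le> T \<Longrightarrow> w \<in> borel_measurable borel \<Longrightarrow>
       (\<integral>\<^sup>+x\<in>parabolic_box T. heat_semigroup p s w x \<partial>lborel) \<ge> ennreal c * (\<integral>\<^sup>+y\<in>parabolic_box T. w y \<partial>lborel)"
    using heat_semigroup_box_mass by blast
  obtain m where m: "m > 0" "ennreal m \<le> (\<integral>\<^sup>+y\<in>parabolic_box 1. ennreal (u\<^sub>0 y) \<partial>lborel)"
    using pos_C0_L1_box[OF u0] by blast
  define a where "a = c * m"
  have a: "a > 0" using c(1) m(1) by (simp add: a_def)
  define g where "g \<tau> = c * (\<phi> (max 0 \<tau>) * (8 * \<tau>\<^sup>2 * f (max 0 (l \<tau> / (8 * \<tau>\<^sup>2)))))" for \<tau>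
  have [measurable]: "g \<in> borel_measurable borel" unfolding g_def by measurable
  have mass: "ennreal a + (\<integral>\<^sup>+\<tau>\<in>{1..T}. ennreal (g \<tau>) \<partial>lborel) \<le> \<Lambda> T" if T: "T \<ge> 1" for T
  proof -
    define K where "K \<tau> x = heat_semigroup p (T - \<tau>) (\<lambda>y. G (\<tau>, y)) x * indicator {0<..<T} \<tau>" for \<tau> x
    have [measurable]: "(\<lambda>(\<tau>, x). K \<tau> x) \<in> borel_measurable (lborel \<Otimes>\<^sub>M lborel)"
      unfolding K_def split_beta' by (rule duhamel_kernel_measurable) measurable
    have [measurable]: "(\<lambda>(x, \<tau>). K \<tau> x) \<in> borel_measurable (lborel \<Otimes>\<^sub>M lborel)"
      unfolding K_def split_beta' by (rule duhamel_kernel_measurable) measurable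
    have [measurable]: "heat_semigroup p T (\<lambda>y. ennreal (u\<^sub>0 y)) \<in> borel_measurable borel"
      using T by (intro heat_semigroup_measurable) auto
    have "ennreal (U (T, x)) = heat_semigroup p T (\<lambda>y. ennreal (u\<^sub>0 y)) x + (\<integral>\<^sup>+\<tau>. K \<tau> x \<partial>lborel)" for x
      using T unfolding K_def by (auto simp: U_def duhamel G indicator_def intro!: nn_integral_cong)
    then have "\<Lambda> T = (\<integral>\<^sup>+x. heat_semigroup p T (\<lambda>y. ennreal (u\<^sub>0 y)) x * indicator (parabolic_box T) x +
        (\<integral>\<^sup>+\<tau>. K \<tau> x * indicator (parabolic_box T) x \<partial>lborel) \<partial>lborel)"
      unfolding \<Lambda>_def by (simp add: distrib_right nn_integral_multc)
    also have "\<dots> = (\<integral>\<^sup>+x\<in>parabolic_box T. heat_semigroup p T (\<lambda>y. ennreal (u\<^sub>0 y)) x \<partial>lborel) +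
        (\<integral>\<^sup>+x. \<integral>\<^sup>+\<tau>. K \<tau> x * indicator (parabolic_box T) x \<partial>lborel \<partial>lborel)"
      by (rule nn_integral_add) measurable
    also have "(\<integral>\<^sup>+x. \<integral>\<^sup>+\<tau>. K \<tau> x * indicator (parabolic_box T) x \<partial>lborel \<partial>lborel) =
        (\<integral>\<^sup>+\<tau>. \<integral>\<^sup>+x. K \<tau> x * indicator (parabolic_box T) x \<partial>lborel \<partial>lborel)"
      by (rule lborel_pair.Fubini') measurable
    finally have \<Lambda>_eq: "\<Lambda> T = (\<integral>\<^sup>+x\<in>parabolic_box T. heat_semigroup p T (\<lambda>y. ennreal (u\<^sub>0 y)) x \<partial>lborel) +
        (\<integral>\<^sup>+\<tau>. \<integral>\<^sup>+x. K \<tau> x * indicator (parabolic_box T) x \<partial>lborel \<partial>lborel)" .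
    have "ennreal a = ennreal c * ennreal m" using c(1) m(1) by (simp add: a_def ennreal_mult)
    also have "\<dots> \<le> ennreal c * (\<integral>\<^sup>+y\<in>parabolic_box T. ennreal (u\<^sub>0 y) \<partial>lborel)"
    proof (rule mult_left_mono)
      have "(\<integral>\<^sup>+y\<in>parabolic_box 1. ennreal (u\<^sub>0 y) \<partial>lborel) \<le> (\<integral>\<^sup>+y\<in>parabolic_box T. ennreal (u\<^sub>0 y) \<partial>lborel)"
        using parabolic_box_mono[OF T] by (intro nn_integral_mono) (auto simp: indicator_def)
      with m(2) show "ennreal m \<le> (\<integral>\<^sup>+y\<in>parabolic_box T. ennreal (u\<^sub>0 y) \<partial>lborel)" by (rule order_trans)
    qed simp
    also have "\<dots> \<le> (\<integral>\<^sup>+x\<in>parabolic_box T. heat_semigroup p T (\<lambda>y. ennreal (u\<^sub>0 y)) x \<partial>lborel)"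
      using T by (intro c(2)) auto
    finally have 1: "ennreal a \<le> (\<integral>\<^sup>+x\<in>parabolic_box T. heat_semigroup p T (\<lambda>y. ennreal (u\<^sub>0 y)) x \<partial>lborel)" .
    \<comment> \<open>The Duhamel integrand lives on the open interval, so the endpoint
      \<open>T\<close>, a null set, is dropped before comparing pointwise.\<close>
    have "(\<integral>\<^sup>+\<tau>\<in>{1..T}. ennreal (g \<tau>) \<partial>lborel) = (\<integral>\<^sup>+\<tau>\<in>{1..<T}. ennreal (g \<tau>) \<partial>lborel)"
      using AE_lborel_singleton[of T]
      by (intro nn_integral_cong_AE) (auto elim!: eventually_mono simp: indicator_def)
    also have "\<dots> \<le> (\<integral>\<^sup>+\<tau>. \<integral>\<^sup>+x. K \<tau> x * indicator (parabolic_box T) x \<partial>lborel \<partial>lborel)"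
    proof (rule nn_integral_mono)
      fix \<tau> :: real
      show "ennreal (g \<tau>) * indicator {1..<T} \<tau> \<le> (\<integral>\<^sup>+x. K \<tau> x * indicator (parabolic_box T) x \<partial>lborel)"
      proof (cases "\<tau> \<in> {1..<T}")
        case True
        then have \<tau>: "1 \<le> \<tau>" "\<tau> < T" by auto
        have \<phi>0: "\<phi> \<tau> \<ge> 0" using \<tau> by (intro \<phi>_nonneg) simp
        have [measurable]: "(\<lambda>y. U (\<tau>, y)) \<in> borel_measurable borel" "(\<lambda>y. G (\<tau>, y)) \<in> borel_measurable borel"
          by measurable
        have [measurable]: "(\<lambda>y. f (U (\<tau>, y))) \<in> borel_measurable borel"
          using f_measurable[of "\<lambda>y. U (\<tau>, y)" borel] U_nonneg by (simp add: max_def)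
        have J: "ennreal (8 * \<tau>\<^sup>2 * f (l \<tau> / (8 * \<tau>\<^sup>2))) \<le> (\<integral>\<^sup>+y\<in>parabolic_box \<tau>. ennreal (f (U (\<tau>, y))) \<partial>lborel)"
          using \<tau> by (intro jensen_box) (auto simp: U_nonneg l l_nonneg \<Lambda>_def[symmetric])
        have "ennreal (g \<tau>) = ennreal c * (ennreal (\<phi> \<tau>) * ennreal (8 * \<tau>\<^sup>2 * f (l \<tau> / (8 * \<tau>\<^sup>2))))"
          using \<tau> c(1) \<phi>0 l_nonneg[of \<tau>] by (simp add: g_def ennreal_mult f_nonneg max_def)
        also have "\<dots> \<le> ennreal c * (ennreal (\<phi> \<tau>) * (\<integral>\<^sup>+y\<in>parabolic_box \<tau>. ennreal (f (U (\<tau>, y))) \<partial>lborel))"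
          by (intro mult_left_mono J) auto
        also have "\<dots> = ennreal c * (\<integral>\<^sup>+y\<in>parabolic_box \<tau>. G (\<tau>, y) \<partial>lborel)"
        proof -
          have "(\<integral>\<^sup>+y\<in>parabolic_box \<tau>. G (\<tau>, y) \<partial>lborel) =
              (\<integral>\<^sup>+y. ennreal (\<phi> \<tau>) * (ennreal (f (U (\<tau>, y))) * indicator (parabolic_box \<tau>) y) \<partial>lborel)"
            using \<tau> \<phi>0 by (intro nn_integral_cong) (auto simp: G_def U_nonneg max_def ennreal_mult f_nonneg mult.assoc)
          also have "\<dots> = ennreal (\<phi> \<tau>) * (\<integral>\<^sup>+y\<in>parabolic_box \<tau>. ennreal (f (U (\<tau>, y))) \<partial>lborel)"
            by (rule nn_integral_cmult) measurable
          finally show ?thesis by simp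
        qed
        \<comment> \<open>Jensen uses the box of time \<open>\<tau>\<close>, while the flow up to
          time \<open>T\<close> retains mass in the larger box; nonnegativity allows
          enlarging.\<close>
        also have "\<dots> \<le> ennreal c * (\<integral>\<^sup>+y\<in>parabolic_box T. G (\<tau>, y) \<partial>lborel)"
          using parabolic_box_mono[of \<tau> T] \<tau>
          by (intro mult_left_mono nn_integral_mono) (auto simp: indicator_def)
        also have "\<dots> \<le> (\<integral>\<^sup>+x\<in>parabolic_box T. heat_semigroup p (T - \<tau>) (\<lambda>y. G (\<tau>, y)) x \<partial>lborel)"
          using \<tau> by (intro c(2)) auto
        finally show ?thesis using \<tau> by (simp add: K_def)
      qed simp
    qed
    finally have 2: "(\<integral>\<^sup>+\<tau>\<in>{1..T}. ennreal (g \<tau>) \<partial>lborel) \<le>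
        (\<integral>\<^sup>+\<tau>. \<integral>\<^sup>+x. K \<tau> x * indicator (parabolic_box T) x \<partial>lborel \<partial>lborel)" .
    show ?thesis unfolding \<Lambda>_eq by (rule add_mono[OF 1 2])
  qed
  \<comment> \<open>The mass itself need not be monotone in time. \<open>V\<close> is a monotone
    minorant of it, constant equal to \<open>a\<close> before time 1, and the inequality persists
    for \<open>V\<close> because \<open>f\<close> is increasing.\<close>
  define V where "V T = enn2real (ennreal a + (\<integral>\<^sup>+\<tau>\<in>{1..T}. ennreal (g \<tau>) \<partial>lborel))" for T
  have V_fin: "ennreal a + (\<integral>\<^sup>+\<tau>\<in>{1..T}. ennreal (g \<tau>) \<partial>lborel) < \<infinity>" for T
  proof (cases "T \<ge> 1")
    case True
    then show ?thesis by (intro le_less_trans[OF mass[OF True] \<Lambda>_fin]) simp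
  qed simp
  have V: "ennreal (V T) = ennreal a + (\<integral>\<^sup>+\<tau>\<in>{1..T}. ennreal (g \<tau>) \<partial>lborel)" for T
    using V_fin[of T] unfolding V_def by (intro ennreal_enn2real) (simp only: infinity_ennreal_def)
  have V_mono: "mono V"
  proof (rule monoI)
    fix S T :: real assume "S \<le> T"
    then have "(\<integral>\<^sup>+\<tau>\<in>{1..S}. ennreal (g \<tau>) \<partial>lborel) \<le> (\<integral>\<^sup>+\<tau>\<in>{1..T}. ennreal (g \<tau>) \<partial>lborel)"
      by (intro nn_integral_mono) (auto simp: indicator_def)
    then have "ennreal (V S) \<le> ennreal (V T)" unfolding V by (intro add_left_mono)
    then show "V S \<le> V T" by (subst (asm) ennreal_le_iff) (simp_all add: V_def)
  qed
  have V_ge: "V T \<ge> a" for T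
  proof -
    have "ennreal a \<le> ennreal (V T)" unfolding V by simp
    then show ?thesis by (subst (asm) ennreal_le_iff) (simp_all add: V_def)
  qed
  have V_le: "V T \<le> l T" if "T \<ge> 1" for T
  proof -
    have "ennreal (V T) \<le> ennreal (l T)" unfolding V using mass[OF that] l[of T] that by simp
    then show ?thesis by (subst (asm) ennreal_le_iff) (simp_all add: l_nonneg)
  qed
  \<comment> \<open>Two demands: \<open>8 * \<epsilon> \<le> a\<close> makes the normalised mass
    \<open>W\<close> at least 1, and \<open>\<epsilon> < 1\<close> keeps the height
    \<open>\<epsilon> / \<tau>\<^sup>2\<close> below 1, where the lower ratio applies.\<close>
  define \<epsilon> where "\<epsilon> = min (a / 8) (1 / 2)"
  have \<epsilon>: "0 < \<epsilon>" "\<epsilon> < 1" "8 * \<epsilon> \<le> a" using a by (auto simp: \<epsilon>_def)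
  define W where "W T = V T / (8 * \<epsilon>)" for T
  \<comment> \<open>The mean \<open>V \<tau> / (8 * \<tau>\<^sup>2)\<close> equals
    \<open>\<epsilon> / \<tau>\<^sup>2 * W \<tau>\<close>, so \<open>f\<close> of it is at least
    \<open>f (\<epsilon> / \<tau>\<^sup>2) * fm (W \<tau>)\<close>. The factor
    \<open>c / \<epsilon>\<close> absorbs all constants, hence the 1 handed to the integral
    inequality.\<close>
  define b where "b \<tau> = ennreal (c / \<epsilon>) * ennreal (\<phi> (max 0 \<tau>) * \<tau>\<^sup>2 * f (max 0 (\<epsilon> * \<tau> powi (- 2))))" for \<tau>
  have "(\<integral>\<^sup>+\<tau>\<in>{1..}. b \<tau> \<partial>lborel) < \<infinity>"
  proof (rule nonlinear_gronwall_finite[of b W fm 1])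
    show "b \<in> borel_measurable borel" unfolding b_def by measurable
    show "mono W" using V_mono \<epsilon> by (auto simp: W_def mono_def intro!: divide_right_mono)
    show W1: "W T \<ge> 1" for T
      using V_ge[of T] \<epsilon> by (simp add: W_def)
    show "mono_on {1..} fm" "\<And>v. v \<ge> 1 \<Longrightarrow> fm v \<ge> 1"
      "(\<integral>\<^sup>+v\<in>{1..}. ennreal (1 / fm v) \<partial>lborel) < \<infinity>"
      by (rule fm_mono fm_ge_1 fm_integral; assumption?)+
    fix T :: real assume "T \<ge> 1"
    have "b \<tau> * ennreal (fm (W \<tau>)) \<le> ennreal (1 / (8 * \<epsilon>)) * ennreal (g \<tau>)" if \<tau>: "\<tau> \<ge> 1" for \<tau>
    proof -
      have \<phi>0: "\<phi> \<tau> \<ge> 0" using \<tau> by (intro \<phi>_nonneg) simp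
      have \<alpha>: "0 < \<epsilon> / \<tau>\<^sup>2" "\<epsilon> / \<tau>\<^sup>2 < 1"
        using \<epsilon> \<tau> less_le_trans[OF \<epsilon>(2) one_le_power[OF \<tau>, of 2]] by (auto simp: divide_less_eq)
      have "f (\<epsilon> / \<tau>\<^sup>2) * fm (W \<tau>) \<le> f (\<epsilon> / \<tau>\<^sup>2 * W \<tau>)"
        using W1[of \<tau>] by (intro fm_bound \<alpha>) simp
      also have "\<dots> \<le> f (l \<tau> / (8 * \<tau>\<^sup>2))"
      proof (rule f_mono)
        show "\<epsilon> / \<tau>\<^sup>2 * W \<tau> \<le> l \<tau> / (8 * \<tau>\<^sup>2)"
          using V_le[OF \<tau>] \<epsilon> \<tau> by (simp add: W_def field_simps)
        show "0 \<le> \<epsilon> / \<tau>\<^sup>2 * W \<tau>" using \<alpha> W1[of \<tau>] by (intro mult_nonneg_nonneg) auto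
      qed
      finally have "(c / \<epsilon> * (\<phi> \<tau> * \<tau>\<^sup>2)) * (f (\<epsilon> / \<tau>\<^sup>2) * fm (W \<tau>)) \<le> (c / \<epsilon> * (\<phi> \<tau> * \<tau>\<^sup>2)) * f (l \<tau> / (8 * \<tau>\<^sup>2))"
        using c(1) \<epsilon> \<phi>0 by (intro mult_left_mono) auto
      also have "\<dots> = 1 / (8 * \<epsilon>) * g \<tau>"
        using \<tau> l_nonneg[of \<tau>] \<epsilon> by (simp add: g_def max_def)
      finally have "ennreal ((c / \<epsilon> * (\<phi> \<tau> * \<tau>\<^sup>2)) * (f (\<epsilon> / \<tau>\<^sup>2) * fm (W \<tau>))) \<le> ennreal (1 / (8 * \<epsilon>) * g \<tau>)"
        by (rule ennreal_leI)
      moreover have "b \<tau> * ennreal (fm (W \<tau>)) = ennreal ((c / \<epsilon> * (\<phi> \<tau> * \<tau>\<^sup>2)) * (f (\<epsilon> / \<tau>\<^sup>2) * fm (W \<tau>)))"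
      proof -
        have "b \<tau> = ennreal (c / \<epsilon> * (\<phi> \<tau> * \<tau>\<^sup>2 * f (\<epsilon> / \<tau>\<^sup>2)))"
          using \<tau> \<alpha> c(1) \<epsilon> \<phi>0 by (simp add: b_def powi_minus_two max_def ennreal_mult' del: times_divide_eq_left)
        then have "b \<tau> * ennreal (fm (W \<tau>)) = ennreal (c / \<epsilon> * (\<phi> \<tau> * \<tau>\<^sup>2 * f (\<epsilon> / \<tau>\<^sup>2)) * fm (W \<tau>))"
          using c(1) \<epsilon> \<phi>0 \<alpha> f_nonneg[of "\<epsilon> / \<tau>\<^sup>2"] by (simp only: ) (subst ennreal_mult'; auto)
        then show ?thesis by (simp only: mult_ac)
      qed
      moreover have "ennreal (1 / (8 * \<epsilon>) * g \<tau>) = ennreal (1 / (8 * \<epsilon>)) * ennreal (g \<tau>)"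
        using \<epsilon> by (intro ennreal_mult') auto
      ultimately show ?thesis by simp
    qed
    then have "(\<integral>\<^sup>+\<tau>\<in>{1..T}. b \<tau> * ennreal (fm (W \<tau>)) \<partial>lborel) \<le>
        (\<integral>\<^sup>+\<tau>. ennreal (1 / (8 * \<epsilon>)) * (ennreal (g \<tau>) * indicator {1..T} \<tau>) \<partial>lborel)"
      by (intro nn_integral_mono) (auto simp: indicator_def)
    also have "\<dots> = ennreal (1 / (8 * \<epsilon>)) * (\<integral>\<^sup>+\<tau>\<in>{1..T}. ennreal (g \<tau>) \<partial>lborel)"
      by (rule nn_integral_cmult) measurable
    also have "\<dots> \<le> ennreal (1 / (8 * \<epsilon>)) * ennreal (V T)"
      unfolding V by (intro mult_left_mono) auto
    also have "\<dots> = ennreal (W T)"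
      using \<epsilon> by (simp add: W_def ennreal_mult'[symmetric])
    finally show "ennreal 1 * (\<integral>\<^sup>+\<tau>\<in>{1..T}. b \<tau> * ennreal (fm (W \<tau>)) \<partial>lborel) \<le> ennreal (W T)" by simp
  qed simp
  moreover have "(\<integral>\<^sup>+\<tau>\<in>{1..}. b \<tau> \<partial>lborel) = ennreal (c / \<epsilon>) * \<infinity>"
  proof -
    have "(\<integral>\<^sup>+\<tau>\<in>{1..}. b \<tau> \<partial>lborel) = ennreal (c / \<epsilon>) *
        (\<integral>\<^sup>+\<tau>\<in>{1..}. ennreal (\<phi> (max 0 \<tau>) * \<tau>\<^sup>2 * f (max 0 (\<epsilon> * \<tau> powi (- 2)))) \<partial>lborel)"
      unfolding b_def mult.assoc powi_minus_two by (rule nn_integral_cmult) measurable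
    also have "(\<integral>\<^sup>+\<tau>\<in>{1..}. ennreal (\<phi> (max 0 \<tau>) * \<tau>\<^sup>2 * f (max 0 (\<epsilon> * \<tau> powi (- 2)))) \<partial>lborel) = \<infinity>"
      using div \<epsilon>(1) weight_integral_max[OF \<epsilon>(1)] by metis
    finally show ?thesis .
  qed
  ultimately show False
    using c(1) \<epsilon>(1) by (simp add: ennreal_mult_eq_top_iff ennreal_mult_less_top)
qed

end

section \<open>Decay of linear evolutions\<close>

context heis_heat
begin

lemma heat_semigroup_mono:
  "(\<And>y. w y \<le> w' y) \<Longrightarrow> heat_semigroup p t w x \<le> heat_semigroup p t w' x"
  unfolding heat_semigroup_def by (intro nn_integral_mono mult_left_mono) auto

lemma heat_semigroup_cmult:
  assumes "t > 0" and [measurable]: "w \<in> borel_measurable borel"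
  shows "heat_semigroup p t (\<lambda>y. a * w y) x = a * heat_semigroup p t w x"
proof -
  note [measurable] = p_measurable[OF assms(1)]
  have "heat_semigroup p t (\<lambda>y. a * w y) x = (\<integral>\<^sup>+y. a * (ennreal (p t (hinv y \<odot> x)) * w y) \<partial>lborel)"
    unfolding heat_semigroup_def by (simp add: mult_ac)
  also have "\<dots> = a * heat_semigroup p t w x"
    unfolding heat_semigroup_def by (rule nn_integral_cmult) measurable
  finally show ?thesis .
qed

lemma heat_semigroup_const:
  assumes "t > 0"
  shows "heat_semigroup p t (\<lambda>y. M) x = M"
proof -
  note [measurable] = p_measurable[OF assms]
  have "heat_semigroup p t (\<lambda>y. M) x = (\<integral>\<^sup>+y. ennreal (p t (hinv y \<odot> x)) \<partial>lborel) * M"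
    unfolding heat_semigroup_def by (rule nn_integral_multc) measurable
  then show ?thesis
    by (simp add: nn_integral_hinv_hmul[of "\<lambda>y. ennreal (p t y)"] p_nn_integral[OF assms])
qed

lemma heat_semigroup_le_L1:
  assumes "t > 0" and [measurable]: "w \<in> borel_measurable borel"
  shows "heat_semigroup p t w x \<le> ennreal (4 * p 2 (0, 0) / t\<^sup>2) * (\<integral>\<^sup>+y. w y \<partial>lborel)"
proof -
  have "heat_semigroup p t w x \<le> (\<integral>\<^sup>+y. ennreal (4 * p 2 (0, 0) / t\<^sup>2) * w y \<partial>lborel)"
    unfolding heat_semigroup_def using p_upper_bound[OF assms(1)]
    by (intro nn_integral_mono mult_right_mono ennreal_leI) auto
  then show ?thesis by (simp add: nn_integral_cmult)
qed

lemma heat_semigroup_pos: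
  assumes "t > 0" and [measurable]: "w \<in> borel_measurable borel" and "\<And>y. w y > 0"
  shows "heat_semigroup p t w x > 0"
proof (rule ccontr)
  note [measurable] = p_measurable[OF assms(1)]
  assume "\<not> ?thesis"
  then have "(\<integral>\<^sup>+y. ennreal (p t (hinv y \<odot> x)) * w y \<partial>lborel) = 0"
    by (simp add: heat_semigroup_def not_gr_zero)
  then have "AE y in lborel. ennreal (p t (hinv y \<odot> x)) * w y = 0"
    by (subst (asm) nn_integral_0_iff_AE) measurable
  moreover have "ennreal (p t (hinv y \<odot> x)) * w y \<noteq> 0" for y
    using p_pos[OF assms(1), of "hinv y \<odot> x"] assms(3)[of y] by (simp add: ennreal_eq_0_iff not_le)
  ultimately have "AE y in (lborel :: heis measure). False" by simp
  then show False
    by (simp add: trivial_limit_def[symmetric] ae_filter_eq_bot_iff emeasure_lborel_UNIV)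
qed

text \<open>After Fubini, left translation by \<open>z\<close> reduces the inner integral to
  \<open>p_convolution_le\<close>. This direction is the one that bounds the Duhamel term from
  above.\<close>

lemma heat_semigroup_semigroup_le:
  assumes s: "s > 0" and t: "t > 0" and [measurable]: "w \<in> borel_measurable borel"
  shows "heat_semigroup p s (heat_semigroup p t w) x \<le> heat_semigroup p (s + t) w x"
proof -
  note [measurable] = p_measurable[OF s] p_measurable[OF t]
  have "heat_semigroup p s (heat_semigroup p t w) x =
      (\<integral>\<^sup>+y. \<integral>\<^sup>+z. ennreal (p s (hinv y \<odot> x)) * (ennreal (p t (hinv z \<odot> y)) * w z) \<partial>lborel \<partial>lborel)"
    unfolding heat_semigroup_def by (intro nn_integral_cong nn_integral_cmult[symmetric]) measurable
  also have "\<dots> = (\<integral>\<^sup>+z. \<integral>\<^sup>+y. ennreal (p s (hinv y \<odot> x)) * (ennreal (p t (hinv z \<odot> y)) * w z) \<partial>lborel \<partial>lborel)"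
    by (rule lborel_pair.Fubini') measurable
  also have "\<dots> \<le> (\<integral>\<^sup>+z. ennreal (p (s + t) (hinv z \<odot> x)) * w z \<partial>lborel)"
  proof (rule nn_integral_mono)
    fix z
    have "(\<integral>\<^sup>+y. ennreal (p s (hinv y \<odot> x)) * (ennreal (p t (hinv z \<odot> y)) * w z) \<partial>lborel) =
        (\<integral>\<^sup>+y. ennreal (p s (hinv y \<odot> x)) * ennreal (p t (hinv z \<odot> y)) \<partial>lborel) * w z"
      by (subst nn_integral_multc[symmetric]) (auto simp: mult.assoc)
    also have "(\<integral>\<^sup>+y. ennreal (p s (hinv y \<odot> x)) * ennreal (p t (hinv z \<odot> y)) \<partial>lborel) =
        (\<integral>\<^sup>+y. ennreal (p s (hinv (z \<odot> y) \<odot> x)) * ennreal (p t (hinv z \<odot> (z \<odot> y))) \<partial>lborel)"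
      by (rule nn_integral_hmul_left[symmetric]) measurable
    also have "\<dots> = (\<integral>\<^sup>+y. ennreal (p s (hinv y \<odot> (hinv z \<odot> x))) * ennreal (p t y) \<partial>lborel)"
      by (simp add: hinv_hmul hmul_assoc hmul_assoc[symmetric, of "hinv z" z] hmul_hinv_left hmul_0_left)
    also have "\<dots> * w z \<le> ennreal (p (s + t) (hinv z \<odot> x)) * w z"
      by (intro mult_right_mono p_convolution_le s t) auto
    finally show "(\<integral>\<^sup>+y. ennreal (p s (hinv y \<odot> x)) * (ennreal (p t (hinv z \<odot> y)) * w z) \<partial>lborel) \<le>
        ennreal (p (s + t) (hinv z \<odot> x)) * w z" .
  qed
  finally show ?thesis by (simp add: heat_semigroup_def)
qed

text \<open>A concrete admissible datum: \<open>p 1\<close> supplies integrability and positivity,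
  while the second function forces decay at infinity, which has not been established for the kernel,
  and the bound 1.\<close>

definition profile :: "heis \<Rightarrow> real" where
  "profile x = min (p 1 x) (1 / (1 + norm x))"

lemma profile_pos: "profile x > 0"
  using p_pos[of 1 x] by (auto simp: profile_def intro!: divide_pos_pos add_pos_nonneg)

lemma profile_le_1: "profile x \<le> 1"
  by (simp add: profile_def min_le_iff_disj divide_le_eq add_pos_nonneg)

lemma profile_continuous: "continuous_on UNIV profile"
proof -
  have "1 + norm x \<noteq> 0" for x :: heis
    using norm_ge_zero[of x] by linarith
  then show ?thesis
    unfolding profile_def[abs_def] by (intro continuous_intros continuous_on_p) auto
qed

lemma profile_integral: "(\<integral>\<^sup>+y. ennreal (profile y) \<partial>lborel) \<le> 1"
proof -
  have "(\<integral>\<^sup>+y. ennreal (profile y) \<partial>lborel) \<le> (\<integral>\<^sup>+y. ennreal (p 1 y) \<partial>lborel)"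
    by (intro nn_integral_mono ennreal_leI) (simp add: profile_def)
  then show ?thesis by (simp add: p_nn_integral)
qed

lemma profile_scaled_in:
  assumes "\<delta> > 0"
  shows "(\<lambda>x. \<delta> * profile x) \<in> pos_C0_L1"
proof -
  have "(profile \<longlongrightarrow> 0) at_infinity"
  proof (rule tendsto_sandwich)
    show "eventually (\<lambda>x. 0 \<le> profile x) at_infinity"
      by (simp add: profile_pos less_imp_le)
    show "eventually (\<lambda>x. profile x \<le> inverse (1 + norm x)) at_infinity"
      by (simp add: profile_def inverse_eq_divide)
    show "((\<lambda>x :: heis. inverse (1 + norm x)) \<longlongrightarrow> 0) at_infinity"
      by (intro tendsto_inverse_0_at_top filterlim_tendsto_add_at_top[OF tendsto_const] filterlim_norm_at_top)
  qed (rule tendsto_const)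
  moreover have "integrable lborel profile"
    using profile_pos borel_measurable_continuous_onI[OF profile_continuous]
    by (intro Bochner_Integration.integrable_bound[OF p_integrable[of 1]])
       (auto simp: profile_def less_imp_le)
  ultimately show ?thesis
    using assms profile_pos profile_continuous
    by (auto simp: pos_C0_L1_def intro!: continuous_intros tendsto_mult_right_zero)
qed

definition decay :: "real \<Rightarrow> real" where
  "decay t = min 1 (1 / t\<^sup>2)"

lemma decay_pos: "t > 0 \<Longrightarrow> 0 < decay t" and decay_le_1: "decay t \<le> 1"
  by (auto simp: decay_def)

lemma decay_ge_1: "t \<ge> 1 \<Longrightarrow> decay t = 1 / t\<^sup>2"
  using one_le_power[of t 2] by (auto simp: decay_def intro!: min_absorb2)

lemma decay_less_1: "0 < t \<Longrightarrow> t < 1 \<Longrightarrow> decay t = 1"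
  using power_le_one[of t 2] by (simp add: decay_def min_def divide_le_eq le_divide_eq)

text \<open>Before time 1 the bound comes from the sup norm of the profile, from time 1 on from its
  integral and \<open>p_upper_bound\<close>; \<open>decay\<close> joins the two regimes.\<close>

lemma profile_decay:
  obtains K where "K \<ge> 1"
    "\<And>\<delta> t x. \<delta> > 0 \<Longrightarrow> t > 0 \<Longrightarrow> heat_semigroup p t (\<lambda>y. ennreal (\<delta> * profile y)) x \<le> ennreal (\<delta> * K * decay t)"
proof -
  define K where "K = max 1 (4 * p 2 (0, 0))"
  have "heat_semigroup p t (\<lambda>y. ennreal (\<delta> * profile y)) x \<le> ennreal (\<delta> * K * decay t)"
    if \<delta>: "\<delta> > 0" and t: "t > 0" for \<delta> t x
  proof -
    have [measurable]: "profile \<in> borel_measurable borel"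
      by (intro borel_measurable_continuous_onI profile_continuous)
    define A where "A = heat_semigroup p t (\<lambda>y. ennreal (profile y)) x"
    have eq: "heat_semigroup p t (\<lambda>y. ennreal (\<delta> * profile y)) x = ennreal \<delta> * A"
      using heat_semigroup_cmult[OF t, of "\<lambda>y. ennreal (profile y)" "ennreal \<delta>" x] \<delta>
      by (simp add: A_def ennreal_mult')
    have "A \<le> heat_semigroup p t (\<lambda>y. 1) x"
      unfolding A_def by (intro heat_semigroup_mono) (simp add: profile_le_1)
    then have A1: "A \<le> 1" by (simp add: heat_semigroup_const[OF t])
    have "A \<le> ennreal (4 * p 2 (0, 0) / t\<^sup>2) * (\<integral>\<^sup>+y. ennreal (profile y) \<partial>lborel)"
      unfolding A_def by (rule heat_semigroup_le_L1[OF t]) measurable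
    also have "\<dots> \<le> ennreal (4 * p 2 (0, 0) / t\<^sup>2) * 1"
      by (intro mult_left_mono profile_integral) auto
    finally have A2: "A \<le> ennreal (4 * p 2 (0, 0) / t\<^sup>2)" by simp
    have "A \<le> ennreal (K * decay t)"
    proof (cases "t \<ge> 1")
      case True
      have "4 * p 2 (0, 0) / t\<^sup>2 \<le> K * decay t"
        unfolding decay_ge_1[OF True] by (simp add: K_def divide_right_mono)
      then show ?thesis using A2 by (meson ennreal_leI order_trans)
    next
      case False
      then have "1 \<le> K * decay t" using t by (simp add: decay_less_1 K_def)
      then have "1 \<le> ennreal (K * decay t)" by simp
      then show ?thesis using A1 by (rule order_trans[rotated])
    qed
    then have "ennreal \<delta> * A \<le> ennreal \<delta> * ennreal (K * decay t)"
      by (rule mult_left_mono) simp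
    then show ?thesis unfolding eq mult.assoc[of \<delta>] using \<delta> by (simp only: ennreal_mult' less_imp_le)
  qed
  then show thesis by (intro that[of K]) (auto simp: K_def)
qed

text \<open>\<open>heat_norm\<close> passes through \<open>enn2real\<close>, which would turn an
  infinite norm into 0; the finite pointwise bound excludes this.\<close>

lemma heat_norm_bounds:
  assumes w: "w \<in> pos_C0_L1" and t: "t > 0"
    and le: "\<And>x. heat_semigroup p t (\<lambda>y. ennreal (w y)) x \<le> ennreal b" and b: "b \<ge> 0"
  shows "0 \<le> heat_norm p w t" "heat_norm p w t \<le> b"
    "ennreal (heat_norm p w t) = Linf_norm (heat_semigroup p t (\<lambda>y. ennreal (w y)))"
proof -
  have [measurable]: "w \<in> borel_measurable borel" by (rule pos_C0_L1_measurable[OF w])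
  have L: "Linf_norm (heat_semigroup p t (\<lambda>y. ennreal (w y))) \<le> ennreal b"
    using t by (intro Linf_norm_le le heat_semigroup_measurable) auto
  then show eq: "ennreal (heat_norm p w t) = Linf_norm (heat_semigroup p t (\<lambda>y. ennreal (w y)))"
    unfolding heat_norm_def by (intro ennreal_enn2real) (auto intro: le_less_trans)
  show "0 \<le> heat_norm p w t" by (simp add: heat_norm_def)
  show "heat_norm p w t \<le> b" using L b unfolding eq[symmetric] by simp
qed

lemma pos_C0_L1_bounded:
  assumes "w \<in> pos_C0_L1"
  obtains M where "M > 0" "\<And>y. w y \<le> M"
proof -
  have w: "continuous_on UNIV w" "(w \<longlongrightarrow> 0) at_infinity"
    using assms by (auto simp: pos_C0_L1_def)
  have "eventually (\<lambda>x. w x < 1) at_infinity" using w(2) by (rule order_tendstoD) simp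
  then obtain r where r: "\<And>x. norm x \<ge> r \<Longrightarrow> w x < 1" unfolding eventually_at_infinity by blast
  have "compact (w ` cball 0 r)"
    by (intro compact_continuous_image compact_cball continuous_on_subset[OF w(1)]) auto
  then have "bounded (w ` cball 0 r)" by (rule compact_imp_bounded)
  then obtain B where "\<forall>v\<in>w ` cball 0 r. norm v \<le> B" unfolding bounded_iff by blast
  then have B: "\<bar>w x\<bar> \<le> B" if "x \<in> cball 0 r" for x using that by fastforce
  have "w y \<le> max 1 B" for y
  proof (cases "norm y \<le> r")
    case True
    then show ?thesis using B[of y] by simp
  next
    case False
    then show ?thesis using r[of y] by simp
  qed
  then show thesis by (intro that[of "max 1 B"]) auto
qed

text \<open>The sup norm dominates the average over the box of size \<open>t\<close>, which retains
  mass at least \<open>c * m\<close> in volume \<open>8 * t\<^sup>2\<close>.\<close>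

lemma heat_norm_pos_C0_L1:
  assumes w: "w \<in> pos_C0_L1"
  obtains \<epsilon> where "\<epsilon> > 0" "\<And>t. t \<ge> 1 \<Longrightarrow> \<epsilon> / t\<^sup>2 \<le> heat_norm p w t"
proof -
  have [measurable]: "(\<lambda>y. ennreal (w y)) \<in> borel_measurable borel"
    using pos_C0_L1_measurable[OF w] by simp
  obtain M where M: "M > 0" "\<And>y. w y \<le> M" using pos_C0_L1_bounded[OF w] by blast
  obtain m where m: "m > 0" "ennreal m \<le> (\<integral>\<^sup>+y\<in>parabolic_box 1. ennreal (w y) \<partial>lborel)"
    using pos_C0_L1_box[OF w] by blast
  obtain c where c: "c > 0"
    "\<And>s T w. 0 < s \<Longrightarrow> s \<le> T \<Longrightarrow> w \<in> borel_measurable borel \<Longrightarrow>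
       (\<integral>\<^sup>+x\<in>parabolic_box T. heat_semigroup p s w x \<partial>lborel) \<ge> ennreal c * (\<integral>\<^sup>+y\<in>parabolic_box T. w y \<partial>lborel)"
    using heat_semigroup_box_mass by blast
  have "c * m / 8 / t\<^sup>2 \<le> heat_norm p w t" if t: "t \<ge> 1" for t
  proof -
    have "heat_semigroup p t (\<lambda>y. ennreal (w y)) x \<le> ennreal M" for x
    proof -
      have "heat_semigroup p t (\<lambda>y. ennreal (w y)) x \<le> heat_semigroup p t (\<lambda>y. ennreal M) x"
        by (intro heat_semigroup_mono ennreal_leI M)
      then show ?thesis using t by (simp add: heat_semigroup_const)
    qed
    then have N: "0 \<le> heat_norm p w t"
      "ennreal (heat_norm p w t) = Linf_norm (heat_semigroup p t (\<lambda>y. ennreal (w y)))"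
      using heat_norm_bounds[OF w, of t M] t M(1) by auto
    have "ennreal (c * m) = ennreal c * ennreal m" using c(1) m(1) by (simp add: ennreal_mult)
    also have "\<dots> \<le> ennreal c * (\<integral>\<^sup>+y\<in>parabolic_box t. ennreal (w y) \<partial>lborel)"
    proof (rule mult_left_mono)
      have "(\<integral>\<^sup>+y\<in>parabolic_box 1. ennreal (w y) \<partial>lborel) \<le> (\<integral>\<^sup>+y\<in>parabolic_box t. ennreal (w y) \<partial>lborel)"
        using parabolic_box_mono[OF t] by (intro nn_integral_mono) (auto simp: indicator_def)
      with m(2) show "ennreal m \<le> (\<integral>\<^sup>+y\<in>parabolic_box t. ennreal (w y) \<partial>lborel)" by (rule order_trans)
    qed simp
    also have "\<dots> \<le> (\<integral>\<^sup>+x\<in>parabolic_box t. heat_semigroup p t (\<lambda>y. ennreal (w y)) x \<partial>lborel)"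
      using t by (intro c(2)) auto
    also have "\<dots> \<le> Linf_norm (heat_semigroup p t (\<lambda>y. ennreal (w y))) * ennreal (8 * t\<^sup>2)"
      using t by (intro box_integral_le_Linf) simp
    also have "\<dots> = ennreal (heat_norm p w t * (8 * t\<^sup>2))"
      using N by (simp add: ennreal_mult)
    finally have "c * m \<le> heat_norm p w t * (8 * t\<^sup>2)"
      using N(1) by (subst (asm) ennreal_le_iff) auto
    then show ?thesis using t by (simp add: field_simps)
  qed
  then show thesis using c(1) m(1) by (intro that[of "c * m / 8"]) auto
qed

end

section \<open>Equivalence of (a) and (b)\<close>

context heis_cauchy
begin

text \<open>Since the norm is at least \<open>\<epsilon> / \<tau>\<^sup>2\<close> from time 1 on,
  monotonicity of \<open>f v / v\<close> bounds the integrand below by the weight in (b) divided by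
  \<open>\<epsilon>\<close>.\<close>

lemma blowup_integral_diverges:
  assumes div: "\<forall>\<epsilon>>0. (\<integral>\<^sup>+\<tau>\<in>{1..}. ennreal (\<phi> \<tau> * \<tau>\<^sup>2 * f (\<epsilon> * \<tau> powi (- 2))) \<partial>lborel) = \<infinity>"
    and w: "w \<in> pos_C0_L1"
  shows "(\<integral>\<^sup>+\<tau>\<in>{0<..}. ennreal (\<phi> \<tau> * (f (heat_norm p w \<tau>) / heat_norm p w \<tau>)) \<partial>lborel) = \<infinity>"
proof -
  obtain \<epsilon> where \<epsilon>: "\<epsilon> > 0" "\<And>t. t \<ge> 1 \<Longrightarrow> \<epsilon> / t\<^sup>2 \<le> heat_norm p w t"
    using heat_norm_pos_C0_L1[OF w] by blast
  have "\<infinity> = ennreal (1 / \<epsilon>) *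
      (\<integral>\<^sup>+\<tau>\<in>{1..}. ennreal (\<phi> (max 0 \<tau>) * \<tau>\<^sup>2 * f (max 0 (\<epsilon> * \<tau> powi (- 2)))) \<partial>lborel)"
    using div \<epsilon>(1) weight_integral_max[OF \<epsilon>(1)] by (simp add: ennreal_mult_top)
  also have "\<dots> = (\<integral>\<^sup>+\<tau>. ennreal (1 / \<epsilon>) *
      (ennreal (\<phi> (max 0 \<tau>) * \<tau>\<^sup>2 * f (max 0 (\<epsilon> * \<tau> powi (- 2)))) * indicator {1..} \<tau>) \<partial>lborel)"
    unfolding powi_minus_two by (rule nn_integral_cmult[symmetric]) measurable
  also have "\<dots> \<le> (\<integral>\<^sup>+\<tau>\<in>{0<..}. ennreal (\<phi> \<tau> * (f (heat_norm p w \<tau>) / heat_norm p w \<tau>)) \<partial>lborel)"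
  proof (rule nn_integral_mono)
    fix \<tau> :: real
    show "ennreal (1 / \<epsilon>) * (ennreal (\<phi> (max 0 \<tau>) * \<tau>\<^sup>2 * f (max 0 (\<epsilon> * \<tau> powi (- 2)))) * indicator {1..} \<tau>) \<le>
        ennreal (\<phi> \<tau> * (f (heat_norm p w \<tau>) / heat_norm p w \<tau>)) * indicator {0<..} \<tau>"
    proof (cases "\<tau> \<ge> 1")
      case True
      define N where "N = heat_norm p w \<tau>"
      have e: "0 < \<epsilon> / \<tau>\<^sup>2" "\<epsilon> / \<tau>\<^sup>2 \<le> N" using \<epsilon> True by (auto simp: N_def)
      have \<phi>0: "\<phi> \<tau> \<ge> 0" using True by (intro \<phi>_nonneg) simp
      have "f (\<epsilon> / \<tau>\<^sup>2) \<le> \<epsilon> / \<tau>\<^sup>2 * (f N / N)"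
        using e by (intro f_ratio_mono) auto
      then have "1 / \<epsilon> * (\<tau>\<^sup>2 * f (\<epsilon> / \<tau>\<^sup>2)) \<le> 1 / \<epsilon> * (\<tau>\<^sup>2 * (\<epsilon> / \<tau>\<^sup>2 * (f N / N)))"
        using \<epsilon>(1) by (intro mult_left_mono) auto
      also have "\<dots> = f N / N" using True \<epsilon>(1) by simp
      finally have "1 / \<epsilon> * (\<tau>\<^sup>2 * f (\<epsilon> / \<tau>\<^sup>2)) \<le> f N / N" .
      then have "\<phi> \<tau> * (1 / \<epsilon> * (\<tau>\<^sup>2 * f (\<epsilon> / \<tau>\<^sup>2))) \<le> \<phi> \<tau> * (f N / N)"
        using \<phi>0 by (rule mult_left_mono)
      then have "ennreal (1 / \<epsilon> * (\<phi> \<tau> * \<tau>\<^sup>2 * f (\<epsilon> / \<tau>\<^sup>2))) \<le> ennreal (\<phi> \<tau> * (f N / N))"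
        by (intro ennreal_leI) (simp add: mult_ac)
      moreover have "ennreal (1 / \<epsilon> * (\<phi> \<tau> * \<tau>\<^sup>2 * f (\<epsilon> / \<tau>\<^sup>2))) =
          ennreal (1 / \<epsilon>) * ennreal (\<phi> \<tau> * \<tau>\<^sup>2 * f (\<epsilon> / \<tau>\<^sup>2))"
        using \<epsilon>(1) by (intro ennreal_mult') simp
      ultimately show ?thesis
        using True e(1) by (simp add: N_def powi_minus_two max_def)
    qed simp
  qed
  finally show ?thesis by (simp add: top_unique)
qed

text \<open>From time 1 on the integrand is the weight in (b) divided by \<open>\<epsilon>\<close>;
  before that, \<open>decay\<close> is 1 and \<open>\<phi>\<close> is bounded by
  compactness.\<close>

lemma decay_integral_finite:
  assumes \<epsilon>: "\<epsilon> > 0" and fin: "(\<integral>\<^sup>+\<tau>\<in>{1..}. ennreal (\<phi> \<tau> * \<tau>\<^sup>2 * f (\<epsilon> * \<tau> powi (- 2))) \<partial>lborel) < \<infinity>"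
  shows "(\<integral>\<^sup>+\<tau>\<in>{0<..}. ennreal (\<phi> \<tau> * (f (\<epsilon> * decay \<tau>) / (\<epsilon> * decay \<tau>))) \<partial>lborel) < \<infinity>"
proof -
  have "compact (\<phi> ` {0..1})"
    by (intro compact_continuous_image continuous_on_subset[OF \<phi>_cont]) auto
  then have "bounded (\<phi> ` {0..1})" by (rule compact_imp_bounded)
  then obtain B where "\<forall>v\<in>\<phi> ` {0..1}. norm v \<le> B" unfolding bounded_iff by blast
  then have "\<bar>\<phi> \<tau>\<bar> \<le> B" if "\<tau> \<in> {0..1}" for \<tau> using that by auto
  then have B: "\<phi> \<tau> \<le> B" if "\<tau> \<in> {0..1}" for \<tau> using that by (simp add: abs_le_iff)
  define C where "C = B * (f \<epsilon> / \<epsilon>)"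
  have "(\<integral>\<^sup>+\<tau>\<in>{0<..}. ennreal (\<phi> \<tau> * (f (\<epsilon> * decay \<tau>) / (\<epsilon> * decay \<tau>))) \<partial>lborel) \<le>
      (\<integral>\<^sup>+\<tau>. (ennreal C * indicator {0..1} \<tau> + ennreal (1 / \<epsilon>) *
        (ennreal (\<phi> (max 0 \<tau>) * \<tau>\<^sup>2 * f (max 0 (\<epsilon> * \<tau> powi (- 2)))) * indicator {1..} \<tau>)) \<partial>lborel)"
  proof (rule nn_integral_mono)
    fix \<tau> :: real
    consider "\<tau> \<le> 0" | "0 < \<tau>" "\<tau> < 1" | "1 \<le> \<tau>" by linarith
    then show "ennreal (\<phi> \<tau> * (f (\<epsilon> * decay \<tau>) / (\<epsilon> * decay \<tau>))) * indicator {0<..} \<tau> \<le>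
        ennreal C * indicator {0..1} \<tau> + ennreal (1 / \<epsilon>) *
        (ennreal (\<phi> (max 0 \<tau>) * \<tau>\<^sup>2 * f (max 0 (\<epsilon> * \<tau> powi (- 2)))) * indicator {1..} \<tau>)"
    proof cases
      case 2
      have "\<phi> \<tau> * (f \<epsilon> / \<epsilon>) \<le> C"
        unfolding C_def using 2 \<epsilon> by (intro mult_right_mono B divide_nonneg_nonneg f_nonneg) auto
      then show ?thesis using 2 by (simp add: decay_less_1 ennreal_leI)
    next
      case 3
      have \<phi>0: "\<phi> \<tau> \<ge> 0" using 3 by (intro \<phi>_nonneg) simp
      have "\<phi> \<tau> * (f (\<epsilon> * decay \<tau>) / (\<epsilon> * decay \<tau>)) = 1 / \<epsilon> * (\<phi> \<tau> * \<tau>\<^sup>2 * f (\<epsilon> / \<tau>\<^sup>2))"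
        using 3 \<epsilon> by (simp add: decay_ge_1)
      then have "ennreal (\<phi> \<tau> * (f (\<epsilon> * decay \<tau>) / (\<epsilon> * decay \<tau>))) =
          ennreal (1 / \<epsilon>) * ennreal (\<phi> \<tau> * \<tau>\<^sup>2 * f (\<epsilon> / \<tau>\<^sup>2))"
        using \<epsilon> by (simp only:) (intro ennreal_mult', simp)
      then show ?thesis using 3 \<epsilon> by (simp add: powi_minus_two max_def)
    qed simp
  qed
  also have "\<dots> = (\<integral>\<^sup>+\<tau>. ennreal C * indicator {0..1::real} \<tau> \<partial>lborel) + (\<integral>\<^sup>+\<tau>. ennreal (1 / \<epsilon>) *
        (ennreal (\<phi> (max 0 \<tau>) * \<tau>\<^sup>2 * f (max 0 (\<epsilon> * \<tau> powi (- 2)))) * indicator {1..} \<tau>) \<partial>lborel)"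
    unfolding powi_minus_two by (rule nn_integral_add) measurable
  also have "(\<integral>\<^sup>+\<tau>. ennreal C * indicator {0..1::real} \<tau> \<partial>lborel) = ennreal C"
    by (subst nn_integral_cmult_indicator) auto
  also have "(\<integral>\<^sup>+\<tau>. ennreal (1 / \<epsilon>) *
        (ennreal (\<phi> (max 0 \<tau>) * \<tau>\<^sup>2 * f (max 0 (\<epsilon> * \<tau> powi (- 2)))) * indicator {1..} \<tau>) \<partial>lborel) =
      ennreal (1 / \<epsilon>) * (\<integral>\<^sup>+\<tau>\<in>{1..}. ennreal (\<phi> (max 0 \<tau>) * \<tau>\<^sup>2 * f (max 0 (\<epsilon> * \<tau> powi (- 2)))) \<partial>lborel)"
    unfolding powi_minus_two by (rule nn_integral_cmult) measurable
  also have "ennreal C + \<dots> < \<infinity>"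
    using fin unfolding weight_integral_max[OF \<epsilon>] by (simp add: ennreal_mult_less_top)
  finally show ?thesis .
qed

text \<open>The profile is scaled by \<open>\<epsilon> / K\<close> so that its evolution stays below
  \<open>\<epsilon> * decay \<tau>\<close>, and monotonicity of \<open>f v / v\<close> transfers
  finiteness.\<close>

lemma exists_convergent_datum:
  assumes \<epsilon>: "\<epsilon> > 0" and fin: "(\<integral>\<^sup>+\<tau>\<in>{1..}. ennreal (\<phi> \<tau> * \<tau>\<^sup>2 * f (\<epsilon> * \<tau> powi (- 2))) \<partial>lborel) < \<infinity>"
  shows "\<exists>w\<in>pos_C0_L1. (\<integral>\<^sup>+\<tau>\<in>{0<..}. ennreal (\<phi> \<tau> * (f (heat_norm p w \<tau>) / heat_norm p w \<tau>)) \<partial>lborel) \<noteq> \<infinity>"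
proof -
  obtain K where K: "K \<ge> 1"
    "\<And>\<delta> t x. \<delta> > 0 \<Longrightarrow> t > 0 \<Longrightarrow> heat_semigroup p t (\<lambda>y. ennreal (\<delta> * profile y)) x \<le> ennreal (\<delta> * K * decay t)"
    using profile_decay by blast
  define w where "w x = \<epsilon> / K * profile x" for x
  have w: "w \<in> pos_C0_L1"
    unfolding w_def using \<epsilon> K(1) by (intro profile_scaled_in) simp
  have "(\<integral>\<^sup>+\<tau>\<in>{0<..}. ennreal (\<phi> \<tau> * (f (heat_norm p w \<tau>) / heat_norm p w \<tau>)) \<partial>lborel) \<le>
      (\<integral>\<^sup>+\<tau>\<in>{0<..}. ennreal (\<phi> \<tau> * (f (\<epsilon> * decay \<tau>) / (\<epsilon> * decay \<tau>))) \<partial>lborel)"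
  proof (rule nn_integral_mono)
    fix \<tau> :: real
    show "ennreal (\<phi> \<tau> * (f (heat_norm p w \<tau>) / heat_norm p w \<tau>)) * indicator {0<..} \<tau> \<le>
        ennreal (\<phi> \<tau> * (f (\<epsilon> * decay \<tau>) / (\<epsilon> * decay \<tau>))) * indicator {0<..} \<tau>"
    proof (cases "\<tau> > 0")
      case \<tau>: True
      define N where "N = heat_norm p w \<tau>"
      define b where "b = \<epsilon> * decay \<tau>"
      have b: "b > 0" using \<epsilon> decay_pos[OF \<tau>] by (simp add: b_def)
      have "heat_semigroup p \<tau> (\<lambda>y. ennreal (w y)) x \<le> ennreal b" for x
        using K(2)[of "\<epsilon> / K" \<tau> x] \<epsilon> K(1) \<tau> by (simp add: w_def b_def)
      then have N: "0 \<le> N" "N \<le> b"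
        using heat_norm_bounds(1,2)[OF w \<tau> _ less_imp_le[OF b]] by (simp_all add: N_def)
      have "f N / N \<le> f b / b"
      \<comment> \<open>If the norm is 0, the quotient is 0 by the division convention and the bound
        is trivial.\<close>
      proof (cases "N = 0")
        case True
        then show ?thesis using b f_nonneg[of b] by simp
      next
        case False
        then show ?thesis using f_ratio_mono[OF N b] N(1) by (simp add: divide_le_eq mult.commute)
      qed
      then have "\<phi> \<tau> * (f N / N) \<le> \<phi> \<tau> * (f b / b)"
        using \<tau> by (intro mult_left_mono \<phi>_nonneg) auto
      then have "ennreal (\<phi> \<tau> * (f N / N)) \<le> ennreal (\<phi> \<tau> * (f b / b))" by (rule ennreal_leI)
      then show ?thesis unfolding N_def b_def by (rule mult_right_mono) simp
    qed simp
  qed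
  also have "\<dots> < \<infinity>" by (rule decay_integral_finite[OF \<epsilon> fin])
  finally show ?thesis using w by (intro bexI[of _ w]) auto
qed

section \<open>Construction of global solutions\<close>

text \<open>\<open>enn2real\<close> sends infinity to 0 and is not monotone there, which explains
  the finiteness hypotheses in \<open>source_mono\<close> and \<open>source_SUP\<close>.\<close>

definition source :: "(real \<times> heis \<Rightarrow> ennreal) \<Rightarrow> real \<times> heis \<Rightarrow> ennreal" where
  "source G z = ennreal (\<phi> (max 0 (fst z)) * f (enn2real (G z)))"

text \<open>The indicators make the operator vanish for nonpositive times, so that its iterates are
  Borel on all of space-time.\<close>

definition duhamel :: "(heis \<Rightarrow> ennreal) \<Rightarrow> (real \<times> heis \<Rightarrow> ennreal) \<Rightarrow> real \<times> heis \<Rightarrow> ennreal" where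
  "duhamel w G z = heat_semigroup p (fst z) w (snd z) * indicator {0<..} (fst z) +
     (\<integral>\<^sup>+\<tau>. heat_semigroup p (fst z - \<tau>) (\<lambda>y. source G (\<tau>, y)) (snd z) * indicator {0<..<fst z} \<tau> \<partial>lborel)"

lemma source_measurable [measurable]:
  assumes [measurable]: "G \<in> borel_measurable borel"
  shows "source G \<in> borel_measurable borel"
proof -
  have [measurable]: "(fst :: real \<times> heis \<Rightarrow> real) \<in> borel_measurable borel"
    by (intro borel_measurable_continuous_onI continuous_intros)
  have "(\<lambda>z. f (max 0 (enn2real (G z)))) \<in> borel_measurable borel" by measurable
  then have [measurable]: "(\<lambda>z. f (enn2real (G z))) \<in> borel_measurable borel"
    by (simp add: max_absorb2)
  show ?thesis unfolding source_def[abs_def] by measurable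
qed

lemma duhamel_measurable [measurable]:
  assumes [measurable]: "w \<in> borel_measurable borel" "G \<in> borel_measurable borel"
  shows "duhamel w G \<in> borel_measurable borel"
proof -
  have [measurable]: "(fst :: real \<times> heis \<Rightarrow> real) \<in> borel_measurable borel"
      "(snd :: real \<times> heis \<Rightarrow> heis) \<in> borel_measurable borel"
    by (intro borel_measurable_continuous_onI continuous_intros)+
  have [measurable]: "(\<lambda>z :: real \<times> heis. heat_semigroup p (fst z) w (snd z) * indicator {0<..} (fst z)) \<in> borel_measurable borel"
    by (rule heat_semigroup_joint_measurable) measurable
  have "(\<lambda>(z :: real \<times> heis, \<tau>). heat_semigroup p (fst z - \<tau>) (\<lambda>y. source G (\<tau>, y)) (snd z) * indicator {0<..<fst z} \<tau>)
      \<in> borel_measurable (borel \<Otimes>\<^sub>M lborel)"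
    unfolding split_beta' by (rule duhamel_kernel_measurable) measurable
  then have [measurable]: "(\<lambda>z :: real \<times> heis. \<integral>\<^sup>+\<tau>. heat_semigroup p (fst z - \<tau>) (\<lambda>y. source G (\<tau>, y)) (snd z) *
      indicator {0<..<fst z} \<tau> \<partial>lborel) \<in> borel_measurable borel"
    by (rule lborel.borel_measurable_nn_integral)
  show ?thesis unfolding duhamel_def[abs_def] by measurable
qed

lemma source_mono:
  assumes "G z \<le> G' z" "G' z < \<infinity>"
  shows "source G z \<le> source G' z"
  unfolding source_def using assms
  by (intro ennreal_leI mult_left_mono f_mono enn2real_mono \<phi>_nonneg) auto

lemma duhamel_mono:
  assumes "\<And>z. G z \<le> G' z" "\<And>z. G' z < \<infinity>"
  shows "duhamel w G z \<le> duhamel w G' z"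
  unfolding duhamel_def
  by (intro add_left_mono nn_integral_mono mult_right_mono heat_semigroup_mono source_mono assms) auto

text \<open>
  Twice the linear evolution is a supersolution: if \<open>f v \<le> \<rho> v\<close> below it, the semigroup law bounds the
  Duhamel term by \<open>2 (\<integral> \<phi> \<rho>)\<close> times the linear evolution.
\<close>

lemma duhamel_supersolution:
  assumes [measurable]: "w \<in> borel_measurable borel" "G \<in> borel_measurable borel"
    and G: "\<And>t x. t > 0 \<Longrightarrow> G (t, x) \<le> 2 * heat_semigroup p t w x"
    and fin: "\<And>t x. t > 0 \<Longrightarrow> heat_semigroup p t w x < \<infinity>"
    and \<rho>: "\<And>\<tau> y v. \<tau> > 0 \<Longrightarrow> v \<ge> 0 \<Longrightarrow> ennreal v \<le> 2 * heat_semigroup p \<tau> w y \<Longrightarrow> f v \<le> \<rho> \<tau> * v"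
      "\<And>\<tau>. \<tau> > 0 \<Longrightarrow> \<rho> \<tau> \<ge> 0"
      "(\<lambda>\<tau>. ennreal (\<phi> \<tau> * \<rho> \<tau>) * indicator {0<..} \<tau>) \<in> borel_measurable borel"
      "(\<integral>\<^sup>+\<tau>\<in>{0<..}. ennreal (\<phi> \<tau> * \<rho> \<tau>) \<partial>lborel) \<le> ennreal (1 / 2)"
    and t: "t > 0"
  shows "duhamel w G (t, x) \<le> 2 * heat_semigroup p t w x"
proof -
  define h where "h = heat_semigroup p t w x"
  note [measurable] = \<rho>(3)
  have source_le: "source G (\<tau>, y) \<le> ennreal (\<phi> \<tau> * \<rho> \<tau>) * (2 * heat_semigroup p \<tau> w y)" if \<tau>: "\<tau> > 0" for \<tau> y
  proof -
    have Gf: "G (\<tau>, y) < \<infinity>"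
      using G[OF \<tau>, of y] fin[OF \<tau>, of y] by (auto simp: ennreal_mult_less_top intro: le_less_trans)
    define v where "v = enn2real (G (\<tau>, y))"
    have v: "v \<ge> 0" "ennreal v = G (\<tau>, y)" using Gf by (auto simp: v_def)
    have \<phi>0: "\<phi> \<tau> \<ge> 0" using \<tau> by (intro \<phi>_nonneg) simp
    have "f v \<le> \<rho> \<tau> * v" using \<rho>(1)[OF \<tau> v(1), of y] v(2) G[OF \<tau>, of y] by simp
    then have "\<phi> \<tau> * f v \<le> (\<phi> \<tau> * \<rho> \<tau>) * v"
      unfolding mult.assoc using \<phi>0 by (rule mult_left_mono)
    then have "source G (\<tau>, y) \<le> ennreal ((\<phi> \<tau> * \<rho> \<tau>) * v)"
      using \<tau> by (simp add: source_def v_def max_absorb2 ennreal_leI)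
    also have "\<dots> = ennreal (\<phi> \<tau> * \<rho> \<tau>) * G (\<tau>, y)"
      unfolding v(2)[symmetric] using \<phi>0 \<rho>(2)[OF \<tau>] by (intro ennreal_mult') auto
    also have "\<dots> \<le> ennreal (\<phi> \<tau> * \<rho> \<tau>) * (2 * heat_semigroup p \<tau> w y)"
      by (intro mult_left_mono G \<tau>) simp
    finally show ?thesis .
  qed
  have "heat_semigroup p (t - \<tau>) (\<lambda>y. source G (\<tau>, y)) x * indicator {0<..<t} \<tau> \<le>
      ennreal (\<phi> \<tau> * \<rho> \<tau>) * indicator {0<..} \<tau> * (2 * h)" for \<tau>
  proof (cases "\<tau> \<in> {0<..<t}")
    case True
    then have \<tau>: "0 < \<tau>" "0 < t - \<tau>" by auto
    have [measurable]: "heat_semigroup p \<tau> w \<in> borel_measurable borel"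
      by (rule heat_semigroup_measurable[OF \<tau>(1)]) measurable
    have "heat_semigroup p (t - \<tau>) (\<lambda>y. source G (\<tau>, y)) x \<le>
        heat_semigroup p (t - \<tau>) (\<lambda>y. ennreal (\<phi> \<tau> * \<rho> \<tau>) * (2 * heat_semigroup p \<tau> w y)) x"
      by (intro heat_semigroup_mono source_le \<tau>)
    also have "\<dots> = ennreal (\<phi> \<tau> * \<rho> \<tau>) * (2 * heat_semigroup p (t - \<tau>) (heat_semigroup p \<tau> w) x)"
      using heat_semigroup_cmult[OF \<tau>(2), of "\<lambda>y. 2 * heat_semigroup p \<tau> w y" "ennreal (\<phi> \<tau> * \<rho> \<tau>)" x]
        heat_semigroup_cmult[OF \<tau>(2), of "heat_semigroup p \<tau> w" 2 x] by simp
    also have "\<dots> \<le> ennreal (\<phi> \<tau> * \<rho> \<tau>) * (2 * heat_semigroup p (t - \<tau> + \<tau>) w x)"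
      by (intro mult_left_mono heat_semigroup_semigroup_le \<tau>) auto
    finally show ?thesis using True by (simp add: h_def)
  qed simp
  then have "(\<integral>\<^sup>+\<tau>. heat_semigroup p (t - \<tau>) (\<lambda>y. source G (\<tau>, y)) x * indicator {0<..<t} \<tau> \<partial>lborel) \<le>
      (\<integral>\<^sup>+\<tau>. ennreal (\<phi> \<tau> * \<rho> \<tau>) * indicator {0<..} \<tau> * (2 * h) \<partial>lborel)"
    by (intro nn_integral_mono)
  also have "\<dots> = (\<integral>\<^sup>+\<tau>\<in>{0<..}. ennreal (\<phi> \<tau> * \<rho> \<tau>) \<partial>lborel) * (2 * h)"
    by (rule nn_integral_multc) measurable
  also have "\<dots> \<le> ennreal (1 / 2) * (2 * h)"
    by (intro mult_right_mono \<rho>(4)) auto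
  also have "\<dots> = (ennreal (1 / 2) * ennreal 2) * h" by (simp add: mult.assoc)
  also have "ennreal (1 / 2) * ennreal 2 = 1" by (subst ennreal_mult[symmetric]) auto
  finally have "(\<integral>\<^sup>+\<tau>. heat_semigroup p (t - \<tau>) (\<lambda>y. source G (\<tau>, y)) x * indicator {0<..<t} \<tau> \<partial>lborel) \<le> h"
    by simp
  then have "duhamel w G (t, x) \<le> h + h"
    using t by (simp add: duhamel_def h_def add_left_mono)
  then show ?thesis by (simp add: h_def mult_2)
qed

text \<open>Continuity of \<open>f\<close> identifies the limit of the sources, and monotonicity
  turns that limit into a supremum.\<close>

lemma source_SUP:
  assumes inc: "incseq (\<lambda>n. U n z)" and fin: "(SUP n. U n z) < \<infinity>"
  shows "source (\<lambda>z. SUP n. U n z) z = (SUP n. source (U n) z)"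
proof -
  define L where "L = enn2real (SUP n. U n z)"
  have L: "ennreal L = (SUP n. U n z)" "L \<ge> 0" using fin by (auto simp: L_def)
  have Ufin: "U n z < \<infinity>" for n
    using fin by (rule le_less_trans[rotated]) (rule SUP_upper, simp)
  have "(\<lambda>n. U n z) \<longlonglongrightarrow> ennreal L" unfolding L by (rule LIMSEQ_SUP[OF inc])
  then have "(\<lambda>n. enn2real (U n z)) \<longlonglongrightarrow> L" using L(2) by (rule tendsto_enn2real)
  then have "(\<lambda>n. f (enn2real (U n z))) \<longlonglongrightarrow> f L"
    using L(2) by (intro continuous_on_tendsto_compose[OF f_cont]) auto
  then have "(\<lambda>n. source (U n) z) \<longlonglongrightarrow> source (\<lambda>z. SUP n. U n z) z"
    unfolding source_def L_def[symmetric] by (intro tendsto_intros)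
  moreover have "incseq (\<lambda>n. source (U n) z)"
    using inc Ufin by (auto simp: incseq_def intro!: source_mono)
  then have "(\<lambda>n. source (U n) z) \<longlonglongrightarrow> (SUP n. source (U n) z)" by (rule LIMSEQ_SUP)
  ultimately show ?thesis by (rule LIMSEQ_unique)
qed

text \<open>Monotone convergence is applied twice, in the space variable inside the semigroup and in
  \<open>\<tau>\<close> outside it.\<close>

lemma duhamel_SUP:
  assumes [measurable]: "w \<in> borel_measurable borel" "\<And>n. U n \<in> borel_measurable borel"
    and inc: "\<And>z. incseq (\<lambda>n. U n z)" and fin: "\<And>z. (SUP n. U n z) < \<infinity>"
  shows "duhamel w (\<lambda>z. SUP n. U n z) z = (SUP n. duhamel w (U n) z)"
proof -
  obtain t x where z: "z = (t, x)" by (cases z)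
  have Ufin: "U n z < \<infinity>" for n z
    using fin[of z] by (rule le_less_trans[rotated]) (rule SUP_upper, simp)
  have source_inc: "m \<le> n \<Longrightarrow> source (U m) z \<le> source (U n) z" for m n z
    by (intro source_mono Ufin incseqD[OF inc])
  have inner: "heat_semigroup p s (\<lambda>y. source (\<lambda>z. SUP n. U n z) (\<tau>, y)) x =
      (SUP n. heat_semigroup p s (\<lambda>y. source (U n) (\<tau>, y)) x)" if s: "s > 0" for s \<tau>
  proof -
    note [measurable] = p_measurable[OF s]
    have "heat_semigroup p s (\<lambda>y. source (\<lambda>z. SUP n. U n z) (\<tau>, y)) x =
        (\<integral>\<^sup>+y. (SUP n. ennreal (p s (hinv y \<odot> x)) * source (U n) (\<tau>, y)) \<partial>lborel)"
      unfolding heat_semigroup_def by (simp only: source_SUP[OF inc fin] SUP_mult_left_ennreal)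
    also have "\<dots> = (SUP n. \<integral>\<^sup>+y. ennreal (p s (hinv y \<odot> x)) * source (U n) (\<tau>, y) \<partial>lborel)"
    proof (rule nn_integral_monotone_convergence_SUP)
      show "incseq (\<lambda>n y. ennreal (p s (hinv y \<odot> x)) * source (U n) (\<tau>, y))"
        by (intro incseq_SucI le_funI mult_left_mono source_inc) auto
    qed measurable
    finally show ?thesis by (simp add: heat_semigroup_def)
  qed
  define K where "K n \<tau> = heat_semigroup p (t - \<tau>) (\<lambda>y. source (U n) (\<tau>, y)) x * indicator {0<..<t} \<tau>" for n \<tau>
  have [measurable]: "K n \<in> borel_measurable lborel" for n
    unfolding K_def[abs_def] by (rule duhamel_kernel_measurable) measurable
  have "(\<integral>\<^sup>+\<tau>. heat_semigroup p (t - \<tau>) (\<lambda>y. source (\<lambda>z. SUP n. U n z) (\<tau>, y)) x * indicator {0<..<t} \<tau> \<partial>lborel) =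
      (\<integral>\<^sup>+\<tau>. (SUP n. K n \<tau>) \<partial>lborel)"
  proof (rule nn_integral_cong)
    fix \<tau>
    show "heat_semigroup p (t - \<tau>) (\<lambda>y. source (\<lambda>z. SUP n. U n z) (\<tau>, y)) x * indicator {0<..<t} \<tau> = (SUP n. K n \<tau>)"
      using inner[of "t - \<tau>" \<tau>] by (cases "\<tau> \<in> {0<..<t}") (simp_all add: K_def)
  qed
  also have "\<dots> = (SUP n. \<integral>\<^sup>+\<tau>. K n \<tau> \<partial>lborel)"
  proof (rule nn_integral_monotone_convergence_SUP)
    show "incseq K"
      unfolding K_def[abs_def]
      by (intro incseq_SucI le_funI mult_right_mono heat_semigroup_mono source_inc) auto
  qed measurable
  finally show ?thesis
    unfolding duhamel_def z fst_conv snd_conv K_def by (simp add: ennreal_SUP_add_right)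
qed

text \<open>\<open>\<rho>\<close> bounds the quotient \<open>f v / v\<close> at all heights below
  twice the linear evolution; with total weight at most 1/2, the iterates remain below that
  supersolution and increase to a fixed point.\<close>

lemma exists_global_solution:
  assumes w: "w \<in> pos_C0_L1"
    and \<rho>: "\<And>\<tau> y v. \<tau> > 0 \<Longrightarrow> v \<ge> 0 \<Longrightarrow>
        ennreal v \<le> 2 * heat_semigroup p \<tau> (\<lambda>y. ennreal (w y)) y \<Longrightarrow> f v \<le> \<rho> \<tau> * v"
      "\<And>\<tau>. \<tau> > 0 \<Longrightarrow> \<rho> \<tau> \<ge> 0"
      "(\<lambda>\<tau>. ennreal (\<phi> \<tau> * \<rho> \<tau>) * indicator {0<..} \<tau>) \<in> borel_measurable borel"
      "(\<integral>\<^sup>+\<tau>\<in>{0<..}. ennreal (\<phi> \<tau> * \<rho> \<tau>) \<partial>lborel) \<le> ennreal (1 / 2)"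
  shows "\<exists>u. global_solution p \<phi> f w u"
proof -
  define we where "we y = ennreal (w y)" for y
  have we_eq: "we = (\<lambda>y. ennreal (w y))" by (simp add: we_def[abs_def])
  have [measurable]: "we \<in> borel_measurable borel"
    unfolding we_def using pos_C0_L1_measurable[OF w] by simp
  obtain M where M: "M > 0" "\<And>y. w y \<le> M" using pos_C0_L1_bounded[OF w] by blast
  have heat_le: "heat_semigroup p t we x \<le> ennreal M" if "t > 0" for t x
  proof -
    have "heat_semigroup p t we x \<le> heat_semigroup p t (\<lambda>y. ennreal M) x"
      unfolding we_def by (intro heat_semigroup_mono ennreal_leI M)
    then show ?thesis using that by (simp add: heat_semigroup_const)
  qed
  have heat_fin: "heat_semigroup p t we x < \<infinity>" if "t > 0" for t x
    using heat_le[OF that, of x] by (rule le_less_trans) simp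
  \<comment> \<open>Starting from 0 makes the first step increasing and places the start below the
    supersolution.\<close>
  define U where "U n = (duhamel we ^^ n) (\<lambda>z. 0)" for n
  have U_Suc: "U (Suc n) = duhamel we (U n)" and U_0: "U 0 = (\<lambda>z. 0)" for n
    by (simp_all add: U_def)
  have U_meas[measurable]: "U n \<in> borel_measurable borel" for n
    by (induction n) (simp_all add: U_0 U_Suc)
  have U_le: "U n (t, x) \<le> 2 * heat_semigroup p t we x" if "t > 0" for n t x
    using that
  proof (induction n arbitrary: t x)
    case (Suc n)
    show ?case
      unfolding U_Suc
      by (rule duhamel_supersolution[OF _ _ Suc.IH heat_fin \<rho>(1)[folded we_eq] \<rho>(2-4) Suc.prems]) measurable
  qed (simp add: U_0)
  have U_neg: "U n (t, x) = 0" if "\<not> t > 0" for n t x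
    using that by (cases n) (auto simp: U_0 U_Suc duhamel_def)
  have U_bdd: "U n z \<le> 2 * ennreal M" for n z
  proof -
    obtain t x where z: "z = (t, x)" by (cases z)
    show ?thesis
    proof (cases "t > 0")
      case True
      have "U n (t, x) \<le> 2 * heat_semigroup p t we x" by (rule U_le[OF True])
      also have "\<dots> \<le> 2 * ennreal M" by (intro mult_left_mono heat_le[OF True]) simp
      finally show ?thesis by (simp only: z)
    qed (simp add: z U_neg)
  qed
  have top: "2 * ennreal M < \<infinity>" by (simp add: ennreal_mult_less_top)
  have U_fin: "U n z < \<infinity>" for n z using U_bdd top by (rule le_less_trans)
  have U_mono: "U n z \<le> U (Suc n) z" for n z
  proof (induction n arbitrary: z)
    case (Suc n)
    show ?case unfolding U_Suc[of "Suc n"] by (subst U_Suc) (intro duhamel_mono Suc U_fin)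
  qed (simp add: U_0)
  then have inc: "incseq (\<lambda>n. U n z)" for z by (rule incseq_SucI)
  define V where "V z = (SUP n. U n z)" for z
  have V_bdd: "V z \<le> 2 * ennreal M" for z unfolding V_def by (intro SUP_least U_bdd)
  have V_fin: "V z < \<infinity>" for z using V_bdd top by (rule le_less_trans)
  have [measurable]: "V \<in> borel_measurable borel" unfolding V_def[abs_def] by measurable
  have fix_point: "V z = duhamel we V z" for z
  proof -
    have "V z = (SUP n. U (Suc n) z)"
      unfolding V_def
    proof (rule antisym)
      show "(SUP n. U n z) \<le> (SUP n. U (Suc n) z)"
        by (rule SUP_mono) (use U_mono in blast)
      show "(SUP n. U (Suc n) z) \<le> (SUP n. U n z)"
        by (intro SUP_least SUP_upper) auto
    qed
    also have "\<dots> = duhamel we V z"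
      unfolding U_Suc V_def[abs_def] using V_fin
      by (intro duhamel_SUP[symmetric] inc) (auto simp: V_def)
    finally show ?thesis .
  qed
  define u where "u t x = enn2real (V (t, x))" for t x
  have u: "ennreal (u t x) = V (t, x)" for t x using V_fin[of "(t, x)"] by (simp add: u_def)
  have "global_solution p \<phi> f w u"
    unfolding global_solution_def
  proof (intro conjI allI impI)
    have "(\<lambda>(t, x). u t x) \<in> borel_measurable borel"
      unfolding u_def split_beta' by simp
    then show "(\<lambda>(t, x). u t x) \<in> borel_measurable (restrict_space borel heat_domain)"
      by (rule measurable_restrict_space1)
    fix t :: real and x assume t: "t > 0"
    show "ennreal (u t x) = heat_semigroup p t (\<lambda>y. ennreal (w y)) x +
        (\<integral>\<^sup>+\<tau>\<in>{0<..<t}. heat_semigroup p (t - \<tau>) (\<lambda>y. ennreal (\<phi> \<tau> * f (u \<tau> y))) x \<partial>lborel)"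
    proof -
      have "ennreal (u t x) = heat_semigroup p t (\<lambda>y. ennreal (w y)) x +
          (\<integral>\<^sup>+\<tau>. heat_semigroup p (t - \<tau>) (\<lambda>y. source V (\<tau>, y)) x * indicator {0<..<t} \<tau> \<partial>lborel)"
        unfolding u by (subst fix_point) (use t in \<open>simp add: duhamel_def we_def[abs_def]\<close>)
      also have "(\<integral>\<^sup>+\<tau>. heat_semigroup p (t - \<tau>) (\<lambda>y. source V (\<tau>, y)) x * indicator {0<..<t} \<tau> \<partial>lborel) =
          (\<integral>\<^sup>+\<tau>\<in>{0<..<t}. heat_semigroup p (t - \<tau>) (\<lambda>y. ennreal (\<phi> \<tau> * f (u \<tau> y))) x \<partial>lborel)"
        by (intro nn_integral_cong) (auto simp: indicator_def source_def u_def max_absorb2)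
      finally show ?thesis .
    qed
    show "u t x > 0"
    proof -
      have "0 < heat_semigroup p t we x"
        using w t by (intro heat_semigroup_pos) (auto simp: we_def pos_C0_L1_def)
      also have "\<dots> \<le> V (t, x)"
        by (subst fix_point) (use t in \<open>simp add: duhamel_def\<close>)
      finally show ?thesis using V_fin[of "(t, x)"] by (simp add: u_def enn2real_positive_iff)
    qed
  next
    fix t :: real assume "t > 0"
    have "Linf_norm (\<lambda>x. ennreal (u t x)) \<le> 2 * ennreal M"
      using V_bdd unfolding u by (intro Linf_norm_le) auto
    then show "Linf_norm (\<lambda>x. ennreal (u t x)) < \<infinity>" using top by (rule le_less_trans)
  qed
  then show ?thesis by (rule exI[where x = u])
qed

text \<open>One small \<open>s\<close> works for every height \<open>\<alpha>\<close> at once: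
  passing from \<open>\<alpha>\<close> to \<open>s * \<alpha>\<close> reduces the quotient
  \<open>f v / v\<close> by the factor \<open>q\<close>. This uniformity turns a finite integral
  into a small one.\<close>

lemma upper_ratio_small:
  assumes "q > 0"
  obtains s where "0 < s" "s < 1" "\<And>\<alpha>. 0 < \<alpha> \<Longrightarrow> \<alpha> < 1 \<Longrightarrow> f (s * \<alpha>) \<le> q * s * f \<alpha>"
proof -
  have "eventually (\<lambda>s. upper_ratio f s / ennreal s < ennreal q) (at_right 0)"
    using assms by (intro order_tendstoD(2)[OF f_upper]) simp
  then obtain d where d: "d > 0" "\<And>s. 0 < s \<Longrightarrow> s < d \<Longrightarrow> upper_ratio f s / ennreal s < ennreal q"
    unfolding eventually_at_right_field by auto
  define s where "s = min (d / 2) (1 / 2)"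
  have s: "0 < s" "s < d" "s < 1" using d(1) by (auto simp: s_def)
  have "f (s * \<alpha>) \<le> q * s * f \<alpha>" if \<alpha>: "0 < \<alpha>" "\<alpha> < 1" for \<alpha>
  proof -
    have "ennreal (f (\<alpha> * s) / f \<alpha> / s) = ennreal (f (\<alpha> * s) / f \<alpha>) / ennreal s"
      using s \<alpha> f_pos[OF \<alpha>(1)] f_nonneg[of "\<alpha> * s"] by (intro divide_ennreal[symmetric]) auto
    also have "\<dots> \<le> upper_ratio f s / ennreal s"
      unfolding upper_ratio_def using \<alpha> by (intro divide_right_mono_ennreal SUP_upper) auto
    also have "\<dots> < ennreal q" using s by (intro d)
    finally have "f (\<alpha> * s) / f \<alpha> / s < q"
      using assms by (simp add: ennreal_less_iff f_nonneg s \<alpha> less_imp_le)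
    then show ?thesis
      using s f_pos[OF \<alpha>(1)] by (simp add: divide_less_eq mult_ac)
  qed
  with s(1,3) show thesis by (rule that)
qed

lemma exists_datum_global_solution:
  assumes \<epsilon>: "\<epsilon> > 0" and fin: "(\<integral>\<^sup>+\<tau>\<in>{1..}. ennreal (\<phi> \<tau> * \<tau>\<^sup>2 * f (\<epsilon> * \<tau> powi (- 2))) \<partial>lborel) < \<infinity>"
  shows "\<exists>w\<in>pos_C0_L1. \<exists>u. global_solution p \<phi> f w u"
proof -
  \<comment> \<open>Lowering \<open>\<epsilon>\<close> below 1 keeps \<open>e * decay \<tau>\<close>
    inside the open unit interval, as the upper ratio requires; finiteness is inherited because
    \<open>f\<close> is increasing.\<close>
  define e where "e = min \<epsilon> (1 / 2)"
  have e: "0 < e" "e < 1" "e \<le> \<epsilon>" using \<epsilon> by (auto simp: e_def)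
  have "(\<integral>\<^sup>+\<tau>\<in>{1..}. ennreal (\<phi> \<tau> * \<tau>\<^sup>2 * f (e * \<tau> powi (- 2))) \<partial>lborel) \<le>
      (\<integral>\<^sup>+\<tau>\<in>{1..}. ennreal (\<phi> \<tau> * \<tau>\<^sup>2 * f (\<epsilon> * \<tau> powi (- 2))) \<partial>lborel)"
    using e by (intro nn_integral_mono)
      (auto simp: indicator_def powi_minus_two intro!: ennreal_leI mult_left_mono f_mono mult_nonneg_nonneg \<phi>_nonneg divide_right_mono)
  then have fin_e: "(\<integral>\<^sup>+\<tau>\<in>{1..}. ennreal (\<phi> \<tau> * \<tau>\<^sup>2 * f (e * \<tau> powi (- 2))) \<partial>lborel) < \<infinity>"
    using fin by (rule le_less_trans)
  define J where "J = (\<integral>\<^sup>+\<tau>\<in>{0<..}. ennreal (\<phi> \<tau> * (f (e * decay \<tau>) / (e * decay \<tau>))) \<partial>lborel)"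
  define j where "j = enn2real J"
  have j: "J = ennreal j" "j \<ge> 0"
    using decay_integral_finite[OF e(1) fin_e] by (auto simp: j_def J_def)
  \<comment> \<open>Chosen so that \<open>q * j \<le> 1 / 2\<close>; the added 1 covers
    \<open>j = 0\<close>.\<close>
  define q where "q = 1 / (2 * (j + 1))"
  have q: "q > 0" "q * j \<le> 1 / 2" using j(2) by (auto simp: q_def field_simps)
  obtain s where s: "0 < s" "s < 1" "\<And>\<alpha>. 0 < \<alpha> \<Longrightarrow> \<alpha> < 1 \<Longrightarrow> f (s * \<alpha>) \<le> q * s * f \<alpha>"
    using upper_ratio_small[OF q(1)] by blast
  obtain K where K: "K \<ge> 1"
    "\<And>\<delta> t x. \<delta> > 0 \<Longrightarrow> t > 0 \<Longrightarrow> heat_semigroup p t (\<lambda>y. ennreal (\<delta> * profile y)) x \<le> ennreal (\<delta> * K * decay t)"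
    using profile_decay by blast
  \<comment> \<open>Twice the evolution of \<open>\<delta> * profile\<close> is then at most
    \<open>s * e * decay \<tau>\<close>; the 2 is the one in the supersolution.\<close>
  define \<delta> where "\<delta> = s * e / (2 * K)"
  have \<delta>: "\<delta> > 0" "2 * (\<delta> * K * r) = s * e * r" for r using s e K(1) by (auto simp: \<delta>_def)
  define w where "w y = \<delta> * profile y" for y
  have w: "w \<in> pos_C0_L1" unfolding w_def by (rule profile_scaled_in[OF \<delta>(1)])
  define b where "b \<tau> = s * e * decay \<tau>" for \<tau>
  have b: "b \<tau> > 0" if "\<tau> > 0" for \<tau> using decay_pos[OF that] s e by (simp add: b_def)
  define \<rho> where "\<rho> \<tau> = f (b \<tau>) / b \<tau>" for \<tau>
  have heat2: "2 * heat_semigroup p \<tau> (\<lambda>y. ennreal (w y)) y \<le> ennreal (b \<tau>)" if \<tau>: "\<tau> > 0" for \<tau> y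
  proof -
    have "2 * heat_semigroup p \<tau> (\<lambda>y. ennreal (w y)) y \<le> ennreal 2 * ennreal (\<delta> * K * decay \<tau>)"
      unfolding w_def using K(2)[OF \<delta>(1) \<tau>] by (simp add: mult_left_mono)
    also have "\<dots> = ennreal (b \<tau>)"
      by (simp only: ennreal_mult'[symmetric] zero_le_numeral \<delta>(2) b_def)
    finally show ?thesis .
  qed
  have "\<exists>u. global_solution p \<phi> f w u"
  proof (rule exists_global_solution[OF w])
    show "f v \<le> \<rho> \<tau> * v" if \<tau>: "\<tau> > 0" and v: "v \<ge> 0"
      "ennreal v \<le> 2 * heat_semigroup p \<tau> (\<lambda>y. ennreal (w y)) y" for \<tau> y v
    proof -
      have "ennreal v \<le> ennreal (b \<tau>)" using v(2) heat2[OF \<tau>] by (rule order_trans)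
      then have "v \<le> b \<tau>" using b[OF \<tau>] by simp
      then show ?thesis using f_ratio_mono[OF v(1) _ b[OF \<tau>]] by (simp add: \<rho>_def mult.commute)
    qed
    show "\<rho> \<tau> \<ge> 0" if "\<tau> > 0" for \<tau>
      using b[OF that] f_nonneg[of "b \<tau>"] by (simp add: \<rho>_def)
    have "(\<lambda>\<tau>. ennreal (\<phi> (max 0 \<tau>) * (f (max 0 (b \<tau>)) / b \<tau>)) * indicator {0<..} \<tau>) \<in> borel_measurable borel"
      unfolding b_def decay_def by measurable
    also have "(\<lambda>\<tau>. ennreal (\<phi> (max 0 \<tau>) * (f (max 0 (b \<tau>)) / b \<tau>)) * indicator {0<..} \<tau>) =
        (\<lambda>\<tau>. ennreal (\<phi> \<tau> * \<rho> \<tau>) * indicator {0<..} \<tau>)"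
    proof (rule ext)
      fix \<tau> :: real
      show "ennreal (\<phi> (max 0 \<tau>) * (f (max 0 (b \<tau>)) / b \<tau>)) * indicator {0<..} \<tau> =
          ennreal (\<phi> \<tau> * \<rho> \<tau>) * indicator {0<..} \<tau>"
        using b[of \<tau>] by (cases "\<tau> > 0") (simp_all add: \<rho>_def max_absorb2)
    qed
    finally show "(\<lambda>\<tau>. ennreal (\<phi> \<tau> * \<rho> \<tau>) * indicator {0<..} \<tau>) \<in> borel_measurable borel" .
    have [measurable]: "(\<lambda>\<tau>. ennreal (\<phi> \<tau> * (f (e * decay \<tau>) / (e * decay \<tau>))) * indicator {0<..} \<tau>) \<in> borel_measurable borel"
    proof -
      have "(\<lambda>\<tau>. ennreal (\<phi> (max 0 \<tau>) * (f (max 0 (e * decay \<tau>)) / (e * decay \<tau>))) * indicator {0<..} \<tau>) \<in> borel_measurable borel"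
        unfolding decay_def by measurable
      also have "(\<lambda>\<tau>. ennreal (\<phi> (max 0 \<tau>) * (f (max 0 (e * decay \<tau>)) / (e * decay \<tau>))) * indicator {0<..} \<tau>) =
          (\<lambda>\<tau>. ennreal (\<phi> \<tau> * (f (e * decay \<tau>) / (e * decay \<tau>))) * indicator {0<..} \<tau>)"
      proof (rule ext)
        fix \<tau> :: real
        show "ennreal (\<phi> (max 0 \<tau>) * (f (max 0 (e * decay \<tau>)) / (e * decay \<tau>))) * indicator {0<..} \<tau> =
            ennreal (\<phi> \<tau> * (f (e * decay \<tau>) / (e * decay \<tau>))) * indicator {0<..} \<tau>"
          using decay_pos[of \<tau>] e by (cases "\<tau> > 0") (simp_all add: max_absorb2)
      qed
      finally show ?thesis .
    qed
    have "(\<integral>\<^sup>+\<tau>\<in>{0<..}. ennreal (\<phi> \<tau> * \<rho> \<tau>) \<partial>lborel) \<le>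
        (\<integral>\<^sup>+\<tau>. ennreal q * (ennreal (\<phi> \<tau> * (f (e * decay \<tau>) / (e * decay \<tau>))) * indicator {0<..} \<tau>) \<partial>lborel)"
    proof (rule nn_integral_mono)
      fix \<tau> :: real
      show "ennreal (\<phi> \<tau> * \<rho> \<tau>) * indicator {0<..} \<tau> \<le>
          ennreal q * (ennreal (\<phi> \<tau> * (f (e * decay \<tau>) / (e * decay \<tau>))) * indicator {0<..} \<tau>)"
      proof (cases "\<tau> > 0")
        case True
        define \<alpha> where "\<alpha> = e * decay \<tau>"
        have \<alpha>: "0 < \<alpha>" "\<alpha> < 1"
        proof -
          show "0 < \<alpha>" using e decay_pos[OF True] by (simp add: \<alpha>_def)
          have "e * decay \<tau> \<le> e * 1" using e by (intro mult_left_mono decay_le_1) simp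
          then show "\<alpha> < 1" using e by (simp only: \<alpha>_def)
        qed
        have b\<alpha>: "b \<tau> = s * \<alpha>" by (simp add: b_def \<alpha>_def)
        have "\<rho> \<tau> \<le> (q * s * f \<alpha>) / (s * \<alpha>)"
          unfolding \<rho>_def b\<alpha> using s(1) \<alpha> by (intro divide_right_mono s(3)) auto
        also have "\<dots> = q * (f \<alpha> / \<alpha>)" using s(1) by simp
        finally have "\<phi> \<tau> * \<rho> \<tau> \<le> \<phi> \<tau> * (q * (f \<alpha> / \<alpha>))"
          using True by (intro mult_left_mono \<phi>_nonneg) auto
        then have "ennreal (\<phi> \<tau> * \<rho> \<tau>) \<le> ennreal (q * (\<phi> \<tau> * (f \<alpha> / \<alpha>)))"
          by (intro ennreal_leI) (simp only: mult.left_commute)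
        also have "\<dots> = ennreal q * ennreal (\<phi> \<tau> * (f \<alpha> / \<alpha>))"
          using q(1) by (intro ennreal_mult') simp
        finally show ?thesis using True by (simp add: \<alpha>_def)
      qed simp
    qed
    also have "\<dots> = ennreal q * J"
      unfolding J_def by (rule nn_integral_cmult) measurable
    also have "\<dots> \<le> ennreal (1 / 2)"
      using q j(2) by (simp only: j(1) ennreal_mult'[symmetric] less_imp_le) (rule ennreal_leI)
    finally show "(\<integral>\<^sup>+\<tau>\<in>{0<..}. ennreal (\<phi> \<tau> * \<rho> \<tau>) \<partial>lborel) \<le> ennreal (1 / 2)" .
  qed
  then show ?thesis using w by blast
qed

end

theorem corollary4p3:
  fixes p :: "real \<Rightarrow> heis \<Rightarrow> real" and f \<phi> :: "real \<Rightarrow> real"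
  assumes "heat_kernel p"
    and "continuous_on {0..} f" and "convex_on {0..} f"
    and "f 0 = 0" and "\<And>v. v > 0 \<Longrightarrow> f v > 0"
    and "(\<integral>\<^sup>+v\<in>{1..}. 1 / lower_ratio f v \<partial>lborel) < \<infinity>"
    and "((\<lambda>v. upper_ratio f v / ennreal v) \<longlongrightarrow> 0) (at_right 0)"
    and "continuous_on {0..} \<phi>" and "\<And>t. t \<ge> 0 \<Longrightarrow> \<phi> t \<ge> 0"
  shows "((\<forall>w\<in>pos_C0_L1.
             (\<integral>\<^sup>+\<tau>\<in>{0<..}. ennreal (\<phi> \<tau> * (f (heat_norm p w \<tau>) / heat_norm p w \<tau>)) \<partial>lborel) = \<infinity>)
           \<longleftrightarrow>
          (\<forall>\<epsilon>>0. (\<integral>\<^sup>+\<tau>\<in>{1..}. ennreal (\<phi> \<tau> * \<tau>\<^sup>2 * f (\<epsilon> * \<tau> powi (-2))) \<partial>lborel) = \<infinity>))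
       \<and> ((\<forall>\<epsilon>>0. (\<integral>\<^sup>+\<tau>\<in>{1..}. ennreal (\<phi> \<tau> * \<tau>\<^sup>2 * f (\<epsilon> * \<tau> powi (-2))) \<partial>lborel) = \<infinity>)
           \<longleftrightarrow>
          (\<forall>u\<^sub>0\<in>pos_C0_L1. \<not> (\<exists>u. global_solution p \<phi> f u\<^sub>0 u)))"
    (is "(?A \<longleftrightarrow> ?B) \<and> (?B \<longleftrightarrow> ?C)")
proof -
  interpret heis_cauchy p f \<phi>
    by unfold_locales (use assms in auto)
  have BA: ?A if ?B
    by (intro ballI blowup_integral_diverges[OF that])
  have BC: ?C if ?B
    using no_global_solution[OF that] by blast
  \<comment> \<open>Failure of (b) refutes (a) and (c) separately, each with its own datum, so both
    converse implications follow by contraposition.\<close>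
  have not_AC: "\<not> ?A \<and> \<not> ?C" if nB: "\<not> ?B"
  proof -
    have "\<exists>\<epsilon>>0. (\<integral>\<^sup>+\<tau>\<in>{1..}. ennreal (\<phi> \<tau> * \<tau>\<^sup>2 * f (\<epsilon> * \<tau> powi (- 2))) \<partial>lborel) \<noteq> \<infinity>"
      using nB by (simp only: not_all not_imp)
    then obtain \<epsilon> where "\<epsilon> > 0"
      "(\<integral>\<^sup>+\<tau>\<in>{1..}. ennreal (\<phi> \<tau> * \<tau>\<^sup>2 * f (\<epsilon> * \<tau> powi (- 2))) \<partial>lborel) \<noteq> \<infinity>"
      by (elim exE conjE)
    then have \<epsilon>: "\<epsilon> > 0"
      "(\<integral>\<^sup>+\<tau>\<in>{1..}. ennreal (\<phi> \<tau> * \<tau>\<^sup>2 * f (\<epsilon> * \<tau> powi (- 2))) \<partial>lborel) < \<infinity>"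
      by (simp_all only: infinity_ennreal_def less_top)
    obtain w where w: "w \<in> pos_C0_L1"
      "(\<integral>\<^sup>+\<tau>\<in>{0<..}. ennreal (\<phi> \<tau> * (f (heat_norm p w \<tau>) / heat_norm p w \<tau>)) \<partial>lborel) \<noteq> \<infinity>"
      using exists_convergent_datum[OF \<epsilon>] by (rule bexE)
    obtain w' u where w': "w' \<in> pos_C0_L1" "global_solution p \<phi> f w' u"
      using exists_datum_global_solution[OF \<epsilon>] by (elim bexE exE)
    have "\<not> ?A"
      using w(2) by (rule contrapos_nn) (erule bspec[OF _ w(1)])
    moreover have "\<not> ?C" using w' by blast
    ultimately show ?thesis by (rule conjI)
  qed
  show ?thesis
  proof (intro conjI iffI)
    show ?A if ?B by (rule BA[OF that])
    show ?C if ?B by (rule BC[OF that])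
    show ?B if A: ?A
    proof (rule ccontr)
      assume "\<not> ?B"
      from conjunct1[OF not_AC[OF this]] A show False by (rule notE)
    qed
    show ?B if C: ?C
    proof (rule ccontr)
      assume "\<not> ?B"
      from conjunct2[OF not_AC[OF this]] C show False by (rule notE)
    qed
  qed
qed

end
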